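(* Let $\epsilon_*\in(0,1)$, let $k_*$ be sufficiently large (depending on $\epsilon_*$), and let $\varphi:[-1,1]\to[-1,1]$ be non-decreasing and odd. Assume that there exist $\delta>0$ and $\lambda>0$ such that $$|\varphi(z_2)-\varphi(z_1)|\le\lambda|z_2-z_1|\qquad\forall z_1,z_2\in[-\delta,\delta].$$ Then for any decreasing sequence $h_k\searrow0$ of positive numbers (with $h_{k_*}<1$), the stationary process specified by the $g$-function on $\{+,-\}\times\{0,1\}$ built from $\epsilon_*,k_*,\varphi,(h_k)$ as described in the context is unique (in law).
   Context: **Processes specified by $g$.** For a finite alphabet $A$ and measurable $g:A\times A^{\mathbb N}\to[0,1]$, a process $(Z_t)_{t\in\mathbb Z}$ with values in $A$ is specified by $g$ if for all $t$ and all $z_t\in A$, $P(Z_t=z_t\mid Z_{t-1}=z_{t-1},Z_{t-2}=z_{t-2},\dots)=g(z_t\mid z_{t-1},z_{t-2},\dots)$ almost surely. **Environment.** $Q$ is the law on $\{0,1\}^{\mathbb Z}$ under which the $\omega_t$ are i.i.d. with $Q(\omega_t=1)=\frac12$. Let $\ell_k=\lceil(1+\epsilon_* )^k\rceil$, $\beta_k=2^{\ell_k}$, $\nu_k=\beta_k/\beta_{k-1}$, and let $I_k$ be the word made of $\ell_k-1$ symbols $1$ followed by one symbol $0$. Intervals are subsets of $\mathbb Z$, $[a,b]=\{a,\dots,b\}$. $I_k$ is seen on $[a,b]$ (with $b-a+1=\ell_k$) if $(\omega_a,\dots,\omega_b)=I_k$. If $I_k$ is seen on two disjoint intervals $[a,b]$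 and $[a',b']$, $b<a'$, but on no other interval contained in $[a,b']$, then $[b,b'-1]$ is called a $k$-block. $Q$-almost surely, for each $k\ge k_*$ the $k$-blocks partition $\mathbb Z$; $B^k(t)=[a^k(t),b^k(t)]$ is the $k$-block containing $t$. For $k>k_*$ each $k$-block $B$ is a disjoint union $b_1\cup\dots\cup b_{N(B)}$ of $(k-1)$-blocks, ordered from left to right, and its beginning is $\mathcal C(B)=\bigcup_{i=1}^{N(B)\wedge\lfloor\nu_k^{1-\epsilon_*}\rfloor}b_i$. For a $k_*$-block $B=[a,b]$, $\mathcal C(B)=\{s\in B:|s-a|\le\beta_{k_*}^{1+\epsilon_*}\}$. **Active points.** For $k\ge k_*$, $t$ is $k$-active if for all $j\in\{k_*,\dots,k\}$: $t\in\mathcal C(B^j(t))$ and $|t-a^j(t)|<\beta_{j+1}$. $\mathcal A_k$ is the set of $k$-active points; for a $k$-block $B$, $\mathcal A(B)=\mathcal A_k\cap B$. Let $k_t=\inf\{k\ge k_*:t\notin\mathcal A_k\}$ ($\inf\varnothing=\infty$), and $S_t=\mathcal A(B^{k_t}(t))$ if $k_*<k_t<\infty$, $S_t=\varnothing$ otherwise. All these depend on $\omega$; $S_t$ and $k_t$ depend only on $(\omega_s)_{s\le t}$. **The $g$-function.** For $x=(x_{t-1},x_{t-2},\dots)\in\{\pm1\}^{\mathbb N}$ set $\psi_t^\omega(x)=h_{k_t}\varphi\bigl(\frac1{|S_t|}\sum_{s\in S_t}x_s\bigr)$ if $S_t\ne\varnothing$ and $|t-a^{k_t}(t)|<\beta_{k_t+1}$,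 and $\psi_t^\omega(x)=0$ otherwise. With $Z_t=(X_t,\omega_t)\in\{+,-\}\times\{0,1\}$, $g\bigl((\pm,\omega_t)\mid(x_{t-1},\omega_{t-1}),(x_{t-2},\omega_{t-2}),\dots\bigr)=\frac14\{1\pm\psi_t^\omega(x_{-\infty}^{t-1})\}$, where $x_{-\infty}^{t-1}=(x_{t-1},x_{t-2},\dots)$. *)

theory Defs
  imports "HOL-Probability.Probability"
begin

section \<open>Processes specified by a g-function\<close>

definition path_space :: "(int \<Rightarrow> 'a) measure" where
  "path_space = PiM UNIV (\<lambda>_. count_space UNIV)"

definition process :: "'w measure \<Rightarrow> (int \<Rightarrow> 'w \<Rightarrow> 'a) \<Rightarrow> bool" where
  "process M Z \<longleftrightarrow> prob_space M \<and> (\<forall>t. Z t \<in> measurable M (count_space UNIV))"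

definition stationary :: "'w measure \<Rightarrow> (int \<Rightarrow> 'w \<Rightarrow> 'a) \<Rightarrow> bool" where
  "stationary M Z \<longleftrightarrow>
     (\<forall>s. distr M path_space (\<lambda>w t. Z (t + s) w) = distr M path_space (\<lambda>w t. Z t w))"

definition past :: "(int \<Rightarrow> 'w \<Rightarrow> 'a) \<Rightarrow> int \<Rightarrow> 'w \<Rightarrow> nat \<Rightarrow> 'a" where
  "past Z t w = (\<lambda>n. Z (t - 1 - int n) w)"

definition past_algebra :: "'w measure \<Rightarrow> (int \<Rightarrow> 'w \<Rightarrow> 'a) \<Rightarrow> int \<Rightarrow> 'w measure" where
  "past_algebra M Z t = vimage_algebra (space M) (past Z t) (PiM UNIV (\<lambda>_. count_space UNIV))"

definition specified_by ::
  "'w measure \<Rightarrow> (int \<Rightarrow> 'w \<Rightarrow> 'a) \<Rightarrow> ('a \<Rightarrow> (nat \<Rightarrow> 'a) \<Rightarrow> real) \<Rightarrow> bool" where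
  "specified_by M Z g \<longleftrightarrow>
     (\<forall>t z. AE w in M. real_cond_exp M (past_algebra M Z t) (indicator {w \<in> space M. Z t w = z}) w
                         = g z (past Z t w))"

section \<open>Blocks of the environment\<close>

text \<open>The symbols 1 and 0 of the environment are \<^const>\<open>True\<close> and \<^const>\<open>False\<close>.
  The parameters \<^term>\<open>e\<close> and \<^term>\<open>ks\<close> are $\epsilon_*$ and $k_*$.\<close>

definition ell :: "real \<Rightarrow> nat \<Rightarrow> nat" where
  "ell e k = nat \<lceil>(1 + e) ^ k\<rceil>"

definition beta :: "real \<Rightarrow> nat \<Rightarrow> real" where
  "beta e k = 2 ^ ell e k"

definition nu :: "real \<Rightarrow> nat \<Rightarrow> real" where
  "nu e k = beta e k / beta e (k - 1)"

definition I_word :: "real \<Rightarrow> nat \<Rightarrow> bool list" where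
  "I_word e k = replicate (ell e k - 1) True @ [False]"

definition seen :: "real \<Rightarrow> (int \<Rightarrow> bool) \<Rightarrow> nat \<Rightarrow> int \<Rightarrow> int \<Rightarrow> bool" where
  "seen e \<omega> k a b \<longleftrightarrow> b - a + 1 = int (ell e k) \<and> map \<omega> [a..b] = I_word e k"

definition is_block :: "real \<Rightarrow> (int \<Rightarrow> bool) \<Rightarrow> nat \<Rightarrow> int set \<Rightarrow> bool" where
  "is_block e \<omega> k B \<longleftrightarrow>
     (\<exists>a b a' b'. seen e \<omega> k a b \<and> seen e \<omega> k a' b' \<and> b < a' \<and>
        (\<forall>c d. seen e \<omega> k c d \<and> {c..d} \<subseteq> {a..b'} \<longrightarrow> (c, d) = (a, b) \<or> (c, d) = (a', b')) \<and>
        B = {b..b' - 1})"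

text \<open>A point lies in at most one block, and almost surely in exactly one.\<close>

definition block_of :: "real \<Rightarrow> (int \<Rightarrow> bool) \<Rightarrow> nat \<Rightarrow> int \<Rightarrow> int set" where
  "block_of e \<omega> k t = (THE B. is_block e \<omega> k B \<and> t \<in> B)"

definition block_start :: "real \<Rightarrow> (int \<Rightarrow> bool) \<Rightarrow> nat \<Rightarrow> int \<Rightarrow> int" where
  "block_start e \<omega> k t = Min (block_of e \<omega> k t)"

text \<open>In the second case of the following definition, the cardinality is the index of \<^term>\<open>b\<close>
  in the left-to-right enumeration $b_1, \dots, b_{N(B)}$ of the (k-1)-blocks contained in
  \<^term>\<open>B\<close>.\<close>

definition beginning :: "real \<Rightarrow> nat \<Rightarrow> (int \<Rightarrow> bool) \<Rightarrow> nat \<Rightarrow> int set \<Rightarrow> int set" where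
  "beginning e ks \<omega> k B =
     (if k = ks then {s \<in> B. real_of_int \<bar>s - Min B\<bar> \<le> beta e ks powr (1 + e)}
      else \<Union>{b. is_block e \<omega> (k - 1) b \<and> b \<subseteq> B \<and>
               int (card {b'. is_block e \<omega> (k - 1) b' \<and> b' \<subseteq> B \<and> Min b' \<le> Min b})
                 \<le> \<lfloor>nu e k powr (1 - e)\<rfloor>})"

section \<open>Active points\<close>

definition active :: "real \<Rightarrow> nat \<Rightarrow> (int \<Rightarrow> bool) \<Rightarrow> nat \<Rightarrow> int set" where
  "active e ks \<omega> k =
     {t. \<forall>j\<in>{ks..k}. t \<in> beginning e ks \<omega> j (block_of e \<omega> j t) \<and>
                     real_of_int \<bar>t - block_start e \<omega> j t\<bar> < beta e (j + 1)}"

definition k_index :: "real \<Rightarrow> nat \<Rightarrow> (int \<Rightarrow> bool) \<Rightarrow> int \<Rightarrow> enat" where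
  "k_index e ks \<omega> t = Inf {enat k | k. ks \<le> k \<and> t \<notin> active e ks \<omega> k}"

definition S_set :: "real \<Rightarrow> nat \<Rightarrow> (int \<Rightarrow> bool) \<Rightarrow> int \<Rightarrow> int set" where
  "S_set e ks \<omega> t =
     (case k_index e ks \<omega> t of
        enat k \<Rightarrow> if ks < k then active e ks \<omega> k \<inter> block_of e \<omega> k t else {}
      | \<infinity> \<Rightarrow> {})"

section \<open>The g-function\<close>

definition spin :: "bool \<Rightarrow> real" where
  "spin x = (if x then 1 else - 1)"

text \<open>The past \<^term>\<open>x\<close> is listed backwards from time t - 1, so that the spin at time s is
  entry t - 1 - s. Almost surely every s in the sum satisfies s < t.\<close>

definition psi ::
  "real \<Rightarrow> nat \<Rightarrow> (real \<Rightarrow> real) \<Rightarrow> (nat \<Rightarrow> real) \<Rightarrow> (int \<Rightarrow> bool) \<Rightarrow> int \<Rightarrow> (nat \<Rightarrow> bool) \<Rightarrow> real" where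
  "psi e ks \<phi> h \<omega> t x =
     (case k_index e ks \<omega> t of
        enat k \<Rightarrow>
          if S_set e ks \<omega> t \<noteq> {} \<and> real_of_int \<bar>t - block_start e \<omega> k t\<bar> < beta e (k + 1)
          then h k * \<phi> ((\<Sum>s\<in>S_set e ks \<omega> t. spin (x (nat (t - 1 - s)))) / real (card (S_set e ks \<omega> t)))
          else 0
      | \<infinity> \<Rightarrow> 0)"

text \<open>By translation covariance the g-function is evaluated at t = 0. Since \<^const>\<open>psi\<close> at time 0
  depends (almost surely) only on the environment up to time 0, the environment may be continued
  to positive times by any configuration containing all the words \<^const>\<open>I_word\<close>, so that all the
  blocks containing 0 exist. Here the symbol 0 is put exactly at the positive perfect squares.\<close>

definition environment :: "bool \<Rightarrow> (nat \<Rightarrow> bool) \<Rightarrow> int \<Rightarrow> bool" where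
  "environment w0 w s =
     (if s = 0 then w0 else if s < 0 then w (nat (- 1 - s)) else \<not> (\<exists>m. s = m\<^sup>2))"

definition gfun ::
  "real \<Rightarrow> nat \<Rightarrow> (real \<Rightarrow> real) \<Rightarrow> (nat \<Rightarrow> real) \<Rightarrow> bool \<times> bool \<Rightarrow> (nat \<Rightarrow> bool \<times> bool) \<Rightarrow> real" where
  "gfun e ks \<phi> h z p =
     1 / 4 * (1 + spin (fst z) * psi e ks \<phi> h (environment (snd z) (snd \<circ> p)) 0 (fst \<circ> p))"

end

theory Submission
  imports Defs "HOL-Real_Asymp.Real_Asymp"
begin

text \<open>
  Given the environment, let X be generated from i.i.d. uniform variables U by the rule that
  X(t) = 1 iff U(t) is at most (1 + psi(t)) / 2. As the rule is monotone in the past spins and reads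
  only finitely many of them, iterating it from the all-plus and the all-minus configuration yields
  a largest and a smallest solution. The largest solution gives existence. Conversely, every
  specified process solves the rule for suitable U, so uniqueness follows once the two extremal
  solutions agree almost surely.

  By Borel-Cantelli, for large k the block B of level k containing t is not in the beginning of the
  block B' of level k + 1. All active spins of B then see only the mean m' of the active spins of B',
  hence the means of the extremal solutions satisfy
  E(m+ - m-) = h(k+1) E(phi(m'+) - phi(m'-)). As h tends to 0, Hoeffding's inequality confines m'
  to the interval where phi is Lipschitz, up to an event that is exponentially unlikely in the number
  of active points of B'. The expected difference therefore contracts in each step and, for a level
  minimizing the number n of active points, is at most of order exp(-cn). This beats the
  factor n lost in passing to the event that some of the n active spins disagree.
\<close>

section \<open>Marks and blocks\<close>

text \<open>The g-function is defined through blocks, whose right ends lie in the future, and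
  through a fixed artificial continuation of the environment. The drift depends visibly on the past
  alone; the two agree once words of all levels occur arbitrarily far to the left and to the right.
  The g-function is therefore explicit only almost surely, and for an arbitrary specified process
  the environment has to be identified as fair coin tossing before the spins can be examined. This
  is possible because the probabilities of the two spins always add up to 1/2 for each bit. Nothing
  forces the number of active points to be monotone in the level. The contraction collects an error
  from every level above the chosen one, and the choice of a level with the fewest active points
  bounds all of them by one exponential b. The recursion a \<le> a'/2 + 2b, started from the trivial
  bound 2 arbitrarily many levels up, leaves only 4b. The uniform variables of a specified process
  do not live on its own probability space; they are built from the process and independent
  auxiliary noise.\<close>

text \<open>
  A mark of level k is the right end of an occurrence of the word of level k. Occurrences never
  overlap, so the k-blocks are the intervals between consecutive marks. Everything is read off the
  past of t, whose points are addressed by their distance n from t: the gap of t is the distance to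
  the first point of its k-block (junk if there is no mark up to t), and the mark count is the index
  of the (k-1)-block of t within its k-block.
\<close>

definition mark :: "real \<Rightarrow> nat \<Rightarrow> (int \<Rightarrow> bool) \<Rightarrow> int \<Rightarrow> bool" where
  "mark e k \<omega> b \<longleftrightarrow> \<not> \<omega> b \<and> (\<forall>i\<in>{1..<int (ell e k)}. \<omega> (b - i))"

definition marked :: "real \<Rightarrow> nat \<Rightarrow> (int \<Rightarrow> bool) \<Rightarrow> bool" where
  "marked e k \<omega> \<longleftrightarrow> (\<forall>t. \<exists>n. mark e k \<omega> (t - int n))"

definition gap :: "real \<Rightarrow> nat \<Rightarrow> (int \<Rightarrow> bool) \<Rightarrow> int \<Rightarrow> nat" where
  "gap e k \<omega> t = (LEAST n. mark e k \<omega> (t - int n))"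

definition mark_count :: "real \<Rightarrow> nat \<Rightarrow> (int \<Rightarrow> bool) \<Rightarrow> int \<Rightarrow> nat" where
  "mark_count e k \<omega> t = card {n. n \<le> gap e k \<omega> t \<and> mark e (k - 1) \<omega> (t - int n)}"

definition early :: "real \<Rightarrow> nat \<Rightarrow> nat \<Rightarrow> (int \<Rightarrow> bool) \<Rightarrow> int \<Rightarrow> bool" where
  "early e ks j \<omega> t \<longleftrightarrow>
     (if j = ks then real (gap e j \<omega> t) \<le> beta e ks powr (1 + e)
      else int (mark_count e j \<omega> t) \<le> \<lfloor>nu e j powr (1 - e)\<rfloor>) \<and>
     real (gap e j \<omega> t) < beta e (j + 1)"

definition active_at :: "real \<Rightarrow> nat \<Rightarrow> nat \<Rightarrow> (int \<Rightarrow> bool) \<Rightarrow> int \<Rightarrow> bool" where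
  "active_at e ks k \<omega> t \<longleftrightarrow> (\<forall>j\<in>{ks..k}. early e ks j \<omega> t)"

definition level :: "real \<Rightarrow> nat \<Rightarrow> (int \<Rightarrow> bool) \<Rightarrow> int \<Rightarrow> nat" where
  "level e ks \<omega> t = (LEAST k. ks \<le> k \<and> \<not> active_at e ks k \<omega> t)"

text \<open>The distances from t to the points of S_t. Only points strictly to the left of t are
  listed; that none is lost is part of \<open>S_set_eq\<close>. The existence clause is needed
  because \<open>level\<close> is an arbitrary number when t is active at all levels.\<close>

definition offsets :: "real \<Rightarrow> nat \<Rightarrow> (int \<Rightarrow> bool) \<Rightarrow> int \<Rightarrow> nat set" where
  "offsets e ks \<omega> t =
     {n. (\<exists>k\<ge>ks. \<not> active_at e ks k \<omega> t) \<and> ks < level e ks \<omega> t \<and>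
         1 \<le> n \<and> n \<le> gap e (level e ks \<omega> t) \<omega> t \<and> active_at e ks (level e ks \<omega> t) \<omega> (t - int n)}"

definition mean :: "nat set \<Rightarrow> int \<Rightarrow> (int \<Rightarrow> bool) \<Rightarrow> real" where
  "mean N t x = (\<Sum>n\<in>N. spin (x (t - int n))) / real (card N)"

text \<open>The past-only form of \<open>psi\<close>. The spins are a configuration on all integers
  instead of a list read backwards, so that one formula serves every time t.\<close>

definition drift ::
  "real \<Rightarrow> nat \<Rightarrow> (real \<Rightarrow> real) \<Rightarrow> (nat \<Rightarrow> real) \<Rightarrow> (int \<Rightarrow> bool) \<Rightarrow> int \<Rightarrow> (int \<Rightarrow> bool) \<Rightarrow> real" where
  "drift e ks \<phi> h \<omega> t x =
     (if offsets e ks \<omega> t \<noteq> {} \<and>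
         real (gap e (level e ks \<omega> t) \<omega> t) < beta e (level e ks \<omega> t + 1)
      then h (level e ks \<omega> t) * \<phi> (mean (offsets e ks \<omega> t) t x) else 0)"

lemma ell_pos: "0 < e \<Longrightarrow> 0 < ell e k"
  by (simp add: ell_def)

lemma ell_mono: "0 < e \<Longrightarrow> k \<le> k' \<Longrightarrow> ell e k \<le> ell e k'"
  unfolding ell_def by (intro nat_mono ceiling_mono power_increasing) auto

lemma mark_mono: "0 < e \<Longrightarrow> k \<le> k' \<Longrightarrow> mark e k' \<omega> b \<Longrightarrow> mark e k \<omega> b"
  using ell_mono[of e k k'] by (auto simp: mark_def)

text \<open>The word has its only 0 at the end. An overlap would put the final 0 of the left
  occurrence where the right one has a 1.\<close>

lemma mark_separated:
  assumes "mark e k \<omega> b" "mark e k \<omega> b'" "b < b'"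
  shows "b + int (ell e k) \<le> b'"
proof (rule ccontr)
  assume "\<not> ?thesis"
  then have "b' - b \<in> {1..<int (ell e k)}" using assms(3) by auto
  then have "\<omega> (b' - (b' - b))" using assms(2) unfolding mark_def by blast
  then show False using assms(1) by (simp add: mark_def)
qed

lemma map_eq_replicate: "map f xs = replicate n c \<longleftrightarrow> length xs = n \<and> (\<forall>x\<in>set xs. f x = c)"
  by (auto simp: list_eq_iff_nth_eq all_set_conv_all_nth)

lemma seen_iff:
  assumes "0 < e"
  shows "seen e \<omega> k a b \<longleftrightarrow> mark e k \<omega> b \<and> a = b - int (ell e k) + 1"
proof -
  have "seen e \<omega> k a b \<longleftrightarrow> mark e k \<omega> b" if "b - a + 1 = int (ell e k)"
  proof -
    have "a \<le> b" using that ell_pos[OF assms, of k] by linarith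
    then have ab: "[a..b] = [a..b - 1] @ [b]" by (rule upto_rec2)
    have "nat (b - a) = ell e k - 1" using that by linarith
    then have *: "map \<omega> [a..b] = I_word e k \<longleftrightarrow> (\<forall>x\<in>{a..b - 1}. \<omega> x) \<and> \<not> \<omega> b"
      unfolding ab I_word_def by (simp add: map_eq_replicate)
    have "(\<forall>x\<in>{a..b - 1}. \<omega> x) \<longleftrightarrow> (\<forall>i\<in>{1..<int (ell e k)}. \<omega> (b - i))"
    proof safe
      fix i assume "\<forall>x\<in>{a..b - 1}. \<omega> x" "i \<in> {1..<int (ell e k)}"
      then show "\<omega> (b - i)" using that by auto
    next
      fix x assume *: "\<forall>i\<in>{1..<int (ell e k)}. \<omega> (b - i)" "x \<in> {a..b - 1}"
      then have "b - x \<in> {1..<int (ell e k)}" using that by auto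
      then have "\<omega> (b - (b - x))" using * by blast
      then show "\<omega> x" by simp
    qed
    then show ?thesis unfolding seen_def mark_def using that * by auto
  qed
  moreover have "seen e \<omega> k a b \<Longrightarrow> b - a + 1 = int (ell e k)" by (simp add: seen_def)
  ultimately show ?thesis by (auto simp: algebra_simps)
qed

text \<open>Occurrences are determined by their right ends and do not overlap, so "no other
  occurrence inside [a, b']" means that no mark lies strictly between b and b', and the disjointness
  b < a' follows from b < b'.\<close>

lemma is_block_iff:
  assumes "0 < e"
  shows "is_block e \<omega> k B \<longleftrightarrow>
    (\<exists>b b'. mark e k \<omega> b \<and> mark e k \<omega> b' \<and> b < b' \<and> (\<forall>c. b < c \<and> c < b' \<longrightarrow> \<not> mark e k \<omega> c) \<and>
            B = {b..b' - 1})" (is "_ = ?R")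
proof
  assume "is_block e \<omega> k B"
  then obtain a b a' b' where *: "seen e \<omega> k a b" "seen e \<omega> k a' b'" "b < a'"
    and only: "\<And>c d. seen e \<omega> k c d \<Longrightarrow> {c..d} \<subseteq> {a..b'} \<Longrightarrow> (c, d) = (a, b) \<or> (c, d) = (a', b')"
    and B: "B = {b..b' - 1}"
    unfolding is_block_def by blast
  have m: "mark e k \<omega> b" "mark e k \<omega> b'" "a = b - int (ell e k) + 1" "a' = b' - int (ell e k) + 1"
    using * by (auto simp: seen_iff[OF assms])
  have bb: "b < b'" using *(3) m(4) ell_pos[OF assms, of k] by linarith
  have "\<not> mark e k \<omega> c" if "b < c" "c < b'" for c
  proof
    assume "mark e k \<omega> c"
    then have "seen e \<omega> k (c - int (ell e k) + 1) c" by (simp add: seen_iff[OF assms])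
    from only[OF this] show False using that m(3) by auto
  qed
  then show ?R using m bb B by blast
next
  assume ?R
  then obtain b b' where *: "mark e k \<omega> b" "mark e k \<omega> b'" "b < b'"
    "\<And>c. b < c \<Longrightarrow> c < b' \<Longrightarrow> \<not> mark e k \<omega> c" and B: "B = {b..b' - 1}" by blast
  have l: "int (ell e k) > 0" using ell_pos[OF assms, of k] by simp
  show "is_block e \<omega> k B"
    unfolding is_block_def
  proof (intro exI conjI allI impI)
    show "seen e \<omega> k (b - int (ell e k) + 1) b" "seen e \<omega> k (b' - int (ell e k) + 1) b'"
      using * by (simp_all add: seen_iff[OF assms])
    show "b < b' - int (ell e k) + 1" using mark_separated[OF *(1-3)] by simp
    show "B = {b..b' - 1}" by (rule B)
    fix c d assume cd: "seen e \<omega> k c d \<and> {c..d} \<subseteq> {b - int (ell e k) + 1..b'}"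
    then have s: "mark e k \<omega> d" "c = d - int (ell e k) + 1" by (auto simp: seen_iff[OF assms])
    then have "b \<le> d" "d \<le> b'" using cd l by auto
    then have "d = b \<or> d = b'" using *(4)[of d] s(1) by force
    then show "(c, d) = (b - int (ell e k) + 1, b) \<or> (c, d) = (b' - int (ell e k) + 1, b')"
      using s by auto
  qed
qed

lemma gap_mark: "marked e k \<omega> \<Longrightarrow> mark e k \<omega> (t - int (gap e k \<omega> t))"
  unfolding gap_def marked_def by (rule LeastI_ex) blast

lemma gap_le: "mark e k \<omega> (t - int n) \<Longrightarrow> gap e k \<omega> t \<le> n"
  unfolding gap_def by (rule Least_le)

lemma not_mark_gap: "n < gap e k \<omega> t \<Longrightarrow> \<not> mark e k \<omega> (t - int n)"
  unfolding gap_def by (rule not_less_Least)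

lemma gap_shift:
  assumes "marked e k \<omega>" "n \<le> gap e k \<omega> t"
  shows "gap e k \<omega> (t - int n) = gap e k \<omega> t - n"
proof (rule antisym)
  have "mark e k \<omega> (t - int n - int (gap e k \<omega> t - n))"
    using gap_mark[OF assms(1), of t] assms(2) by (simp add: of_nat_diff)
  then show "gap e k \<omega> (t - int n) \<le> gap e k \<omega> t - n" by (rule gap_le)
  have "mark e k \<omega> (t - int (n + gap e k \<omega> (t - int n)))"
    using gap_mark[OF assms(1), of "t - int n"] by (simp add: algebra_simps)
  from gap_le[OF this] show "gap e k \<omega> t - n \<le> gap e k \<omega> (t - int n)" by simp
qed

lemma gap_mono:
  assumes "0 < e" "marked e k' \<omega>" "k \<le> k'"
  shows "gap e k \<omega> t \<le> gap e k' \<omega> t"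
  by (rule gap_le, rule mark_mono[OF assms(1,3)], rule gap_mark[OF assms(2)])

lemma mark_count_shift_le:
  assumes "marked e k \<omega>" "n \<le> gap e k \<omega> t"
  shows "mark_count e k \<omega> (t - int n) \<le> mark_count e k \<omega> t"
  unfolding mark_count_def gap_shift[OF assms]
  by (rule card_inj_on_le[where f = "\<lambda>m. m + n"])
     (use assms(2) in \<open>auto simp: algebra_simps intro: finite_subset[of _ "{..gap e k \<omega> t}"]\<close>)

text \<open>Moving left inside one (k-1)-block passes no (k-1)-mark, so all its points share the
  same index in the k-block.\<close>

lemma mark_count_shift_eq:
  assumes "marked e k \<omega>" "n \<le> gap e (k - 1) \<omega> t" "n \<le> gap e k \<omega> t"
  shows "mark_count e k \<omega> (t - int n) = mark_count e k \<omega> t"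
proof -
  have "{m. m \<le> gap e k \<omega> t \<and> mark e (k - 1) \<omega> (t - int m)} =
        (\<lambda>m. m + n) ` {m. m \<le> gap e k \<omega> t - n \<and> mark e (k - 1) \<omega> (t - int n - int m)}"
  proof safe
    fix m assume m: "m \<le> gap e k \<omega> t" "mark e (k - 1) \<omega> (t - int m)"
    then have "n \<le> m" using not_mark_gap[of m e "k - 1" \<omega> t] assms(2) by (meson le_trans linorder_not_less)
    then show "m \<in> (\<lambda>m. m + n) ` {m. m \<le> gap e k \<omega> t - n \<and> mark e (k - 1) \<omega> (t - int n - int m)}"
      using m by (intro image_eqI[of _ _ "m - n"]) (auto simp: of_nat_diff)
  qed (use assms(3) in \<open>auto simp: algebra_simps\<close>)
  then show ?thesis
    unfolding mark_count_def gap_shift[OF assms(1,3)] by (simp add: card_image)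
qed

text \<open>Both the gap and the mark count decrease towards the left end of the block, hence the
  early points form an initial piece of it.\<close>

lemma early_shift:
  assumes "marked e k \<omega>" "n \<le> gap e k \<omega> t" "early e ks k \<omega> t"
  shows "early e ks k \<omega> (t - int n)"
  using mark_count_shift_le[OF assms(1,2)] assms(3) gap_shift[OF assms(1,2)]
  unfolding early_def by (auto split: if_splits)

text \<open>The left end of the block is the last mark up to t, the right end comes from the first
  mark b after t. A block as a set needs both, which is why a mark in the future of t must be
  assumed.\<close>

lemma block_of_ex:
  assumes "0 < e" "marked e k \<omega>" and nxt: "\<exists>b>t. mark e k \<omega> b"
  shows "\<exists>b. t < b \<and> mark e k \<omega> b \<and> (\<forall>c. t - int (gap e k \<omega> t) < c \<longrightarrow> c < b \<longrightarrow> \<not> mark e k \<omega> c) \<and>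
    is_block e \<omega> k (block_of e \<omega> k t) \<and> block_of e \<omega> k t = {t - int (gap e k \<omega> t)..b - 1}"
proof -
  define N where "N = (LEAST n. mark e k \<omega> (t + 1 + int n))"
  define b where "b = t + 1 + int N"
  obtain b0 where "b0 > t" "mark e k \<omega> b0" using nxt by blast
  then have ex: "mark e k \<omega> (t + 1 + int (nat (b0 - t - 1)))" by simp
  have bm: "mark e k \<omega> b" unfolding b_def N_def by (rule LeastI, rule ex)
  have no: "\<not> mark e k \<omega> c" if "t - int (gap e k \<omega> t) < c" "c < b" for c
  proof (cases "c \<le> t")
    case True
    then show ?thesis using not_mark_gap[of "nat (t - c)" e k \<omega> t] that by simp
  next
    case False
    then have "\<not> mark e k \<omega> (t + 1 + int (nat (c - t - 1)))"
      using that(2) unfolding b_def N_def by (intro not_less_Least) linarith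
    then show ?thesis using False by simp
  qed
  have gm: "mark e k \<omega> (t - int (gap e k \<omega> t))" by (rule gap_mark[OF assms(2)])
  have blk: "is_block e \<omega> k {t - int (gap e k \<omega> t)..b - 1}"
    unfolding is_block_iff[OF assms(1)] using gm bm no
    by (intro exI[of _ "t - int (gap e k \<omega> t)"] exI[of _ b]) (auto simp: b_def)
  have "block_of e \<omega> k t = {t - int (gap e k \<omega> t)..b - 1}"
    unfolding block_of_def
  proof (rule the_equality)
    show "is_block e \<omega> k {t - int (gap e k \<omega> t)..b - 1} \<and> t \<in> {t - int (gap e k \<omega> t)..b - 1}"
      using blk by (simp add: b_def)
    fix B assume "is_block e \<omega> k B \<and> t \<in> B"
    then obtain c c' where c: "mark e k \<omega> c" "mark e k \<omega> c'" "c < c'"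
      "\<And>d. c < d \<Longrightarrow> d < c' \<Longrightarrow> \<not> mark e k \<omega> d" "B = {c..c' - 1}" "c \<le> t" "t < c'"
      unfolding is_block_iff[OF assms(1)] by auto
    have "\<not> t - int (gap e k \<omega> t) < c" using no[of c] c(1,6) by (auto simp: b_def)
    moreover have "\<not> c < t - int (gap e k \<omega> t)" using c(4)[of "t - int (gap e k \<omega> t)"] gm c(7) by auto
    moreover have "\<not> c' < b" using no[of c'] c(2,7) by force
    moreover have "\<not> b < c'" using c(4)[of b] bm c(6) by (auto simp: b_def)
    ultimately show "B = {t - int (gap e k \<omega> t)..b - 1}" using c(5) by force
  qed
  moreover have "t < b" by (simp add: b_def)
  ultimately show ?thesis using bm no blk by metis
qed

lemma block_start_eq:
  assumes "0 < e" "marked e k \<omega>" "\<exists>b>t. mark e k \<omega> b"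
  shows "block_start e \<omega> k t = t - int (gap e k \<omega> t)"
proof -
  obtain b where "t < b" "mark e k \<omega> b" "\<And>c. t - int (gap e k \<omega> t) < c \<Longrightarrow> c < b \<Longrightarrow> \<not> mark e k \<omega> c"
    "is_block e \<omega> k (block_of e \<omega> k t)" "block_of e \<omega> k t = {t - int (gap e k \<omega> t)..b - 1}"
    using block_of_ex[OF assms] by blast
  then show ?thesis unfolding block_start_def by (auto intro!: Min_eqI)
qed

lemma block_of_unique:
  assumes "0 < e" "is_block e \<omega> k B" "t \<in> B"
  shows "block_of e \<omega> k t = B"
  unfolding block_of_def
proof (rule the_equality)
  fix C assume "is_block e \<omega> k C \<and> t \<in> C"
  then obtain c c' where c: "mark e k \<omega> c" "mark e k \<omega> c'" 
      "\<And>d. c < d \<Longrightarrow> d < c' \<Longrightarrow> \<not> mark e k \<omega> d" "C = {c..c' - 1}" "c \<le> t" "t < c'"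
      unfolding is_block_iff[OF assms(1)] by auto
  obtain b b' where b: "mark e k \<omega> b" "mark e k \<omega> b'" 
      "\<And>d. b < d \<Longrightarrow> d < b' \<Longrightarrow> \<not> mark e k \<omega> d" "B = {b..b' - 1}" "b \<le> t" "t < b'"
      using assms(2,3) unfolding is_block_iff[OF assms(1)] by auto
  have "\<not> c < b" "\<not> b < c" "\<not> c' < b'" "\<not> b' < c'"
    using b c by (meson le_less_trans less_le_trans)+
  then have "b = c" "b' = c'" by auto
  then show "C = B" using b c by simp
qed (use assms in simp)

section \<open>Translation of blocks, beginnings and active points into functions of the
  past\<close>

context
  fixes e :: real and ks :: nat and \<omega> :: "int \<Rightarrow> bool"
  assumes e: "0 < e"
    and left: "\<And>k. ks \<le> k \<Longrightarrow> marked e k \<omega>"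
    and right: "\<And>k t. ks \<le> k \<Longrightarrow> \<exists>b>t. mark e k \<omega> b"
begin

text \<open>A (k-1)-block inside B is determined by its left end. The blocks up to that of t thus
  correspond to the (k-1)-marks between the left end of B and t.\<close>

lemma card_blocks_eq_mark_count:
  assumes "ks < k" and B: "B = block_of e \<omega> k t"
  shows "card {b. is_block e \<omega> (k - 1) b \<and> b \<subseteq> B \<and> Min b \<le> Min (block_of e \<omega> (k - 1) t)} = mark_count e k \<omega> t"
proof -
  let ?N = "{n. n \<le> gap e k \<omega> t \<and> mark e (k - 1) \<omega> (t - int n)}"
  let ?Bs = "{b. is_block e \<omega> (k - 1) b \<and> b \<subseteq> B \<and> Min b \<le> Min (block_of e \<omega> (k - 1) t)}"
  have k: "ks \<le> k" "ks \<le> k - 1" "k - 1 \<le> k" using assms by auto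
  obtain b' where b': "t < b'" "mark e k \<omega> b'"
    "\<And>c. t - int (gap e k \<omega> t) < c \<Longrightarrow> c < b' \<Longrightarrow> \<not> mark e k \<omega> c"
    "is_block e \<omega> k B" "B = {t - int (gap e k \<omega> t)..b' - 1}"
    using B block_of_ex[OF e left[OF k(1)] right[OF k(1)], of t] by blast
  have Mt: "Min (block_of e \<omega> (k - 1) s) = s - int (gap e (k - 1) \<omega> s)" for s
    using block_start_eq[OF e left[OF k(2)] right[OF k(2)], of s] by (simp add: block_start_def)
  have "bij_betw (\<lambda>n. block_of e \<omega> (k - 1) (t - int n))
          ?N
          ?Bs"
  proof (rule bij_betw_imageI)
    have g0: "gap e (k - 1) \<omega> (t - int n) = 0" if "mark e (k - 1) \<omega> (t - int n)" for n
      using gap_le[of e "k - 1" \<omega> "t - int n" 0] that by simp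
    show "inj_on (\<lambda>n. block_of e \<omega> (k - 1) (t - int n)) ?N"
    proof (rule inj_onI)
      fix n m assume *: "n \<in> ?N"
        "m \<in> ?N"
        "block_of e \<omega> (k - 1) (t - int n) = block_of e \<omega> (k - 1) (t - int m)"
      have "Min (block_of e \<omega> (k - 1) (t - int n)) = Min (block_of e \<omega> (k - 1) (t - int m))"
        by (rule arg_cong[OF *(3)])
      then show "n = m" unfolding Mt using g0[of n] g0[of m] *(1,2) by simp
    qed
    show "(\<lambda>n. block_of e \<omega> (k - 1) (t - int n)) ` ?N =
          ?Bs"
    proof (intro equalityI subsetI)
      fix b assume "b \<in> (\<lambda>n. block_of e \<omega> (k - 1) (t - int n)) ` ?N"
      then obtain n where n: "n \<le> gap e k \<omega> t" "mark e (k - 1) \<omega> (t - int n)"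
        and b: "b = block_of e \<omega> (k - 1) (t - int n)" by auto
      obtain c where c: "t - int n < c" "mark e (k - 1) \<omega> c"
        "\<And>d. t - int n < d \<Longrightarrow> d < c \<Longrightarrow> \<not> mark e (k - 1) \<omega> d"
        "is_block e \<omega> (k - 1) b" "b = {t - int n..c - 1}"
        using block_of_ex[OF e left[OF k(2)] right[OF k(2)], of "t - int n"]
        unfolding b[symmetric] g0[OF n(2)] by auto
      \<comment> \<open>The mark that ends B is also a (k-1)-mark, so a (k-1)-block starting in B
        cannot reach beyond B.\<close>
      have "mark e (k - 1) \<omega> b'" using mark_mono[OF e k(3) b'(2)] .
      then have "c \<le> b'" using c(3)[of b'] b'(1) by force
      then have "b \<subseteq> B" using c(5) b'(5) n(1) by auto
      moreover have "Min b \<le> Min (block_of e \<omega> (k - 1) t)"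
        unfolding b Mt g0[OF n(2)] using gap_le[OF n(2)] by simp
      ultimately show "b \<in> ?Bs"
        using c(4) by simp
    next
      fix b assume "b \<in> ?Bs"
      then have b: "is_block e \<omega> (k - 1) b" "b \<subseteq> B" "Min b \<le> t - int (gap e (k - 1) \<omega> t)"
        unfolding Mt by auto
      then obtain c c' where c: "mark e (k - 1) \<omega> c" "c < c'" "b = {c..c' - 1}"
        unfolding is_block_iff[OF e] by blast
      have "Min b = c" using c by (auto intro!: Min_eqI)
      then have ct: "c \<le> t" using b(3) by linarith
      have cB: "c \<in> b" using c by simp
      then have "t - int (gap e k \<omega> t) \<le> c" using b(2) b'(5) by auto
      then have ng: "nat (t - c) \<le> gap e k \<omega> t" by linarith
      show "b \<in> (\<lambda>n. block_of e \<omega> (k - 1) (t - int n)) ` ?N"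
        by (rule image_eqI[of _ _ "nat (t - c)"])
           (use block_of_unique[OF e b(1) cB] ct c(1) ng in auto)
    qed
  qed
  then show ?thesis unfolding mark_count_def by (simp add: bij_betw_same_card)
qed

text \<open>The (k-1)-block of t is the only one containing t and lies inside the k-block of t, so
  membership in the union is decided by the index of this single block.\<close>

lemma mem_beginning_iff:
  assumes "ks \<le> k"
  shows "t \<in> beginning e ks \<omega> k (block_of e \<omega> k t) \<longleftrightarrow>
    (if k = ks then real (gap e k \<omega> t) \<le> beta e ks powr (1 + e)
     else int (mark_count e k \<omega> t) \<le> \<lfloor>nu e k powr (1 - e)\<rfloor>)"
proof -
  obtain b' where b': "t < b'" "mark e k \<omega> b'"
    "\<And>c. t - int (gap e k \<omega> t) < c \<Longrightarrow> c < b' \<Longrightarrow> \<not> mark e k \<omega> c"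
    "is_block e \<omega> k (block_of e \<omega> k t)" "block_of e \<omega> k t = {t - int (gap e k \<omega> t)..b' - 1}"
    using block_of_ex[OF e left[OF assms] right[OF assms], of t] by blast
  show ?thesis
  proof (cases "k = ks")
    case True
    have "Min (block_of e \<omega> k t) = t - int (gap e k \<omega> t)"
      using block_start_eq[OF e left[OF assms] right[OF assms], of t] by (simp add: block_start_def)
    then show ?thesis using True b'(1,5) unfolding beginning_def by simp
  next
    case False
    then have k: "ks < k" "ks \<le> k - 1" "k - 1 \<le> k" using assms by auto
    obtain c where c: "t < c" "mark e (k - 1) \<omega> c"
      "\<And>d. t - int (gap e (k - 1) \<omega> t) < d \<Longrightarrow> d < c \<Longrightarrow> \<not> mark e (k - 1) \<omega> d"
      "is_block e \<omega> (k - 1) (block_of e \<omega> (k - 1) t)"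
      "block_of e \<omega> (k - 1) t = {t - int (gap e (k - 1) \<omega> t)..c - 1}"
      using block_of_ex[OF e left[OF k(2)] right[OF k(2)], of t] by blast
    have tb: "t \<in> block_of e \<omega> (k - 1) t" using c by simp
    have "c \<le> b'" using c(3)[of b'] mark_mono[OF e k(3) b'(2)] b'(1) by force
    then have sub: "block_of e \<omega> (k - 1) t \<subseteq> block_of e \<omega> k t"
      using c(5) b'(5) gap_mono[OF e left[OF assms] k(3), of t] by auto
    have "t \<in> beginning e ks \<omega> k (block_of e \<omega> k t) \<longleftrightarrow>
      int (card {b'. is_block e \<omega> (k - 1) b' \<and> b' \<subseteq> block_of e \<omega> k t \<and>
             Min b' \<le> Min (block_of e \<omega> (k - 1) t)}) \<le> \<lfloor>nu e k powr (1 - e)\<rfloor>"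
      (is "_ \<longleftrightarrow> int (card (?C (block_of e \<omega> (k - 1) t))) \<le> _")
    proof -
      have "t \<in> beginning e ks \<omega> k (block_of e \<omega> k t) \<longleftrightarrow>
        (\<exists>b. is_block e \<omega> (k - 1) b \<and> b \<subseteq> block_of e \<omega> k t \<and>
             int (card (?C b)) \<le> \<lfloor>nu e k powr (1 - e)\<rfloor> \<and> t \<in> b)"
        using False unfolding beginning_def by auto
      also have "\<dots> \<longleftrightarrow> int (card (?C (block_of e \<omega> (k - 1) t))) \<le> \<lfloor>nu e k powr (1 - e)\<rfloor>"
        using tb sub c(4) block_of_unique[OF e] by blast
      finally show ?thesis .
    qed
    then show ?thesis using False card_blocks_eq_mark_count[OF k(1) refl, of t] by simp
  qed
qed

lemma mem_active_iff:
  "t \<in> active e ks \<omega> k \<longleftrightarrow> active_at e ks k \<omega> t"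
  unfolding active_def active_at_def early_def
  using mem_beginning_iff block_start_eq[OF e left right] by auto

lemma k_index_eq:
  "k_index e ks \<omega> t = (if \<exists>k\<ge>ks. \<not> active_at e ks k \<omega> t then enat (level e ks \<omega> t) else \<infinity>)"
proof -
  have eq: "{enat k | k. ks \<le> k \<and> t \<notin> active e ks \<omega> k} = enat ` {k. ks \<le> k \<and> \<not> active_at e ks k \<omega> t}"
    by (auto simp: mem_active_iff)
  show ?thesis
  proof (cases "\<exists>k\<ge>ks. \<not> active_at e ks k \<omega> t")
    case True
    have "Inf (enat ` {k. ks \<le> k \<and> \<not> active_at e ks k \<omega> t}) = enat (level e ks \<omega> t)"
    proof (rule antisym)
      have "ks \<le> level e ks \<omega> t \<and> \<not> active_at e ks (level e ks \<omega> t) \<omega> t"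
        unfolding level_def using LeastI_ex[of "\<lambda>k. ks \<le> k \<and> \<not> active_at e ks k \<omega> t"] True by blast
      then show "Inf (enat ` {k. ks \<le> k \<and> \<not> active_at e ks k \<omega> t}) \<le> enat (level e ks \<omega> t)"
        by (intro Inf_lower) auto
      show "enat (level e ks \<omega> t) \<le> Inf (enat ` {k. ks \<le> k \<and> \<not> active_at e ks k \<omega> t})"
        by (intro Inf_greatest) (auto simp: level_def intro: Least_le)
    qed
    then show ?thesis using True unfolding k_index_def eq by simp
  next
    case False
    then have "{k. ks \<le> k \<and> \<not> active_at e ks k \<omega> t} = {}" by auto
    then show ?thesis unfolding k_index_def eq using False by (simp only: if_False) (simp add: top_enat_def)
  qed
qed

lemma level_props:
  assumes "\<exists>k\<ge>ks. \<not> active_at e ks k \<omega> t"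
  shows "ks \<le> level e ks \<omega> t" "\<not> active_at e ks (level e ks \<omega> t) \<omega> t"
    and "\<And>k. k < level e ks \<omega> t \<Longrightarrow> active_at e ks k \<omega> t"
proof -
  show "ks \<le> level e ks \<omega> t" "\<not> active_at e ks (level e ks \<omega> t) \<omega> t"
    using LeastI_ex[of "\<lambda>k. ks \<le> k \<and> \<not> active_at e ks k \<omega> t"] assms unfolding level_def by blast+
  fix k assume "k < level e ks \<omega> t"
  then have "\<not> (ks \<le> k \<and> \<not> active_at e ks k \<omega> t)" unfolding level_def by (rule not_less_Least)
  then show "active_at e ks k \<omega> t" by (cases "ks \<le> k") (auto simp: active_at_def)
qed

text \<open>By definition S_t consists of the active points of the whole block, including those
  after t. None of these exists: t fails to be early exactly at its own level k, and early points
  form an initial piece of the k-block.\<close>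

lemma S_set_eq:
  "S_set e ks \<omega> t = (\<lambda>n. t - int n) ` offsets e ks \<omega> t"
proof (cases "(\<exists>k\<ge>ks. \<not> active_at e ks k \<omega> t) \<and> ks < level e ks \<omega> t")
  case False
  then have "offsets e ks \<omega> t = {}" by (auto simp: offsets_def)
  then show ?thesis using False unfolding S_set_def k_index_eq by auto
next
  case True
  define k where "k = level e ks \<omega> t"
  have k: "ks < k" "ks \<le> k" using True by (auto simp: k_def)
  \<comment> \<open>Since t is active at level k - 1, its inactivity at level k can only come from
    the condition at k itself.\<close>
  have late: "\<not> early e ks k \<omega> t"
  proof
    assume "early e ks k \<omega> t"
    moreover have "active_at e ks (k - 1) \<omega> t" using level_props(3)[of t "k - 1"] True k by (simp add: k_def)
    moreover have "{ks..k} = insert k {ks..k - 1}" using k by auto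
    ultimately have "active_at e ks k \<omega> t" by (simp add: active_at_def)
    then show False using level_props(2)[of t] True by (simp add: k_def)
  qed
  obtain b' where b': "t < b'" "mark e k \<omega> b'"
    "\<And>c. t - int (gap e k \<omega> t) < c \<Longrightarrow> c < b' \<Longrightarrow> \<not> mark e k \<omega> c"
    "is_block e \<omega> k (block_of e \<omega> k t)" "block_of e \<omega> k t = {t - int (gap e k \<omega> t)..b' - 1}"
    using block_of_ex[OF e left[OF k(2)] right[OF k(2)], of t] by blast
  have not_act: "\<not> active_at e ks k \<omega> s" if s: "t \<le> s" "s < b'" for s
  proof
    assume a: "active_at e ks k \<omega> s"
    have st: "s - int (nat (s - t)) = t" using s by simp
    have "nat (s - t) \<le> gap e k \<omega> s"
    proof (rule ccontr)
      assume "\<not> ?thesis"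
      then have "t < s - int (gap e k \<omega> s)" by linarith
      then show False using b'(3)[of "s - int (gap e k \<omega> s)"] gap_mark[OF left[OF k(2)], of s] s by linarith
    qed
    from early_shift[OF left[OF k(2)] this, of ks] a k(2) late show False unfolding st active_at_def by auto
  qed
  have "S_set e ks \<omega> t = {s \<in> block_of e \<omega> k t. active_at e ks k \<omega> s}"
    using True unfolding S_set_def k_index_eq by (auto simp: k_def mem_active_iff)
  also have "\<dots> = {s. t - int (gap e k \<omega> t) \<le> s \<and> s < t \<and> active_at e ks k \<omega> s}"
  proof (rule Collect_cong)
    fix s
    have "active_at e ks k \<omega> s \<Longrightarrow> s < b' \<Longrightarrow> s < t" using not_act[of s] by linarith
    then show "s \<in> block_of e \<omega> k t \<and> active_at e ks k \<omega> s \<longleftrightarrow>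
      t - int (gap e k \<omega> t) \<le> s \<and> s < t \<and> active_at e ks k \<omega> s" unfolding b'(5) using b'(1) by auto
  qed
  also have "\<dots> = (\<lambda>n. t - int n) ` {n. 1 \<le> n \<and> n \<le> gap e k \<omega> t \<and> active_at e ks k \<omega> (t - int n)}"
  proof (intro equalityI subsetI)
    fix s assume "s \<in> {s. t - int (gap e k \<omega> t) \<le> s \<and> s < t \<and> active_at e ks k \<omega> s}"
    then show "s \<in> (\<lambda>n. t - int n) ` {n. 1 \<le> n \<and> n \<le> gap e k \<omega> t \<and> active_at e ks k \<omega> (t - int n)}"
      by (intro image_eqI[of _ _ "nat (t - s)"]) auto
  qed auto
  finally show ?thesis using True by (simp add: offsets_def k_def)
qed

text \<open>Stated at time 0 only, where \<open>gfun\<close> evaluates \<open>psi\<close>; other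
  times are reached through the translation covariance of the drift.\<close>

lemma psi_eq_drift:
  "psi e ks \<phi> h \<omega> 0 (\<lambda>n. x (- 1 - int n)) = drift e ks \<phi> h \<omega> 0 x"
proof (cases "(\<exists>k\<ge>ks. \<not> active_at e ks k \<omega> 0) \<and> ks < level e ks \<omega> 0")
  case False
  then have "offsets e ks \<omega> 0 = {}" by (auto simp: offsets_def)
  then show ?thesis using False unfolding psi_def S_set_eq k_index_eq drift_def by auto
next
  case True
  define k where "k = level e ks \<omega> 0"
  have k: "ks \<le> k" using True by (simp add: k_def)
  have inj: "inj_on (\<lambda>n. - int n) N" for N by (auto simp: inj_on_def)
  have "(\<Sum>s\<in>S_set e ks \<omega> 0. spin (x (- 1 - int (nat (0 - 1 - s))))) =
        (\<Sum>n\<in>offsets e ks \<omega> 0. spin (x (0 - int n)))"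
    unfolding S_set_eq
    by (simp add: sum.reindex[OF inj]) (rule sum.cong, auto simp: offsets_def)
  moreover have "card (S_set e ks \<omega> 0) = card (offsets e ks \<omega> 0)"
    unfolding S_set_eq by (simp add: card_image[OF inj])
  ultimately show ?thesis
    using True block_start_eq[OF e left[OF k] right[OF k], of 0]
    unfolding psi_def k_index_eq drift_def mean_def by (auto simp: S_set_eq k_def[symmetric])
qed

end

section \<open>Locality and measurability of the drift\<close>

context
  fixes e :: real and ks :: nat and \<omega> \<omega>' :: "int \<Rightarrow> bool" and t t' :: int
  assumes agree: "\<And>n. \<omega>' (t' - int n) = \<omega> (t - int n)"
begin

lemma mark_cong: "mark e k \<omega>' (t' - int n) = mark e k \<omega> (t - int n)"
proof -
  have "\<omega>' (t' - int n - i) = \<omega> (t - int n - i)" if "i \<in> {1..<int (ell e k)}" for i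
    using agree[of "n + nat i"] that by (simp add: algebra_simps)
  then show ?thesis using agree[of n] unfolding mark_def by auto
qed

lemma gap_cong: "gap e k \<omega>' (t' - int n) = gap e k \<omega> (t - int n)"
proof -
  have "mark e k \<omega>' (t' - int n - int m) = mark e k \<omega> (t - int n - int m)" for m
    using mark_cong[of k "n + m"] by (simp add: algebra_simps)
  then show ?thesis by (simp add: gap_def)
qed

lemma mark_count_cong: "mark_count e k \<omega>' (t' - int n) = mark_count e k \<omega> (t - int n)"
proof -
  have "mark e (k - 1) \<omega>' (t' - int n - int m) = mark e (k - 1) \<omega> (t - int n - int m)" for m
    using mark_cong[of "k - 1" "n + m"] by (simp add: algebra_simps)
  then show ?thesis by (simp add: mark_count_def gap_cong)
qed

lemma active_at_cong: "active_at e ks k \<omega>' (t' - int n) = active_at e ks k \<omega> (t - int n)"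
  by (simp add: active_at_def early_def gap_cong mark_count_cong)

lemma level_cong: "level e ks \<omega>' t' = level e ks \<omega> t"
  using active_at_cong[of _ 0] by (simp add: level_def)

lemma offsets_cong: "offsets e ks \<omega>' t' = offsets e ks \<omega> t"
  using active_at_cong[of _ 0] gap_cong[of _ 0] by (simp add: offsets_def level_cong active_at_cong)

text \<open>The drift reads the environment up to and including the current time but spins only
  strictly before it. Allowing two different times t and t' gives causality and translation
  covariance at once.\<close>

lemma drift_cong:
  assumes "\<And>n. 1 \<le> n \<Longrightarrow> x' (t' - int n) = x (t - int n)"
  shows "drift e ks \<phi> h \<omega>' t' x' = drift e ks \<phi> h \<omega> t x"
proof -
  have "mean (offsets e ks \<omega> t) t' x' = mean (offsets e ks \<omega> t) t x"
    unfolding mean_def using assms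
    by (intro arg_cong2[where f = "(/)"] sum.cong refl) (simp add: offsets_def)
  then show ?thesis
    using gap_cong[of _ 0] by (simp add: drift_def offsets_cong level_cong)
qed

end

lemma finite_offsets [simp]: "finite (offsets e ks \<omega> t)"
  by (rule finite_subset[of _ "{..gap e (level e ks \<omega> t) \<omega> t}"]) (auto simp: offsets_def)

lemma level_gt: "offsets e ks \<omega> t \<noteq> {} \<Longrightarrow> ks < level e ks \<omega> t"
  by (auto simp: offsets_def)

lemma drift_cong_offsets:
  assumes "\<And>n. n \<in> offsets e ks \<omega> t \<Longrightarrow> x (t - int n) = y (t - int n)"
  shows "drift e ks \<phi> h \<omega> t x = drift e ks \<phi> h \<omega> t y"
  using assms by (simp add: drift_def mean_def cong: sum.cong)

context
  fixes M :: "'w measure" and \<omega> x :: "'w \<Rightarrow> int \<Rightarrow> bool"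
  assumes \<omega>_measurable [measurable]: "\<And>t. (\<lambda>w. \<omega> w t) \<in> measurable M (count_space UNIV)"
begin

lemma measurable_mark [measurable]: "Measurable.pred M (\<lambda>w. mark e k (\<omega> w) b)"
  unfolding mark_def by measurable

lemma measurable_gap [measurable]: "(\<lambda>w. gap e k (\<omega> w) t) \<in> measurable M (count_space UNIV)"
  unfolding gap_def by measurable

lemma measurable_mark_count [measurable]: "(\<lambda>w. mark_count e k (\<omega> w) t) \<in> measurable M (count_space UNIV)"
  unfolding mark_count_def by measurable

lemma measurable_early [measurable]: "Measurable.pred M (\<lambda>w. early e ks k (\<omega> w) t)"
proof -
  have gap: "Measurable.pred M (\<lambda>w. P (gap e k (\<omega> w) t))" for P
    by (rule measurable_compose[OF measurable_gap]) simp
  have mark_count: "Measurable.pred M (\<lambda>w. P (mark_count e k (\<omega> w) t))" for P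
    by (rule measurable_compose[OF measurable_mark_count]) simp
  show ?thesis
    unfolding early_def
    using gap[of "\<lambda>n. real n \<le> beta e ks powr (1 + e)"] gap[of "\<lambda>n. real n < beta e (k + 1)"]
      mark_count[of "\<lambda>n. int n \<le> \<lfloor>nu e k powr (1 - e)\<rfloor>"]
    by (cases "k = ks") (simp_all only: if_True if_False refl pred_intros_logic)
qed

lemma measurable_active_at [measurable]: "Measurable.pred M (\<lambda>w. active_at e ks k (\<omega> w) t)"
  unfolding active_at_def by measurable

lemma measurable_level [measurable]: "(\<lambda>w. level e ks (\<omega> w) t) \<in> measurable M (count_space UNIV)"
  unfolding level_def by measurable

lemma measurable_active_at_level [measurable]:
  "Measurable.pred M (\<lambda>w. active_at e ks (level e ks (\<omega> w) t) (\<omega> w) s)"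
  by (rule measurable_compose_countable[OF _ measurable_level, where f = "\<lambda>k w. active_at e ks k (\<omega> w) s"])
     measurable

lemma measurable_gap_level [measurable]:
  "(\<lambda>w. gap e (level e ks (\<omega> w) t) (\<omega> w) t) \<in> measurable M (count_space UNIV)"
  by (rule measurable_compose_countable[OF _ measurable_level, where f = "\<lambda>k w. gap e k (\<omega> w) t"])
     measurable

lemma measurable_mem_offsets [measurable]: "Measurable.pred M (\<lambda>w. n \<in> offsets e ks (\<omega> w) t)"
  unfolding offsets_def mem_Collect_eq by measurable

text \<open>The offsets form a finite set of naturals, and there are countably many of these. This
  lets random offsets be treated as a countable case distinction.\<close>

lemma measurable_offsets:
  "(\<lambda>w. offsets e ks (\<omega> w) t) \<in> measurable M (count_space (Collect finite))"
proof -
  have "countable (Collect (finite :: nat set \<Rightarrow> bool))" by (rule countable_Collect_finite)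
  moreover have "(\<lambda>w. offsets e ks (\<omega> w) t) -` {N} \<inter> space M \<in> sets M" for N
  proof -
    have "(\<lambda>w. offsets e ks (\<omega> w) t) -` {N} \<inter> space M =
          {w \<in> space M. \<forall>n. n \<in> offsets e ks (\<omega> w) t \<longleftrightarrow> n \<in> N}" by auto
    also have "\<dots> \<in> sets M" by measurable
    finally show ?thesis .
  qed
  ultimately show ?thesis by (subst measurable_count_space_eq_countable) auto
qed

text \<open>Here \<open>\<phi>\<close> is an arbitrary function; its composition with the mean is
  measurable because, for a fixed finite set of offsets, the mean takes only finitely many values.
  The random level and the random offsets are then glued over countable ranges.\<close>

lemma measurable_drift:
  assumes x_measurable [measurable]: "\<And>t. (\<lambda>w. x w t) \<in> measurable M (count_space UNIV)"
  shows "(\<lambda>w. drift e ks \<phi> h (\<omega> w) t (x w)) \<in> borel_measurable M"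
proof -
  have c: "countable (Collect (finite :: nat set \<Rightarrow> bool))" by (rule countable_Collect_finite)
  have [measurable]: "spin \<in> measurable (count_space UNIV) borel" by simp
  have "(\<lambda>w. if N \<noteq> {} \<and> real (gap e k (\<omega> w) t) < beta e (k + 1)
      then h k * \<phi> (mean N t (x w)) else 0) \<in> borel_measurable M" if "finite N" for k and N :: "nat set"
  proof -
    have "(\<lambda>w. \<phi> (mean N t (x w))) \<in> borel_measurable M"
    proof -
      have fin: "finite (range (\<lambda>w. mean N t (x w)))"
      proof (rule finite_subset)
        show "range (\<lambda>w. mean N t (x w)) \<subseteq>
          (\<lambda>P. (\<Sum>n\<in>N. if n \<in> P then 1 else - 1) / real (card N)) ` Pow N"
        proof safe
          fix w
          show "mean N t (x w) \<in> (\<lambda>P. (\<Sum>n\<in>N. if n \<in> P then 1 else - 1) / real (card N)) ` Pow N"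
            by (rule image_eqI[of _ _ "{n \<in> N. x w (t - int n)}"])
               (auto simp: mean_def spin_def intro!: sum.cong arg_cong2[where f = "(/)"])
        qed
        show "finite ((\<lambda>P. (\<Sum>n\<in>N. if n \<in> P then 1 else - 1) / real (card N)) ` Pow N)"
          using that by simp
      qed
      have [measurable]: "(\<lambda>w. mean N t (x w)) \<in> borel_measurable M"
        unfolding mean_def by measurable
      have "(\<lambda>w. mean N t (x w)) \<in> measurable M (count_space (range (\<lambda>w. mean N t (x w))))"
        by (subst measurable_count_space_eq2[OF fin]) (auto intro!: measurable_sets[where A = borel])
      then show ?thesis by (rule measurable_compose) simp
    qed
    then show ?thesis by measurable
  qed
  then have "(\<lambda>w. if N \<noteq> {} \<and> real (gap e (level e ks (\<omega> w) t) (\<omega> w) t) < beta e (level e ks (\<omega> w) t + 1)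
      then h (level e ks (\<omega> w) t) * \<phi> (mean N t (x w)) else 0) \<in> borel_measurable M"
    if "finite N" for N :: "nat set"
    by (rule measurable_compose_countable[OF _ measurable_level]) (rule that)
  then show ?thesis
    unfolding drift_def
    by (intro measurable_compose_countable'[OF _ measurable_offsets c,
          where f = "\<lambda>N w. if N \<noteq> {} \<and> real (gap e (level e ks (\<omega> w) t) (\<omega> w) t) <
             beta e (level e ks (\<omega> w) t + 1) then h (level e ks (\<omega> w) t) * \<phi> (mean N t (x w)) else 0"])
       simp
qed

end

section \<open>Monotone dynamics driven by uniform variables and its extremal solutions\<close>

locale bramson_kalikow =
  fixes e :: real and ks :: nat and \<phi> :: "real \<Rightarrow> real" and h :: "nat \<Rightarrow> real"
  assumes e_pos: "0 < e" and e_less: "e < 1"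
    and \<phi>_range: "\<And>z. z \<in> {-1..1} \<Longrightarrow> \<phi> z \<in> {-1..1}"
    and \<phi>_mono: "mono_on {-1..1} \<phi>"
    and h_pos: "\<And>k. ks \<le> k \<Longrightarrow> 0 < h k"
    and h_dec: "\<And>k. ks \<le> k \<Longrightarrow> h (Suc k) \<le> h k"
    and h_less: "h ks < 1"
begin

abbreviation D :: "(int \<Rightarrow> bool) \<Rightarrow> int \<Rightarrow> (int \<Rightarrow> bool) \<Rightarrow> real" where
  "D \<equiv> drift e ks \<phi> h"

primrec spin_iter :: "bool \<Rightarrow> nat \<Rightarrow> (int \<Rightarrow> bool) \<Rightarrow> (int \<Rightarrow> real) \<Rightarrow> int \<Rightarrow> bool" where
  "spin_iter c 0 \<omega> U = (\<lambda>t. c)"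
| "spin_iter c (Suc n) \<omega> U = (\<lambda>t. U t \<le> (1 + D \<omega> t (spin_iter c n \<omega> U)) / 2)"

text \<open>The iterates started from all plus decrease at every site, so the quantifier over n is
  their pointwise limit; dually for \<open>bot_spins\<close>.\<close>

definition top_spins :: "(int \<Rightarrow> bool) \<Rightarrow> (int \<Rightarrow> real) \<Rightarrow> int \<Rightarrow> bool" where
  "top_spins \<omega> U t \<longleftrightarrow> (\<forall>n. spin_iter True n \<omega> U t)"

definition bot_spins :: "(int \<Rightarrow> bool) \<Rightarrow> (int \<Rightarrow> real) \<Rightarrow> int \<Rightarrow> bool" where
  "bot_spins \<omega> U t \<longleftrightarrow> (\<exists>n. spin_iter False n \<omega> U t)"

lemma h_le: "ks \<le> k \<Longrightarrow> h k \<le> h ks"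
  by (induction k rule: dec_induct) (auto intro: order_trans[OF h_dec])

lemma mean_bounds: "mean N t x \<in> {-1..1}"
proof -
  have "\<bar>\<Sum>n\<in>N. spin (x (t - int n))\<bar> \<le> (\<Sum>n\<in>N. 1)"
    by (intro order_trans[OF sum_abs] sum_mono) (simp add: spin_def)
  then have "\<bar>mean N t x\<bar> \<le> 1"
    by (cases "card N = 0") (simp_all add: mean_def abs_divide divide_le_eq_1)
  then show ?thesis by auto
qed

lemma mean_mono: "(\<And>s. x s \<Longrightarrow> y s) \<Longrightarrow> mean N t x \<le> mean N t y"
  unfolding mean_def by (intro divide_right_mono sum_mono) (auto simp: spin_def)

lemma D_mono:
  assumes "\<And>s. x s \<Longrightarrow> y s"
  shows "D \<omega> t x \<le> D \<omega> t y"
proof -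
  have "\<phi> (mean N t x) \<le> \<phi> (mean N t y)" for N
    using mono_onD[OF \<phi>_mono mean_bounds mean_bounds mean_mono] assms by blast
  then show ?thesis
    using h_pos[of "level e ks \<omega> t"] level_gt[of e ks \<omega> t]
    by (cases "offsets e ks \<omega> t = {}") (simp_all add: drift_def)
qed

lemma D_bound_level: "\<bar>D \<omega> t x\<bar> \<le> (if offsets e ks \<omega> t = {} then 0 else h (level e ks \<omega> t))"
proof -
  have "\<bar>\<phi> (mean N t x)\<bar> \<le> 1" for N using \<phi>_range[OF mean_bounds] by (simp add: abs_le_iff)
  then show ?thesis
    using h_pos[of "level e ks \<omega> t"] level_gt[of e ks \<omega> t]
    by (cases "offsets e ks \<omega> t = {}") (auto simp: drift_def abs_mult intro: mult_left_le)
qed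

lemma D_bound: "\<bar>D \<omega> t x\<bar> \<le> h ks"
  using D_bound_level[of \<omega> t x] h_le[of "level e ks \<omega> t"] h_pos[of ks] level_gt[of e ks \<omega> t]
  by (auto split: if_splits)

lemma D_less: "\<bar>D \<omega> t x\<bar> < 1"
  using D_bound h_less by (rule le_less_trans)

text \<open>The first step holds because the starting configurations are extremal; monotonicity of
  the drift in the spins then carries the comparison from one iteration to the next.\<close>

lemma spin_iter_step_mono: "(spin_iter True (Suc n) \<omega> U t \<longrightarrow> spin_iter True n \<omega> U t) \<and>
   (spin_iter False n \<omega> U t \<longrightarrow> spin_iter False (Suc n) \<omega> U t)"
proof (induction n arbitrary: t)
  case (Suc n)
  have "D \<omega> t (spin_iter True (Suc n) \<omega> U) \<le> D \<omega> t (spin_iter True n \<omega> U)"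
    by (rule D_mono) (metis Suc)
  moreover have "D \<omega> t (spin_iter False n \<omega> U) \<le> D \<omega> t (spin_iter False (Suc n) \<omega> U)"
    by (rule D_mono) (metis Suc)
  ultimately show ?case
    unfolding spin_iter.simps(2)[of _ "Suc n"] spin_iter.simps(2)[of _ n \<omega> U, THEN fun_cong] by auto
qed simp

lemma spin_iter_True_antimono: "n \<le> m \<Longrightarrow> spin_iter True m \<omega> U t \<Longrightarrow> spin_iter True n \<omega> U t"
  by (induction m rule: dec_induct) (use spin_iter_step_mono in blast)+

lemma spin_iter_False_mono: "n \<le> m \<Longrightarrow> spin_iter False n \<omega> U t \<Longrightarrow> spin_iter False m \<omega> U t"
  by (induction m rule: dec_induct) (use spin_iter_step_mono in blast)+

lemma top_spins_eventually: "\<forall>\<^sub>F n in sequentially. spin_iter True n \<omega> U t = top_spins \<omega> U t"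
proof (cases "top_spins \<omega> U t")
  case False
  then obtain n where "\<not> spin_iter True n \<omega> U t" by (auto simp: top_spins_def)
  then show ?thesis using False spin_iter_True_antimono unfolding eventually_sequentially by blast
qed (simp add: top_spins_def)

lemma bot_spins_eventually: "\<forall>\<^sub>F n in sequentially. spin_iter False n \<omega> U t = bot_spins \<omega> U t"
proof (cases "bot_spins \<omega> U t")
  case True
  then obtain n where "spin_iter False n \<omega> U t" by (auto simp: bot_spins_def)
  then show ?thesis using True spin_iter_False_mono unfolding eventually_sequentially by blast
qed (simp add: bot_spins_def)

text \<open>Monotone convergence alone would not give a fixed point, since \<open>\<phi>\<close> may
  jump. But the drift at t reads finitely many spins, and these have all reached their limits after
  finitely many iterations, so the drift itself becomes constant.\<close>

lemma fixed_point_limit: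
  assumes "\<And>t. \<forall>\<^sub>F n in sequentially. spin_iter c n \<omega> U t = x t"
  shows "x t \<longleftrightarrow> U t \<le> (1 + D \<omega> t x) / 2"
proof -
  have "\<forall>\<^sub>F n in sequentially. \<forall>m\<in>offsets e ks \<omega> t. spin_iter c n \<omega> U (t - int m) = x (t - int m)"
    using assms by (intro eventually_ball_finite) auto
  moreover have "\<forall>\<^sub>F n in sequentially. spin_iter c (Suc n) \<omega> U t = x t"
    using assms[of t] unfolding eventually_sequentially by (meson le_Suc_eq)
  ultimately have "\<forall>\<^sub>F n in sequentially. x t \<longleftrightarrow> U t \<le> (1 + D \<omega> t x) / 2"
  proof eventually_elim
    case (elim n)
    have "D \<omega> t (spin_iter c n \<omega> U) = D \<omega> t x" using elim(1) by (intro drift_cong_offsets) blast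
    then show ?case using elim(2) by simp
  qed
  then show ?thesis by simp
qed

lemmas top_spins_fixed = fixed_point_limit[OF top_spins_eventually]
lemmas bot_spins_fixed = fixed_point_limit[OF bot_spins_eventually]

lemma fixed_point_between:
  assumes "\<And>t. x t \<longleftrightarrow> U t \<le> (1 + D \<omega> t x) / 2"
  shows "(spin_iter False n \<omega> U t \<longrightarrow> x t) \<and> (x t \<longrightarrow> spin_iter True n \<omega> U t)"
proof (induction n arbitrary: t)
  case (Suc n)
  have "D \<omega> t (spin_iter False n \<omega> U) \<le> D \<omega> t x"
    by (rule D_mono) (metis Suc)
  moreover have "D \<omega> t x \<le> D \<omega> t (spin_iter True n \<omega> U)"
    by (rule D_mono) (metis Suc)
  ultimately show ?case using assms[of t] by auto
qed simp

lemma fixed_point_bounds: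
  assumes "\<And>t. x t \<longleftrightarrow> U t \<le> (1 + D \<omega> t x) / 2"
  shows "bot_spins \<omega> U t \<Longrightarrow> x t" "x t \<Longrightarrow> top_spins \<omega> U t"
  using fixed_point_between[OF assms] unfolding bot_spins_def top_spins_def by blast+

text \<open>Used with t' = t to show that a change of the noise or the environment after a time
  leaves the spins up to that time alone, and with shifted configurations for stationarity.\<close>

lemma spin_iter_cong:
  assumes "\<And>n. \<omega>' (t' - int n) = \<omega> (t - int n)" "\<And>n. U' (t' - int n) = U (t - int n)"
  shows "spin_iter c n \<omega>' U' t' = spin_iter c n \<omega> U t"
  using assms
proof (induction n arbitrary: t t')
  case (Suc n)
  have "D \<omega>' t' (spin_iter c n \<omega>' U') = D \<omega> t (spin_iter c n \<omega> U)"
  proof (rule drift_cong)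
    fix m :: nat
    show "spin_iter c n \<omega>' U' (t' - int m) = spin_iter c n \<omega> U (t - int m)"
    proof (rule Suc.IH)
      fix l
      show "\<omega>' (t' - int m - int l) = \<omega> (t - int m - int l)" "U' (t' - int m - int l) = U (t - int m - int l)"
        using Suc.prems[of "m + l"] by (simp_all add: algebra_simps)
    qed
  qed (rule Suc.prems)
  then show ?case using Suc.prems(2)[of 0] by simp
qed simp

lemma top_spins_cong:
  assumes "\<And>n. \<omega>' (t' - int n) = \<omega> (t - int n)" "\<And>n. U' (t' - int n) = U (t - int n)"
  shows "top_spins \<omega>' U' t' = top_spins \<omega> U t"
proof -
  have "spin_iter True n \<omega>' U' t' = spin_iter True n \<omega> U t" for n by (rule spin_iter_cong) (rule assms)+
  then show ?thesis by (simp add: top_spins_def)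
qed

lemma bot_spins_cong:
  assumes "\<And>n. \<omega>' (t' - int n) = \<omega> (t - int n)" "\<And>n. U' (t' - int n) = U (t - int n)"
  shows "bot_spins \<omega>' U' t' = bot_spins \<omega> U t"
proof -
  have "spin_iter False n \<omega>' U' t' = spin_iter False n \<omega> U t" for n by (rule spin_iter_cong) (rule assms)+
  then show ?thesis by (simp add: bot_spins_def)
qed

lemma measurable_spin_iter:
  fixes \<omega> :: "'w \<Rightarrow> int \<Rightarrow> bool" and U :: "'w \<Rightarrow> int \<Rightarrow> real"
  assumes [measurable]: "\<And>t. (\<lambda>w. \<omega> w t) \<in> measurable M (count_space UNIV)"
    "\<And>t. (\<lambda>w. U w t) \<in> borel_measurable M"
  shows "(\<lambda>w. spin_iter c n (\<omega> w) (U w) t) \<in> measurable M (count_space UNIV)"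
proof (induction n arbitrary: t)
  case (Suc n)
  have [measurable]: "(\<lambda>w. D (\<omega> w) t (spin_iter c n (\<omega> w) (U w))) \<in> borel_measurable M"
    by (rule measurable_drift) (auto intro: assms Suc)
  show ?case by simp
qed simp

lemma measurable_top_spins:
  fixes \<omega> :: "'w \<Rightarrow> int \<Rightarrow> bool" and U :: "'w \<Rightarrow> int \<Rightarrow> real"
  assumes "\<And>t. (\<lambda>w. \<omega> w t) \<in> measurable M (count_space UNIV)" "\<And>t. (\<lambda>w. U w t) \<in> borel_measurable M"
  shows "(\<lambda>w. top_spins (\<omega> w) (U w) t) \<in> measurable M (count_space UNIV)"
proof -
  note [measurable] = measurable_spin_iter[OF assms]
  show ?thesis unfolding top_spins_def by measurable
qed

lemma measurable_bot_spins:
  fixes \<omega> :: "'w \<Rightarrow> int \<Rightarrow> bool" and U :: "'w \<Rightarrow> int \<Rightarrow> real"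
  assumes "\<And>t. (\<lambda>w. \<omega> w t) \<in> measurable M (count_space UNIV)" "\<And>t. (\<lambda>w. U w t) \<in> borel_measurable M"
  shows "(\<lambda>w. bot_spins (\<omega> w) (U w) t) \<in> measurable M (count_space UNIV)"
proof -
  note [measurable] = measurable_spin_iter[OF assms]
  show ?thesis unfolding bot_spins_def by measurable
qed

end

section \<open>The random environment\<close>

text \<open>Replacing one coordinate of a product measure by an independent copy does not change the
  measure. This is the only form of independence between a coordinate and the rest that is used for
  the coins and for the uniform variables.\<close>

lemma nn_integral_PiM_resample:
  assumes "prob_space N" and F: "F \<in> borel_measurable (PiM UNIV (\<lambda>_. N))"
  shows "(\<integral>\<^sup>+ X. F X \<partial>PiM UNIV (\<lambda>_. N)) = (\<integral>\<^sup>+ X. (\<integral>\<^sup>+ x. F (X(i := x)) \<partial>N) \<partial>PiM UNIV (\<lambda>_. N))"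
proof -
  interpret N: prob_space N by fact
  interpret P: prob_space "PiM UNIV (\<lambda>_. N)" using assms by (intro prob_space_PiM)
  interpret pair_sigma_finite N "PiM UNIV (\<lambda>_. N)" ..
  let ?P = "PiM UNIV (\<lambda>_. N)"
  have upd: "(\<lambda>z. (snd z)(i := fst z)) \<in> measurable (N \<Otimes>\<^sub>M ?P) ?P"
    by (rule measurable_fun_upd[where J = UNIV]) auto
  have "distr (N \<Otimes>\<^sub>M ?P) ?P (\<lambda>(x, X). X(i := x)) = ?P"
    using distr_pair_PiM_eq_PiM[of UNIV "\<lambda>_. N" i] assms by simp
  then have "(\<integral>\<^sup>+ X. F X \<partial>?P) = (\<integral>\<^sup>+ X. F X \<partial>distr (N \<Otimes>\<^sub>M ?P) ?P (\<lambda>(x, X). X(i := x)))" by simp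
  also have "\<dots> = (\<integral>\<^sup>+ z. F ((snd z)(i := fst z)) \<partial>(N \<Otimes>\<^sub>M ?P))"
    using F upd by (subst nn_integral_distr) (simp_all add: case_prod_beta)
  also have "\<dots> = (\<integral>\<^sup>+ X. (\<integral>\<^sup>+ x. F (X(i := x)) \<partial>N) \<partial>?P)"
    using nn_integral_snd[OF measurable_compose[OF upd F]] by simp
  finally show ?thesis .
qed

definition coin :: "bool measure" where
  "coin = measure_pmf (bernoulli_pmf (1 / 2))"

definition bits :: "(int \<Rightarrow> bool) measure" where
  "bits = PiM UNIV (\<lambda>_. coin)"

lemma sets_coin [measurable_cong, simp]: "sets coin = sets (count_space UNIV)"
  by (simp add: coin_def)

lemma space_coin [simp]: "space coin = UNIV"
  by (simp add: coin_def)

lemma prob_space_coin: "prob_space coin"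
  unfolding coin_def by (rule prob_space_measure_pmf)

lemma prob_space_bits: "prob_space bits"
  unfolding bits_def by (intro prob_space_PiM prob_space_coin)

lemma space_bits [simp]: "space bits = UNIV"
  by (simp add: bits_def space_PiM)

lemma sets_bits [measurable_cong]: "sets bits = sets (PiM UNIV (\<lambda>_. count_space UNIV))"
  unfolding bits_def by (intro sets_PiM_cong) auto

lemma sets_CollectI: "space M = UNIV \<Longrightarrow> Measurable.pred M P \<Longrightarrow> {x. P x} \<in> sets M"
  by (drule predE) simp

lemma measurable_bit [measurable]: "(\<lambda>\<omega>. \<omega> t) \<in> measurable bits (count_space UNIV)"
  unfolding measurable_cong_sets[OF sets_bits refl] by measurable

lemma nn_integral_coin: "(\<integral>\<^sup>+ x. f x \<partial>coin) = (f True + f False) / 2"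
proof -
  have "(\<integral>\<^sup>+ x. f x \<partial>coin) = f True * ennreal (1 / 2) + f False * ennreal (1 / 2)"
    unfolding coin_def by simp
  also have "ennreal (1 / 2) = 1 / 2" using divide_ennreal[of 1 2] by simp
  finally show ?thesis by (simp add: divide_ennreal_def algebra_simps distrib_left)
qed

interpretation bits: prob_space bits
  by (rule prob_space_bits)

text \<open>The event E ignores the coordinates in J. Resampling these one by one gives a factor 1/2
  for each prescribed bit.\<close>

lemma prob_bits_cylinder:
  assumes "finite J" and E: "E \<in> sets bits"
    and indep: "\<And>\<omega> \<omega>'. (\<And>i. i \<notin> J \<Longrightarrow> \<omega> i = \<omega>' i) \<Longrightarrow> \<omega> \<in> E \<Longrightarrow> \<omega>' \<in> E"
  shows "bits.prob ({\<omega>. \<forall>i\<in>J. \<omega> i = w i} \<inter> E) = (1 / 2) ^ card J * bits.prob E"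
  using assms
proof (induction J arbitrary: E rule: finite_induct)
  case (insert j J)
  define E' where "E' = {\<omega>. \<omega> j = w j} \<inter> E"
  have sj: "{\<omega>. \<omega> j = w j} \<in> sets bits"
    by (rule sets_CollectI) (simp, measurable)
  have E': "E' \<in> sets bits" using sj insert.prems(1) by (auto simp: E'_def)
  have "bits.prob ({\<omega>. \<forall>i\<in>insert j J. \<omega> i = w i} \<inter> E) = bits.prob ({\<omega>. \<forall>i\<in>J. \<omega> i = w i} \<inter> E')"
    by (rule arg_cong[where f = bits.prob]) (auto simp: E'_def)
  also have "\<dots> = (1 / 2) ^ card J * bits.prob E'"
  proof (rule insert.IH[OF E'])
    fix \<omega> \<omega>' :: "int \<Rightarrow> bool" assume *: "\<And>i. i \<notin> J \<Longrightarrow> \<omega> i = \<omega>' i" "\<omega> \<in> E'"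
    then show "\<omega>' \<in> E'" using insert.prems(2)[of \<omega> \<omega>'] insert.hyps by (auto simp: E'_def)
  qed
  also have "bits.prob E' = bits.prob E / 2"
  proof -
    have ind: "(indicator E (fun_upd \<omega> j x) :: ennreal) = indicator E \<omega>" for \<omega> x
    proof -
      have "fun_upd \<omega> j x \<in> E" if "\<omega> \<in> E"
        by (rule insert.prems(2)[OF _ that]) auto
      moreover have "\<omega> \<in> E" if "fun_upd \<omega> j x \<in> E"
        by (rule insert.prems(2)[OF _ that]) auto
      ultimately have "fun_upd \<omega> j x \<in> E \<longleftrightarrow> \<omega> \<in> E" by blast
      then show ?thesis by (simp only: indicator_def)
    qed
    have "emeasure bits E' = (\<integral>\<^sup>+ \<omega>. indicator E' \<omega> \<partial>bits)" using E' by simp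
    also have "\<dots> = (\<integral>\<^sup>+ \<omega>. (\<integral>\<^sup>+ x. indicator E' (fun_upd \<omega> j x) \<partial>coin) \<partial>bits)"
      unfolding bits_def
      by (rule nn_integral_PiM_resample[OF prob_space_coin]) (use E' in \<open>simp add: bits_def[symmetric]\<close>)
    also have "\<dots> = (\<integral>\<^sup>+ \<omega>. indicator E \<omega> / 2 \<partial>bits)"
    proof (rule nn_integral_cong)
      fix \<omega>
      have "indicator E' (fun_upd \<omega> j x) = (if x = w j then indicator E \<omega> else (0 :: ennreal))" for x
        using ind[of \<omega> x] by (auto simp: E'_def indicator_def)
      then show "(\<integral>\<^sup>+ x. indicator E' (fun_upd \<omega> j x) \<partial>coin) = indicator E \<omega> / 2"
        by (cases "w j") (simp_all add: nn_integral_coin)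
    qed
    also have "\<dots> = emeasure bits E / 2"
      using insert.prems(1) by (simp add: divide_ennreal_def nn_integral_multc)
    finally show ?thesis
      by (simp add: bits.emeasure_eq_measure ennreal_divide_numeral)
  qed
  finally show ?case using insert.hyps by simp
qed simp

lemma mark_cong_interval:
  assumes "\<And>i. b - int (ell e k) < i \<Longrightarrow> i \<le> b \<Longrightarrow> \<omega> i = \<omega>' i" and "0 < e"
  shows "mark e k \<omega> b = mark e k \<omega>' b"
proof -
  have "\<omega> b = \<omega>' b" using assms ell_pos[of e k] by simp
  moreover have "\<omega> (b - i) = \<omega>' (b - i)" if "i \<in> {1..<int (ell e k)}" for i
    using assms that by simp
  ultimately show ?thesis unfolding mark_def by auto
qed

lemma mark_cylinder:
  assumes "0 < e"
  shows "mark e k \<omega> b \<longleftrightarrow> (\<forall>i\<in>{b - int (ell e k)<..b}. \<omega> i = (i \<noteq> b))"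
proof
  assume m: "mark e k \<omega> b"
  show "\<forall>i\<in>{b - int (ell e k)<..b}. \<omega> i = (i \<noteq> b)"
  proof
    fix i assume "i \<in> {b - int (ell e k)<..b}"
    then show "\<omega> i = (i \<noteq> b)"
      using m unfolding mark_def by (cases "i = b") (auto dest!: bspec[of _ _ "b - i"])
  qed
next
  assume *: "\<forall>i\<in>{b - int (ell e k)<..b}. \<omega> i = (i \<noteq> b)"
  then show "mark e k \<omega> b" using ell_pos[OF assms, of k] unfolding mark_def by auto
qed

lemma measurable_mark_bits [measurable]: "Measurable.pred bits (\<lambda>\<omega>. mark e k \<omega> b)"
  unfolding mark_def by measurable

text \<open>
  The events that the last mark up to t is at distance m are disjoint, and each of them is a
  word occurrence intersected with an independent event containing the event of having no mark.
\<close>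

lemma prob_no_mark:
  assumes e: "0 < e"
  shows "real n * bits.prob {\<omega>. \<forall>m<n. \<not> mark e k \<omega> (t - int m)} \<le> beta e k"
proof -
  define M where "M m = {\<omega>. mark e k \<omega> (t - int m) \<and> (\<forall>m'<m. \<not> mark e k \<omega> (t - int m'))}" for m
  define E where "E m = {\<omega>. \<forall>m'. m' + ell e k \<le> m \<longrightarrow> \<not> mark e k \<omega> (t - int m')}" for m
  define J where "J m = {t - int m - int (ell e k)<..t - int m}" for m
  have Mset: "M m \<in> sets bits" for m
    unfolding M_def by (rule sets_CollectI) (simp, measurable)
  have Eset: "E m \<in> sets bits" for m
    unfolding E_def by (rule sets_CollectI) (simp, measurable)
  have lower: "(1 / 2) ^ ell e k * bits.prob {\<omega>. \<forall>m<n. \<not> mark e k \<omega> (t - int m)} \<le> bits.prob (M m)"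
    if "m < n" for m
  proof -
    \<comment> \<open>Given a mark at distance m, separation already excludes marks at smaller
      distances above m - \<open>ell e k\<close>. Only words lying entirely to the right of t - m
      remain to be forbidden, and these do not meet \<open>J m\<close>.\<close>
    have "M m = {\<omega>. \<forall>i\<in>J m. \<omega> i = (i \<noteq> t - int m)} \<inter> E m"
    proof -
      have "(\<forall>m'<m. \<not> mark e k \<omega> (t - int m')) \<longleftrightarrow> (\<forall>m'. m' + ell e k \<le> m \<longrightarrow> \<not> mark e k \<omega> (t - int m'))"
        if "mark e k \<omega> (t - int m)" for \<omega>
      proof -
        have "m' + ell e k \<le> m" if "mark e k \<omega> (t - int m')" "m' < m" for m'
          using mark_separated[OF \<open>mark e k \<omega> (t - int m)\<close> that(1)] that(2) by linarith
        then show ?thesis using ell_pos[OF e, of k] by fastforce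
      qed
      then show ?thesis unfolding M_def E_def J_def mark_cylinder[OF e, of k _ "t - int m", symmetric] by auto
    qed
    also have "bits.prob \<dots> = (1 / 2) ^ card (J m) * bits.prob (E m)"
    proof (rule prob_bits_cylinder[OF _ Eset])
      fix \<omega> \<omega>' :: "int \<Rightarrow> bool" assume *: "\<And>i. i \<notin> J m \<Longrightarrow> \<omega> i = \<omega>' i" "\<omega> \<in> E m"
      have "mark e k \<omega> (t - int m') = mark e k \<omega>' (t - int m')" if "m' + ell e k \<le> m" for m'
        by (rule mark_cong_interval[OF _ e], rule *(1)) (use that in \<open>auto simp: J_def\<close>)
      then show "\<omega>' \<in> E m" using *(2) by (auto simp: E_def)
    qed (simp add: J_def)
    finally have "bits.prob (M m) = (1 / 2) ^ ell e k * bits.prob (E m)" by (simp add: J_def)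
    \<comment> \<open>Forbidding marks at all distances below n forbids in particular those in
      \<open>E m\<close>. The lower bound for the probability of \<open>M m\<close> is thereby the
      same for all m < n and can be summed.\<close>
    moreover have "bits.prob {\<omega>. \<forall>m<n. \<not> mark e k \<omega> (t - int m)} \<le> bits.prob (E m)"
      using that Eset by (intro bits.finite_measure_mono) (auto simp: E_def)
    ultimately show ?thesis by (simp add: mult_left_mono)
  qed
  have "real n * ((1 / 2) ^ ell e k * bits.prob {\<omega>. \<forall>m<n. \<not> mark e k \<omega> (t - int m)}) \<le> (\<Sum>m<n. bits.prob (M m))"
    using sum_mono[of "{..<n}", OF lower] by simp
  also have "\<dots> = bits.prob (\<Union>m<n. M m)"
  proof (rule bits.finite_measure_finite_Union[symmetric])
    show "disjoint_family_on M {..<n}"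
      unfolding disjoint_family_on_def M_def by (auto dest: linorder_neqE_nat)
  qed (use Mset in auto)
  also have "\<dots> \<le> 1" by simp
  finally show ?thesis by (simp add: beta_def power_one_over field_simps)
qed

text \<open>The number of predecessors satisfying P is strictly increasing along the points
  satisfying P, hence an injection into {0, ..., M - 1}.\<close>

lemma card_few_predecessors:
  fixes P :: "nat \<Rightarrow> bool"
  shows "finite {m. P m \<and> card {m'. m' < m \<and> P m'} < M}" (is "finite ?A")
  "card {m. P m \<and> card {m'. m' < m \<and> P m'} < M} \<le> M"
proof -
  have inj: "inj_on (\<lambda>m. card {m'. m' < m \<and> P m'}) (?A :: nat set)"
  proof (rule linorder_inj_onI)
    fix a b assume *: "a < b" "a \<in> ?A" "b \<in> ?A"
    have "card {m'. m' < a \<and> P m'} < card {m'. m' < b \<and> P m'}"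
      by (rule psubset_card_mono) (use * in auto)
    then show "card {m'. m' < a \<and> P m'} \<noteq> card {m'. m' < b \<and> P m'}" by simp
  qed auto
  have sub: "(\<lambda>m. card {m'. m' < m \<and> P m'}) ` ?A \<subseteq> {..<M}" by auto
  show "finite ?A" by (rule inj_on_finite[OF inj sub]) simp
  show "card ?A \<le> M" using card_inj_on_le[OF inj sub] by simp
qed

lemma nu_eq: "0 < e \<Longrightarrow> nu e k = 2 ^ (ell e k - ell e (k - 1))"
  using ell_mono[of e "k - 1" k] by (simp add: nu_def beta_def power_diff)

text \<open>
  A (k-1)-mark is a k-mark iff it is preceded by some further ones, which are independent of the
  marks to the right of it, and at most M marks have fewer than M marks to the right.
\<close>

lemma prob_few_blocks:
  assumes e: "0 < e"
  shows "bits.prob {\<omega>. \<exists>m. mark e k \<omega> (t - int m) \<and>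
           card {m'. m' < m \<and> mark e (k - 1) \<omega> (t - int m')} < M} \<le> real M / nu e k"
proof -
  define G where "G m = {\<omega>. mark e k \<omega> (t - int m) \<and> card {m'. m' < m \<and> mark e (k - 1) \<omega> (t - int m')} < M}" for m
  define E where "E m = {\<omega>. mark e (k - 1) \<omega> (t - int m) \<and> card {m'. m' < m \<and> mark e (k - 1) \<omega> (t - int m')} < M}" for m
  define J where "J m = {t - int m - int (ell e k)<..t - int m - int (ell e (k - 1))}" for m
  have le: "ell e (k - 1) \<le> ell e k" using e by (rule ell_mono) simp
  have Gset [measurable]: "G m \<in> sets bits" for m
    unfolding G_def by (rule sets_CollectI) (simp, measurable)
  have Eset [measurable]: "E m \<in> sets bits" for m
    unfolding E_def by (rule sets_CollectI) (simp, measurable)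
  have G: "bits.prob (G m) = bits.prob (E m) / nu e k" for m
  proof -
    have "mark e k \<omega> b \<longleftrightarrow> mark e (k - 1) \<omega> b \<and>
        (\<forall>i\<in>{b - int (ell e k)<..b - int (ell e (k - 1))}. \<omega> i = True)" for \<omega> b
      unfolding mark_cylinder[OF e] using le ell_pos[OF e, of "k - 1"] by (auto simp: not_le)
    then have "G m = {\<omega>. \<forall>i\<in>J m. \<omega> i = True} \<inter> E m"
      unfolding G_def E_def J_def by auto
    also have "bits.prob \<dots> = (1 / 2) ^ card (J m) * bits.prob (E m)"
    proof (rule prob_bits_cylinder[OF _ Eset])
      fix \<omega> \<omega>' :: "int \<Rightarrow> bool" assume *: "\<And>i. i \<notin> J m \<Longrightarrow> \<omega> i = \<omega>' i" "\<omega> \<in> E m"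
      have c: "mark e (k - 1) \<omega> (t - int m') = mark e (k - 1) \<omega>' (t - int m')" if "m' \<le> m" for m'
        by (rule mark_cong_interval[OF _ e], rule *(1)) (use that in \<open>auto simp: J_def\<close>)
      then have "{m'. m' < m \<and> mark e (k - 1) \<omega> (t - int m')} = {m'. m' < m \<and> mark e (k - 1) \<omega>' (t - int m')}"
        by auto
      then show "\<omega>' \<in> E m" using *(2) c[of m] by (auto simp: E_def)
    qed (simp add: J_def)
    finally show ?thesis using le by (simp add: J_def nu_eq[OF e] power_one_over nat_diff_distrib)
  qed
  \<comment> \<open>The estimate is uniform in n, so continuity from below extends it to the union
    over all distances.\<close>
  have fin: "bits.prob (\<Union>m<n. G m) \<le> real M / nu e k" for n
  proof -
    have "(\<Sum>m<n. bits.prob (E m)) = bits.expectation (\<lambda>\<omega>. \<Sum>m<n. indicator (E m) \<omega>)"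
      by (subst Bochner_Integration.integral_sum) (auto simp: bits.emeasure_eq_measure)
    also have "\<dots> \<le> bits.expectation (\<lambda>\<omega>. real M)"
    proof (rule integral_mono)
      fix \<omega>
      have "(\<Sum>m<n. indicator (E m) \<omega>) = (real (card ({..<n} \<inter> {m. \<omega> \<in> E m})))"
        by (simp add: indicator_def of_bool_def sum.If_cases)
      also have "\<dots> \<le> real (card {m. \<omega> \<in> E m})"
        unfolding E_def mem_Collect_eq by (intro of_nat_mono card_mono card_few_predecessors) auto
      also have "\<dots> \<le> real M"
        unfolding E_def mem_Collect_eq by (intro of_nat_mono card_few_predecessors)
      finally show "(\<Sum>m<n. indicator (E m) \<omega>) \<le> real M" .
    qed (auto simp: bits.emeasure_eq_measure)
    finally have "(\<Sum>m<n. bits.prob (E m)) \<le> real M" using bits.prob_space by simp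
    moreover have "bits.prob (\<Union>m<n. G m) \<le> (\<Sum>m<n. bits.prob (G m))"
      by (rule bits.finite_measure_subadditive_finite) auto
    moreover have "(\<Sum>m<n. bits.prob (G m)) = (\<Sum>m<n. bits.prob (E m)) / nu e k"
      unfolding G by (simp add: sum_divide_distrib)
    moreover have "0 < nu e k" by (simp add: nu_eq[OF e])
    ultimately show ?thesis
      using divide_right_mono[of "\<Sum>m<n. bits.prob (E m)" "real M" "nu e k"] by linarith
  qed
  have "(\<lambda>n. bits.prob (\<Union>m<n. G m)) \<longlonglongrightarrow> bits.prob (\<Union>n. \<Union>m<n. G m)"
    by (rule bits.finite_Lim_measure_incseq) (auto simp: incseq_def intro: less_le_trans)
  then have "bits.prob (\<Union>n. \<Union>m<n. G m) \<le> real M / nu e k"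
    by (rule LIMSEQ_le_const2) (use fin in auto)
  moreover have "(\<Union>n. \<Union>m<n. G m) = {\<omega>. \<exists>m. mark e k \<omega> (t - int m) \<and>
           card {m'. m' < m \<and> mark e (k - 1) \<omega> (t - int m')} < M}"
    by (auto simp: G_def)
  ultimately show ?thesis by simp
qed

section \<open>Growth of \<nu>_k and almost sure properties of the environment\<close>

lemma nu_Suc_ge:
  assumes e: "0 < e"
  shows "2 powr (e\<^sup>2 * real k - 1) \<le> nu e (Suc k)"
proof -
  have "e * (1 + real k * e) \<le> e * (1 + e) ^ k"
    using e Bernoulli_inequality[of e k] by (intro mult_left_mono) auto
  moreover have "(1 + e) ^ Suc k \<le> real (ell e (Suc k))"
    using e unfolding ell_def by linarith
  moreover have "real (ell e k) \<le> (1 + e) ^ k + 1"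
    using e unfolding ell_def by (simp add: of_nat_nat)
  moreover have "ell e k \<le> ell e (Suc k)" using e by (rule ell_mono) simp
  ultimately have "e\<^sup>2 * real k - 1 \<le> real (ell e (Suc k) - ell e k)"
    using e by (simp add: of_nat_diff algebra_simps power2_eq_square)
  then have "2 powr (e\<^sup>2 * real k - 1) \<le> 2 powr real (ell e (Suc k) - ell e k)" by simp
  also have "\<dots> = nu e (Suc k)" using e by (simp add: nu_eq powr_realpow)
  finally show ?thesis .
qed

lemma nu_pos: "0 < e \<Longrightarrow> 0 < nu e k"
  by (simp add: nu_eq)

lemma summable_nu_powr:
  assumes e: "0 < e" and c: "0 < c"
  shows "summable (\<lambda>k. nu e (Suc k) powr (- c))"
proof (rule summable_comparison_test')
  have "(2 powr (- (e\<^sup>2 * c))) < 2 powr 0" using e c by (intro powr_less_mono) auto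
  then show "summable (\<lambda>k. 2 powr c * (2 powr (- (e\<^sup>2 * c))) ^ k)"
    by (intro summable_mult summable_geometric) simp
  fix k
  have "nu e (Suc k) powr (- c) \<le> (2 powr (e\<^sup>2 * real k - 1)) powr (- c)"
    using nu_Suc_ge[OF e, of k] c by (intro powr_mono2') auto
  also have "\<dots> = 2 powr c * (2 powr (- (e\<^sup>2 * c))) ^ k"
    by (simp add: powr_powr powr_realpow[symmetric] powr_add[symmetric] algebra_simps)
  finally show "norm (nu e (Suc k) powr (- c)) \<le> 2 powr c * (2 powr (- (e\<^sup>2 * c))) ^ k" by simp
qed

lemma filterlim_nu_powr:
  assumes e: "0 < e" and c: "0 < c"
  shows "filterlim (\<lambda>k. nu e k powr c) at_top sequentially"
proof -
  have "(\<lambda>k. nu e (Suc k) powr (- c)) \<longlonglongrightarrow> 0"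
    by (rule summable_LIMSEQ_zero[OF summable_nu_powr[OF e c]])
  then have "filterlim (\<lambda>k. inverse (nu e (Suc k) powr (- c))) at_top sequentially"
    using nu_pos[OF e] by (intro filterlim_inverse_at_top) (simp_all add: less_imp_neq[symmetric])
  then have "filterlim (\<lambda>k. nu e (Suc k) powr c) at_top sequentially"
    by (simp add: powr_minus)
  then show ?thesis by (rule filterlim_sequentially_Suc[THEN iffD1])
qed

lemma AE_marked:
  assumes e: "0 < e"
  shows "AE \<omega> in bits. \<forall>k. marked e k \<omega>"
proof -
  have "AE \<omega> in bits. \<exists>n. mark e k \<omega> (t - int n)" for k t
  proof -
    have "bits.prob {\<omega>. \<forall>m. \<not> mark e k \<omega> (t - int m)} \<le> 0"
    proof (rule field_le_epsilon)
      fix \<epsilon> :: real assume "0 < \<epsilon>"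
      obtain n where n: "beta e k / \<epsilon> < real n" using reals_Archimedean2 by blast
      have b: "0 < beta e k" by (simp add: beta_def)
      have n0: "0 < real n" using b \<open>0 < \<epsilon>\<close> n by (meson divide_pos_pos less_trans)
      have "{\<omega> \<in> space bits. \<forall>m<n. \<not> mark e k \<omega> (t - int m)} \<in> sets bits" by measurable
      then have "bits.prob {\<omega>. \<forall>m. \<not> mark e k \<omega> (t - int m)} \<le> bits.prob {\<omega>. \<forall>m<n. \<not> mark e k \<omega> (t - int m)}"
        by (intro bits.finite_measure_mono) auto
      also have "\<dots> \<le> beta e k / real n"
        using prob_no_mark[OF e, of n k t] n0 by (simp add: field_simps)
      also have "\<dots> \<le> \<epsilon>" using n n0 \<open>0 < \<epsilon>\<close> by (simp add: field_simps)
      finally show "bits.prob {\<omega>. \<forall>m. \<not> mark e k \<omega> (t - int m)} \<le> 0 + \<epsilon>" by simp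
    qed
    then have z: "bits.prob {\<omega>. \<forall>m. \<not> mark e k \<omega> (t - int m)} = 0"
      using measure_nonneg[of bits "{\<omega>. \<forall>m. \<not> mark e k \<omega> (t - int m)}"] by linarith
    have "{\<omega> \<in> space bits. \<forall>m. \<not> mark e k \<omega> (t - int m)} \<in> sets bits" by measurable
    then have "{\<omega>. \<forall>m. \<not> mark e k \<omega> (t - int m)} \<in> null_sets bits"
      using z by (simp add: null_sets_def bits.emeasure_eq_measure)
    then show ?thesis by (rule AE_I') auto
  qed
  then show ?thesis unfolding marked_def by (simp add: AE_all_countable)
qed

text \<open>Taking n = \<beta>_(k+1) in \<open>prob_no_mark\<close> bounds the failure probability
  by \<beta>_k / \<beta>_(k+1) = 1 / \<nu>_(k+1), which is summable.\<close>

lemma AE_eventually_gap: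
  assumes e: "0 < e"
  shows "AE \<omega> in bits. \<forall>t. \<forall>\<^sub>F k in sequentially. real (gap e k \<omega> t) < beta e (k + 1)"
  unfolding AE_all_countable
proof
  fix t
  define A where "A k = {\<omega>. \<forall>m<2 ^ ell e (Suc k). \<not> mark e k \<omega> (t - int m)}" for k
  have A: "A k \<in> sets bits" for k
    unfolding A_def by (rule sets_CollectI) (simp, measurable)
  have "bits.prob (A k) \<le> nu e (Suc k) powr (- 1)" for k
    using prob_no_mark[OF e, of "2 ^ ell e (Suc k)" k t] nu_pos[OF e, of "Suc k"]
    by (simp add: A_def powr_minus nu_def beta_def field_simps)
  then have "summable (\<lambda>k. bits.prob (A k))"
    by (intro summable_comparison_test'[OF summable_nu_powr[OF e zero_less_one], of 0]) simp
  then have "AE \<omega> in bits. \<forall>\<^sub>F k in sequentially. \<omega> \<in> space bits - A k"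
    using A by (intro borel_cantelli_AE1) (auto simp: bits.emeasure_eq_measure)
  then show "AE \<omega> in bits. \<forall>\<^sub>F k in sequentially. real (gap e k \<omega> t) < beta e (k + 1)"
  proof eventually_elim
    case (elim \<omega>)
    then show ?case
    proof eventually_elim
      case (elim k)
      then obtain m where m: "m < 2 ^ ell e (Suc k)" "mark e k \<omega> (t - int m)" by (auto simp: A_def)
      then have "real (gap e k \<omega> t) < real (2 ^ ell e (Suc k))"
        using gap_le[OF m(2)] by (simp only: of_nat_less_iff)
      then show ?case by (simp add: beta_def)
    qed
  qed
qed

text \<open>With M the integer part of \<nu>^(1-e), the bound M / \<nu> is at most \<nu>^(-e), which
  is summable. So the exponent 1 - e makes a beginning short enough for t to leave it at all large
  levels.\<close>

lemma AE_eventually_mark_count: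
  assumes e: "0 < e"
  shows "AE \<omega> in bits. \<forall>t. \<forall>\<^sub>F k in sequentially. \<lfloor>nu e k powr (1 - e)\<rfloor> < int (mark_count e k \<omega> t)"
  unfolding AE_all_countable
proof
  fix t
  define M where "M k = nat \<lfloor>nu e (Suc k) powr (1 - e)\<rfloor>" for k
  define A where "A k = {\<omega>. \<exists>m. mark e (Suc k) \<omega> (t - int m) \<and>
           card {m'. m' < m \<and> mark e (Suc k - 1) \<omega> (t - int m')} < M k}" for k
  have A: "A k \<in> sets bits" for k
    unfolding A_def by (rule sets_CollectI) (simp, measurable)
  have "bits.prob (A k) \<le> nu e (Suc k) powr (- e)" for k
  proof -
    have "bits.prob (A k) \<le> real (M k) / nu e (Suc k)" unfolding A_def by (rule prob_few_blocks[OF e])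
    also have "\<dots> \<le> nu e (Suc k) powr (1 - e) / nu e (Suc k)"
      using nu_pos[OF e, of "Suc k"] by (intro divide_right_mono) (simp_all add: M_def)
    also have "\<dots> = nu e (Suc k) powr (- e)"
      using nu_pos[OF e, of "Suc k"] by (simp add: powr_diff powr_minus divide_inverse)
    finally show ?thesis .
  qed
  then have "summable (\<lambda>k. bits.prob (A k))"
    by (intro summable_comparison_test'[OF summable_nu_powr[OF e e], of 0]) simp
  then have "AE \<omega> in bits. \<forall>\<^sub>F k in sequentially. \<omega> \<in> space bits - A k"
    using A by (intro borel_cantelli_AE1) (auto simp: bits.emeasure_eq_measure)
  with AE_marked[OF e]
  show "AE \<omega> in bits. \<forall>\<^sub>F k in sequentially. \<lfloor>nu e k powr (1 - e)\<rfloor> < int (mark_count e k \<omega> t)"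
  proof eventually_elim
    case (elim \<omega>)
    have "\<forall>\<^sub>F k in sequentially. \<lfloor>nu e (Suc k) powr (1 - e)\<rfloor> < int (mark_count e (Suc k) \<omega> t)"
      using elim(2)
    proof eventually_elim
      case (elim k)
      define g where "g = gap e (Suc k) \<omega> t"
      have g: "mark e (Suc k) \<omega> (t - int g)"
        using \<open>\<forall>k. marked e k \<omega>\<close> gap_mark by (simp add: g_def)
      then have "\<not> card {m'. m' < g \<and> mark e k \<omega> (t - int m')} < M k"
        using elim by (auto simp: A_def)
      \<comment> \<open>The k-mark at distance g is itself counted, so \<open>mark_count\<close>
        exceeds by one the number of marks to its right. This turns the bound by M into a strict
        inequality.\<close>
      moreover have "{m'. m' \<le> g \<and> mark e k \<omega> (t - int m')} = insert g {m'. m' < g \<and> mark e k \<omega> (t - int m')}"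
        using mark_mono[OF e _ g, of k] by auto
      then have "mark_count e (Suc k) \<omega> t = Suc (card {m'. m' < g \<and> mark e k \<omega> (t - int m')})"
        by (simp add: mark_count_def g_def)
      ultimately show ?case unfolding M_def by linarith
    qed
    then show ?case by (rule eventually_sequentially_Suc[THEN iffD1])
  qed
qed

section \<open>The uniform noise\<close>

definition unif :: "real measure" where
  "unif = uniform_measure lborel {0..1}"

definition noise :: "(int \<Rightarrow> real) measure" where
  "noise = PiM UNIV (\<lambda>_. unif)"

lemma sets_unif [measurable_cong, simp]: "sets unif = sets borel"
  by (simp add: unif_def)

lemma space_unif [simp]: "space unif = UNIV"
  by (simp add: unif_def)

lemma prob_space_unif: "prob_space unif"
  unfolding unif_def by (rule prob_space_uniform_measure) auto

lemma prob_space_noise: "prob_space noise"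
  unfolding noise_def by (intro prob_space_PiM prob_space_unif)

lemma space_noise [simp]: "space noise = UNIV"
  by (simp add: noise_def space_PiM)

lemma sets_noise [measurable_cong]: "sets noise = sets (PiM UNIV (\<lambda>_. borel))"
  unfolding noise_def by (intro sets_PiM_cong) auto

lemma measurable_noise [measurable]: "(\<lambda>U. U t) \<in> borel_measurable noise"
  unfolding measurable_cong_sets[OF sets_noise refl] by measurable

lemma nn_integral_unif:
  assumes [measurable]: "f \<in> borel_measurable borel"
  shows "(\<integral>\<^sup>+ x. f x \<partial>unif) = (\<integral>\<^sup>+ x. f x * indicator {0..1} x \<partial>lborel)"
  unfolding unif_def by (subst nn_integral_uniform_measure) (auto simp: divide_ennreal_def)

lemma emeasure_unif_atMost:
  assumes "0 \<le> p" "p \<le> 1"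
  shows "emeasure unif {u. u \<le> p} = ennreal p"
proof -
  have "emeasure unif {u. u \<le> p} = emeasure lborel ({0..1} \<inter> {u. u \<le> p}) / emeasure lborel {0..1::real}"
    unfolding unif_def by (rule emeasure_uniform_measure) auto
  also have "{0..1} \<inter> {u. u \<le> p} = {0..p}" using assms by auto
  finally show ?thesis using assms by (simp add: divide_ennreal_def)
qed

interpretation noise: prob_space noise
  by (rule prob_space_noise)

lemma distr_noise_component: "distr noise unif (\<lambda>U. U t) = unif"
  unfolding noise_def by (rule distr_PiM_component) (auto intro: prob_space_unif)

lemma indep_vars_noise: "noise.indep_vars (\<lambda>_. unif) (\<lambda>t U. U t) UNIV"
proof (subst noise.indep_vars_iff_distr_eq_PiM')
  have *: "(\<lambda>x. restrict x UNIV) = (\<lambda>x :: int \<Rightarrow> real. x)" by (simp add: restrict_def)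
  show "distr noise (PiM UNIV (\<lambda>_. unif)) (\<lambda>x. \<lambda>i\<in>UNIV. x i) = PiM UNIV (\<lambda>i. distr noise unif (\<lambda>U. U i))"
    unfolding distr_noise_component * unfolding noise_def by (rule distr_id2) simp
qed (auto simp: measurable_cong_sets[OF refl sets_unif])

text \<open>Counting an element of C together with the larger ones is a bijection from C onto {1,
  ..., card C}. For a set of distances it selects the M leftmost points, that is, the first M
  sub-blocks.\<close>

lemma card_few_successors:
  fixes C :: "nat set"
  assumes "finite C" "M \<le> card C"
  shows "card {m \<in> C. card {m' \<in> C. m \<le> m'} \<le> M} = M"
proof -
  let ?r = "\<lambda>m. card {m' \<in> C. m \<le> m'}"
  have inj: "inj_on ?r C"
  proof (rule linorder_inj_onI)
    fix a b assume *: "a < b" "a \<in> C" "b \<in> C"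
    have "{m' \<in> C. b \<le> m'} \<subseteq> {m' \<in> C. a \<le> m'}" using * by auto
    moreover have "a \<in> {m' \<in> C. a \<le> m'} - {m' \<in> C. b \<le> m'}" using * by auto
    ultimately have "{m' \<in> C. b \<le> m'} \<subset> {m' \<in> C. a \<le> m'}" by blast
    then have "?r b < ?r a" by (rule psubset_card_mono[rotated]) (use assms in simp)
    then show "?r a \<noteq> ?r b" by simp
  qed auto
  have "?r ` C \<subseteq> {1..card C}"
    using assms(1) by (auto simp: Suc_le_eq card_gt_0_iff intro!: card_mono)
  then have im: "?r ` C = {1..card C}"
    by (rule card_subset_eq[rotated]) (simp_all add: card_image[OF inj])
  have "?r ` {m \<in> C. ?r m \<le> M} = {1..M}"
  proof -
    have "?r ` {m \<in> C. ?r m \<le> M} = ?r ` C \<inter> {..M}" by auto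
    then show ?thesis unfolding im using assms(2) by auto
  qed
  moreover have "card (?r ` {m \<in> C. ?r m \<le> M}) = card {m \<in> C. ?r m \<le> M}"
    by (rule card_image, rule inj_on_subset[OF inj]) auto
  ultimately show ?thesis by simp
qed

lemma hoeffding_mean:
  assumes N: "finite N" "N \<noteq> {}" and p: "0 \<le> p" "p \<le> 1" and \<epsilon>: "0 \<le> \<epsilon>"
  shows "noise.prob {U. 2 * p - 1 + \<epsilon> \<le> mean N t (\<lambda>s. U s \<le> p)} \<le> exp (- real (card N) * \<epsilon>\<^sup>2 / 2)" (is ?ge)
    and "noise.prob {U. mean N t (\<lambda>s. U s \<le> p) \<le> 2 * p - 1 - \<epsilon>} \<le> exp (- real (card N) * \<epsilon>\<^sup>2 / 2)" (is ?le)
proof -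
  define I where "I = (\<lambda>n. t - int n) ` N"
  have inj: "inj_on (\<lambda>n. t - int n) N" by (auto simp: inj_on_def)
  have cI: "card I = card N" unfolding I_def by (rule card_image[OF inj])
  have pos: "0 < card N" using N by (simp add: card_gt_0_iff)
  have [measurable]: "(\<lambda>u. spin (u \<le> p)) \<in> borel_measurable borel"
    unfolding spin_def by measurable
  have E: "noise.expectation (\<lambda>U. spin (U s \<le> p)) = 2 * p - 1" for s
  proof -
    have "{U \<in> space noise. U s \<le> p} \<in> sets noise" by measurable
    then have set: "{U. U s \<le> p} \<in> sets noise" by simp
    have "emeasure noise {U. U s \<le> p} = emeasure (distr noise unif (\<lambda>U. U s)) {u. u \<le> p}"
      by (subst emeasure_distr) (auto simp: measurable_cong_sets[OF refl sets_unif] vimage_def)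
    also have "\<dots> = ennreal p" unfolding distr_noise_component by (rule emeasure_unif_atMost[OF p])
    finally have "noise.prob {U. U s \<le> p} = p" using p by (simp add: noise.emeasure_eq_measure)
    moreover have "noise.expectation (\<lambda>U. spin (U s \<le> p)) = noise.expectation (\<lambda>U. 2 * indicator {U. U s \<le> p} U - 1)"
      by (rule Bochner_Integration.integral_cong) (auto simp: spin_def)
    ultimately show ?thesis
      using set noise.prob_space by (simp add: noise.emeasure_eq_measure)
  qed
  interpret Hoeffding_ineq noise I "\<lambda>s U. spin (U s \<le> p)" "\<lambda>_. - 1" "\<lambda>_. 1" "real (card N) * (2 * p - 1)"
  proof unfold_locales
    show "noise.indep_vars (\<lambda>_. borel) (\<lambda>s U. spin (U s \<le> p)) I"
      by (rule noise.indep_vars_compose2[OF noise.indep_vars_subset[OF indep_vars_noise]])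
         (auto simp: measurable_cong_sets[OF sets_unif refl])
    show "real (card N) * (2 * p - 1) \<equiv> \<Sum>s\<in>I. noise.expectation (\<lambda>U. spin (U s \<le> p))"
      unfolding E by (simp add: cI)
  qed (use N in \<open>auto simp: I_def spin_def\<close>)
  have sum: "(\<Sum>s\<in>I. spin (U s \<le> p)) = real (card N) * mean N t (\<lambda>s. U s \<le> p)" for U :: "int \<Rightarrow> real"
    using pos unfolding I_def mean_def by (simp add: sum.reindex[OF inj])
  have ex: "- 2 * (real (card N) * \<epsilon>)\<^sup>2 / (\<Sum>s\<in>I. (1 - - 1)\<^sup>2) = - real (card N) * \<epsilon>\<^sup>2 / 2"
    using pos by (simp add: cI field_simps power2_eq_square)
  have c: "(\<Sum>s\<in>I. (1 - - 1)\<^sup>2 :: real) > 0" "0 \<le> real (card N) * \<epsilon>" using pos \<epsilon> by (simp_all add: cI)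
  show ?ge
    using Hoeffding_ineq_ge[OF c(2,1)] pos
    unfolding ex sum by (simp add: distrib_left[symmetric])
  show ?le
    using Hoeffding_ineq_le[OF c(2,1)] pos
    unfolding ex sum by (simp add: right_diff_distrib[symmetric])
qed

section \<open>Coalescence of the extremal solutions\<close>

locale lipschitz_bramson_kalikow = bramson_kalikow +
  fixes \<delta> L :: real
  assumes \<delta>_pos: "0 < \<delta>" and L_pos: "0 < L"
    and lipschitz: "\<And>z1 z2. z1 \<in> {-\<delta>..\<delta>} \<inter> {-1..1} \<Longrightarrow> z2 \<in> {-\<delta>..\<delta>} \<inter> {-1..1} \<Longrightarrow>
          \<bar>\<phi> z2 - \<phi> z1\<bar> \<le> L * \<bar>z2 - z1\<bar>"
    and h_tendsto: "h \<longlonglongrightarrow> 0"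
begin

section \<open>A fixed typical environment and a fixed time t: the active sets of the blocks
  containing t\<close>

context
  fixes \<omega> :: "int \<Rightarrow> bool" and t :: int and K0 :: nat
  assumes marked: "\<And>k. marked e k \<omega>"
    and K0: "ks \<le> K0"
    and late: "\<And>k. K0 < k \<Longrightarrow> \<lfloor>nu e k powr (1 - e)\<rfloor> < int (mark_count e k \<omega> t)"
    and near: "\<And>k. K0 < k \<Longrightarrow> real (gap e k \<omega> t) < beta e (k + 1)"
begin

text \<open>For k > K0 the point t is late in its k-block, and so is everything to the right of it
  there. The distances listed are then those of all active points of the block.\<close>

definition active_offsets :: "nat \<Rightarrow> nat set" where
  "active_offsets k = {n. 1 \<le> n \<and> n \<le> gap e k \<omega> t \<and> active_at e ks k \<omega> (t - int n)}"

lemma finite_active_offsets [simp]: "finite (active_offsets k)"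
  by (rule finite_subset[of _ "{..gap e k \<omega> t}"]) (auto simp: active_offsets_def)

lemma gap_le_gap: "k \<le> k' \<Longrightarrow> gap e k \<omega> s \<le> gap e k' \<omega> s"
  by (rule gap_mono[OF e_pos marked])

text \<open>A point of the k-block of t has the same index in the (k+1)-block as t, and this index
  is beyond the beginning.\<close>

lemma not_act_Suc:
  assumes "K0 \<le> k" "n \<le> gap e k \<omega> t"
  shows "\<not> active_at e ks (Suc k) \<omega> (t - int n)"
proof -
  have "mark_count e (Suc k) \<omega> (t - int n) = mark_count e (Suc k) \<omega> t"
    using assms gap_le_gap[of k "Suc k" t] by (intro mark_count_shift_eq marked) auto
  then have "\<not> early e ks (Suc k) \<omega> (t - int n)"
    using late[of "Suc k"] assms(1) K0 by (simp add: early_def)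
  then show ?thesis using K0 assms(1) by (auto simp: active_at_def)
qed

lemma level_le:
  assumes "K0 \<le> k" "n \<le> gap e k \<omega> t"
  shows "level e ks \<omega> (t - int n) \<le> Suc k"
  using not_act_Suc[OF assms] K0 assms(1) unfolding level_def by (intro Least_le) auto

lemma level_active_offsets:
  assumes "K0 \<le> k" "n \<in> active_offsets k"
  shows "level e ks \<omega> (t - int n) = Suc k"
proof (rule antisym)
  have n: "n \<le> gap e k \<omega> t" "active_at e ks k \<omega> (t - int n)" using assms(2) by (auto simp: active_offsets_def)
  show "level e ks \<omega> (t - int n) \<le> Suc k" by (rule level_le[OF assms(1) n(1)])
  have "ks \<le> level e ks \<omega> (t - int n) \<and> \<not> active_at e ks (level e ks \<omega> (t - int n)) \<omega> (t - int n)"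
    unfolding level_def
    by (rule LeastI[of _ "Suc k"]) (use not_act_Suc[OF assms(1) n(1)] K0 assms(1) in auto)
  then show "Suc k \<le> level e ks \<omega> (t - int n)" using n(2) by (force simp: active_at_def)
qed

text \<open>Seen from t, a site of level k + 1 in the k-block of t reads the active points of the
  (k+1)-block of t. This set is the same for all such sites, which is what makes their drifts
  equal.\<close>

lemma offsets_of_level_Suc:
  assumes "K0 \<le> k" "n \<le> gap e k \<omega> t" "level e ks \<omega> (t - int n) = Suc k"
  shows "(\<lambda>m. n + m) ` offsets e ks \<omega> (t - int n) = active_offsets (Suc k)"
proof -
  have ex: "\<exists>k\<ge>ks. \<not> active_at e ks k \<omega> (t - int n)"
    using not_act_Suc[OF assms(1,2)] K0 assms(1) by (intro exI[of _ "Suc k"]) auto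
  have g: "n \<le> gap e (Suc k) \<omega> t" using assms(2) gap_le_gap[of k "Suc k" t] by simp
  have off: "offsets e ks \<omega> (t - int n) =
      {m. 1 \<le> m \<and> m \<le> gap e (Suc k) \<omega> t - n \<and> active_at e ks (Suc k) \<omega> (t - int n - int m)}"
    using ex K0 assms(1) unfolding offsets_def assms(3) gap_shift[OF marked g] by auto
  show ?thesis
  proof (intro equalityI subsetI)
    fix m' assume "m' \<in> (\<lambda>m. n + m) ` offsets e ks \<omega> (t - int n)"
    then show "m' \<in> active_offsets (Suc k)" using g unfolding off active_offsets_def by (auto simp: algebra_simps)
  next
    fix m' assume m': "m' \<in> active_offsets (Suc k)"
    \<comment> \<open>No point within the k-block of t is active at level k + 1, so all the active
      points lie strictly to the left of the site at distance n.\<close>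
    then have "n < m'"
      using not_act_Suc[OF assms(1), of m'] assms(2) by (force simp: active_offsets_def not_less)
    then show "m' \<in> (\<lambda>m. n + m) ` offsets e ks \<omega> (t - int n)"
      using m' unfolding off active_offsets_def by (intro image_eqI[of _ _ "m' - n"]) auto
  qed
qed

lemma D_active_offsets:
  assumes "K0 \<le> k" "n \<in> active_offsets k" and ne: "active_offsets (Suc k) \<noteq> {}"
  shows "D \<omega> (t - int n) x = h (Suc k) * \<phi> (mean (active_offsets (Suc k)) t x)"
proof -
  have n: "n \<le> gap e k \<omega> t" using assms(2) by (auto simp: active_offsets_def)
  note lev = level_active_offsets[OF assms(1,2)]
  have im: "active_offsets (Suc k) = (\<lambda>m. n + m) ` offsets e ks \<omega> (t - int n)"
    using offsets_of_level_Suc[OF assms(1) n lev] by simp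
  have "mean (active_offsets (Suc k)) t x = mean (offsets e ks \<omega> (t - int n)) (t - int n) x"
    unfolding im mean_def by (subst sum.reindex) (auto simp: card_image algebra_simps)
  moreover have "gap e (Suc k) \<omega> (t - int n) \<le> gap e (Suc k) \<omega> t"
    using gap_shift[OF marked, of n "Suc k" t] n gap_le_gap[of k "Suc k" t] by simp
  then have "real (gap e (Suc k) \<omega> (t - int n)) < beta e (Suc k + 1)"
    using near[of "Suc k"] assms(1) by simp
  moreover have "offsets e ks \<omega> (t - int n) \<noteq> {}" using ne im by auto
  ultimately show ?thesis unfolding drift_def lev by simp
qed

text \<open>The first points of the first M sub-blocks are active, with M the number of sub-blocks
  allowed in a beginning. Such a point is a mark of every level below k, hence has gap 0 and index
  at most 1 there; at level k its index is at most M.\<close>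

lemma card_active_offsets:
  assumes "K0 < k"
  shows "nat \<lfloor>nu e k powr (1 - e)\<rfloor> \<le> card (active_offsets k)"
proof -
  define M where "M = nat \<lfloor>nu e k powr (1 - e)\<rfloor>"
  define C where "C = {m. m \<le> gap e k \<omega> t \<and> mark e (k - 1) \<omega> (t - int m)}"
  have nu1: "1 \<le> \<lfloor>nu e j powr (1 - e)\<rfloor>" for j
    using e_less by (simp add: nu_eq[OF e_pos] ge_one_powr_ge_zero)
  have fC: "finite C" by (rule finite_subset[of _ "{..gap e k \<omega> t}"]) (auto simp: C_def)
  have cC: "M < card C" using late[OF assms] nu1[of k] unfolding M_def C_def mark_count_def by linarith
  have "{m \<in> C. card {m' \<in> C. m \<le> m'} \<le> M} \<subseteq> active_offsets k"
  proof
    fix m assume "m \<in> {m \<in> C. card {m' \<in> C. m \<le> m'} \<le> M}"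
    then have m: "m \<in> C" "m \<le> gap e k \<omega> t" "mark e (k - 1) \<omega> (t - int m)" "card {m' \<in> C. m \<le> m'} \<le> M"
      by (auto simp: C_def)
    \<comment> \<open>Distance 0 would have all of C at or beyond it, and C has more than M
      elements.\<close>
    have "1 \<le> m"
    proof (rule ccontr)
      assume "\<not> 1 \<le> m"
      then have "{m' \<in> C. m \<le> m'} = C" by auto
      then show False using m(4) cC by simp
    qed
    have "early e ks j \<omega> (t - int m)" if "ks \<le> j" "j \<le> k" for j
    proof (cases "j = k")
      case True
      have "mark_count e k \<omega> (t - int m) \<le> card {m' \<in> C. m \<le> m'}"
        unfolding mark_count_def gap_shift[OF marked m(2)]
        by (rule card_inj_on_le[where f = "\<lambda>l. l + m"])
           (use fC m(2) in \<open>auto simp: C_def algebra_simps\<close>)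
      then have "int (mark_count e k \<omega> (t - int m)) \<le> \<lfloor>nu e k powr (1 - e)\<rfloor>"
        using m(4) nu1[of k] unfolding M_def by linarith
      moreover have "real (gap e k \<omega> (t - int m)) < beta e (k + 1)"
        using near[OF assms] gap_shift[OF marked m(2)] by simp
      ultimately show ?thesis using True assms K0 by (simp add: early_def)
    next
      case False
      then have "mark e j \<omega> (t - int m - int 0)"
        using mark_mono[OF e_pos _ m(3), of j] that by simp
      then have g0: "gap e j \<omega> (t - int m) = 0" using gap_le by blast
      have "mark_count e j \<omega> (t - int m) \<le> card {0::nat}"
        unfolding mark_count_def g0 by (intro card_mono) auto
      then have "mark_count e j \<omega> (t - int m) \<le> 1" by simp
      then have "int (mark_count e j \<omega> (t - int m)) \<le> \<lfloor>nu e j powr (1 - e)\<rfloor>" using nu1[of j] by linarith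
      then show ?thesis using g0 by (auto simp: early_def beta_def)
    qed
    then show "m \<in> active_offsets k" using m(2) \<open>1 \<le> m\<close> by (simp add: active_offsets_def active_at_def)
  qed
  then have "card {m \<in> C. card {m' \<in> C. m \<le> m'} \<le> M} \<le> card (active_offsets k)"
    by (intro card_mono) simp_all
  then show ?thesis using card_few_successors[OF fC, of M] cC by (simp add: M_def)
qed

text \<open>Induction from the left end of the k-block. A site of level k + 1 reads active points of
  the (k+1)-block, where x and y agree by assumption. A site of level at most k reads only sites to
  its left in its own smaller block, which lies in the k-block.\<close>

lemma fixed_points_coincide:
  assumes "K0 \<le> k"
    and x: "\<And>s. x s \<longleftrightarrow> U s \<le> (1 + D \<omega> s x) / 2"
    and y: "\<And>s. y s \<longleftrightarrow> U s \<le> (1 + D \<omega> s y) / 2"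
    and eq: "\<And>n. n \<in> active_offsets (Suc k) \<Longrightarrow> x (t - int n) = y (t - int n)"
    and "n \<le> gap e k \<omega> t"
  shows "x (t - int n) = y (t - int n)"
  using assms(5)
proof (induction "gap e k \<omega> t - n" arbitrary: n rule: less_induct)
  case less
  define l where "l = level e ks \<omega> (t - int n)"
  have "D \<omega> (t - int n) x = D \<omega> (t - int n) y"
  proof (rule drift_cong_offsets)
    fix m assume m: "m \<in> offsets e ks \<omega> (t - int n)"
    show "x (t - int n - int m) = y (t - int n - int m)"
    proof (cases "l = Suc k")
      case True
      then have "n + m \<in> active_offsets (Suc k)"
        using offsets_of_level_Suc[OF assms(1) less.prems] m by (auto simp: l_def)
      from eq[OF this] show ?thesis by (simp add: algebra_simps)
    next
      case False
      then have "l \<le> k" using level_le[OF assms(1) less.prems] by (simp add: l_def)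
      moreover have m1: "1 \<le> m" "m \<le> gap e l \<omega> (t - int n)" using m by (auto simp: offsets_def l_def)
      ultimately have "m \<le> gap e k \<omega> t - n"
        using gap_le_gap[of l k "t - int n"] gap_shift[OF marked less.prems] by simp
      then have "x (t - int (n + m)) = y (t - int (n + m))"
        using m1(1) less.prems by (intro less.hyps) auto
      then show ?thesis by (simp add: algebra_simps)
    qed
  qed
  then show ?case by (simp add: x[of "t - int n"] y[of "t - int n"])
qed

lemma measurable_top [measurable]: "Measurable.pred noise (\<lambda>U. top_spins \<omega> U s)"
  by (rule measurable_top_spins) auto

lemma measurable_bot [measurable]: "Measurable.pred noise (\<lambda>U. bot_spins \<omega> U s)"
  by (rule measurable_bot_spins) auto

lemma measurable_D_top [measurable]: "(\<lambda>U. D \<omega> s (top_spins \<omega> U)) \<in> borel_measurable noise"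
  by (rule measurable_drift) auto

lemma measurable_D_bot [measurable]: "(\<lambda>U. D \<omega> s (bot_spins \<omega> U)) \<in> borel_measurable noise"
  by (rule measurable_drift) auto

text \<open>Resample the uniform variable at s. The drift at s depends on earlier spins only and
  stays the same, so the fresh variable yields a positive spin with probability (1 + D) / 2, that
  is, expected spin D.\<close>

lemma expectation_spin_fixed:
  fixes y :: "(int \<Rightarrow> real) \<Rightarrow> int \<Rightarrow> bool"
  assumes fixed: "\<And>U. y U s \<longleftrightarrow> U s \<le> (1 + D \<omega> s (y U)) / 2"
    and past: "\<And>U u n. 1 \<le> n \<Longrightarrow> y (U(s := u)) (s - int n) = y U (s - int n)"
    and [measurable]: "Measurable.pred noise (\<lambda>U. y U s)"
      "(\<lambda>U. D \<omega> s (y U)) \<in> borel_measurable noise"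
  shows "noise.expectation (\<lambda>U. spin (y U s)) = noise.expectation (\<lambda>U. D \<omega> s (y U))"
proof -
  have D_past: "D \<omega> s (y (U(s := u))) = D \<omega> s (y U)" for U u
    by (rule drift_cong_offsets) (simp add: offsets_def past)
  have p: "0 \<le> (1 + D \<omega> s x) / 2" "(1 + D \<omega> s x) / 2 \<le> 1" for x
    using D_less[of \<omega> s x] by (auto simp: abs_less_iff)
  have set: "{U. y U s} \<in> sets noise"
    by (rule sets_CollectI) (simp, measurable)
  have "emeasure noise {U. y U s} = (\<integral>\<^sup>+ U. indicator {U. y U s} U \<partial>noise)" using set by simp
  also have "\<dots> = (\<integral>\<^sup>+ U. (\<integral>\<^sup>+ u. indicator {U. y U s} (U(s := u)) \<partial>unif) \<partial>noise)"
    unfolding noise_def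
    by (rule nn_integral_PiM_resample[OF prob_space_unif]) (use set in \<open>simp add: noise_def[symmetric]\<close>)
  also have "\<dots> = (\<integral>\<^sup>+ U. ennreal ((1 + D \<omega> s (y U)) / 2) \<partial>noise)"
  proof (rule nn_integral_cong)
    fix U
    have "(\<integral>\<^sup>+ u. indicator {U. y U s} (U(s := u)) \<partial>unif) =
      (\<integral>\<^sup>+ u. indicator {u. u \<le> (1 + D \<omega> s (y U)) / 2} u \<partial>unif)"
      by (rule nn_integral_cong) (simp add: indicator_def fixed[of "U(s := _)"] D_past)
    also have "\<dots> = emeasure unif {u. u \<le> (1 + D \<omega> s (y U)) / 2}" by (rule nn_integral_indicator) simp
    also have "\<dots> = ennreal ((1 + D \<omega> s (y U)) / 2)" by (rule emeasure_unif_atMost[OF p])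
    finally show "(\<integral>\<^sup>+ u. indicator {U. y U s} (U(s := u)) \<partial>unif) = ennreal ((1 + D \<omega> s (y U)) / 2)" .
  qed
  also have "\<dots> = ennreal (noise.expectation (\<lambda>U. (1 + D \<omega> s (y U)) / 2))"
    by (rule nn_integral_eq_integral)
       (use p in \<open>auto intro!: noise.integrable_const_bound[where B = 1] simp: abs_le_iff\<close>)
  finally have "noise.prob {U. y U s} = noise.expectation (\<lambda>U. (1 + D \<omega> s (y U)) / 2)"
    using p by (simp add: noise.emeasure_eq_measure)
  moreover have iD: "integrable noise (\<lambda>U. D \<omega> s (y U))"
    using D_less by (intro noise.integrable_const_bound[where B = 1]) (auto intro!: AE_I2 less_imp_le)
  ultimately have prob: "2 * noise.prob {U. y U s} = 1 + noise.expectation (\<lambda>U. D \<omega> s (y U))"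
    using noise.prob_space by (simp add: field_simps)
  have "noise.expectation (\<lambda>U. spin (y U s)) = noise.expectation (\<lambda>U. 2 * indicator {U. y U s} U - 1)"
    by (rule Bochner_Integration.integral_cong) (auto simp: spin_def)
  also have "\<dots> = 2 * noise.prob {U. y U s} - 1"
    using set noise.prob_space by (simp add: noise.emeasure_eq_measure)
  finally show ?thesis using prob by simp
qed

lemma expectation_top: "noise.expectation (\<lambda>U. spin (top_spins \<omega> U s)) = noise.expectation (\<lambda>U. D \<omega> s (top_spins \<omega> U))"
  by (rule expectation_spin_fixed[where y = "top_spins \<omega>"], rule top_spins_fixed)
     (auto intro!: top_spins_cong)

lemma expectation_bot: "noise.expectation (\<lambda>U. spin (bot_spins \<omega> U s)) = noise.expectation (\<lambda>U. D \<omega> s (bot_spins \<omega> U))"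
  by (rule expectation_spin_fixed[where y = "bot_spins \<omega>"], rule bot_spins_fixed)
     (auto intro!: bot_spins_cong)

lemma bot_le_top: "bot_spins \<omega> U s \<Longrightarrow> top_spins \<omega> U s"
  using fixed_point_bounds(1)[OF top_spins_fixed] .

abbreviation top_mean :: "nat \<Rightarrow> (int \<Rightarrow> real) \<Rightarrow> real" where
  "top_mean k U \<equiv> mean (active_offsets k) t (top_spins \<omega> U)"

abbreviation bot_mean :: "nat \<Rightarrow> (int \<Rightarrow> real) \<Rightarrow> real" where
  "bot_mean k U \<equiv> mean (active_offsets k) t (bot_spins \<omega> U)"

definition spread :: "nat \<Rightarrow> real" where
  "spread k = noise.expectation (\<lambda>U. top_mean k U - bot_mean k U)"

abbreviation discrepancy :: "int \<Rightarrow> real" where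
  "discrepancy s \<equiv> noise.expectation (\<lambda>U. spin (top_spins \<omega> U s)) - noise.expectation (\<lambda>U. spin (bot_spins \<omega> U s))"

text \<open>Two one-sided conditions suffice: the lower mean never exceeds the upper one, so outside
  this event both lie in [-\<delta>, \<delta>].\<close>

definition bad :: "nat \<Rightarrow> (int \<Rightarrow> real) set" where
  "bad k = {U. \<delta> < top_mean k U \<or> bot_mean k U < - \<delta>}"

lemma measurable_mean_top [measurable]: "(\<lambda>U. mean N t (top_spins \<omega> U)) \<in> borel_measurable noise"
  unfolding mean_def spin_def by measurable

lemma measurable_mean_bot [measurable]: "(\<lambda>U. mean N t (bot_spins \<omega> U)) \<in> borel_measurable noise"
  unfolding mean_def spin_def by measurable

lemma sets_bad [measurable]: "bad k \<in> sets noise"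
proof -
  have "{U \<in> space noise. \<delta> < top_mean k U \<or>
      bot_mean k U < - \<delta>} \<in> sets noise" by measurable
  then show ?thesis by (simp add: bad_def)
qed

lemma integrable_mean: "integrable noise (\<lambda>U. mean N t (top_spins \<omega> U))" "integrable noise (\<lambda>U. mean N t (bot_spins \<omega> U))"
  using mean_bounds by (auto intro!: noise.integrable_const_bound[where B = 1] AE_I2 simp: abs_le_iff)

lemma integrable_spins: "integrable noise (\<lambda>U. spin (top_spins \<omega> U s))" "integrable noise (\<lambda>U. spin (bot_spins \<omega> U s))"
  by (auto intro!: noise.integrable_const_bound[where B = 1] AE_I2 simp: spin_def)

lemma integrable_drifts: "integrable noise (\<lambda>U. D \<omega> s (top_spins \<omega> U))" "integrable noise (\<lambda>U. D \<omega> s (bot_spins \<omega> U))"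
  using D_less by (auto intro!: noise.integrable_const_bound[where B = 1] AE_I2 less_imp_le)

lemma spread_le_2: "spread k \<le> 2"
proof -
  have "spread k \<le> noise.expectation (\<lambda>U. 2)"
    unfolding spread_def
  proof (rule integral_mono)
    fix U
    show "top_mean k U - bot_mean k U \<le> 2"
      using mean_bounds[of "active_offsets k" t "top_spins \<omega> U"] mean_bounds[of "active_offsets k" t "bot_spins \<omega> U"]
      by auto
  qed (auto intro!: Bochner_Integration.integrable_diff integrable_mean)
  then show ?thesis using noise.prob_space by simp
qed

lemma spread_eq_sum:
  "spread k = (\<Sum>n\<in>active_offsets k. discrepancy (t - int n)) / real (card (active_offsets k))"
  unfolding spread_def
  by (subst Bochner_Integration.integral_diff[OF integrable_mean])
     (simp add: mean_def sum_subtractf diff_divide_distrib integrable_spins)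

text \<open>Off the bad event the Lipschitz bound applies to both means. On it, 2 is the largest
  possible difference of values of \<open>\<phi>\<close>.\<close>

lemma \<phi>_diff_le:
  "\<phi> (top_mean k U) - \<phi> (bot_mean k U) \<le>
   L * (top_mean k U - bot_mean k U) + 2 * indicator (bad k) U"
proof -
  let ?p = "top_mean k U" and ?m = "bot_mean k U"
  have le: "?m \<le> ?p" by (rule mean_mono) (rule bot_le_top)
  show ?thesis
  proof (cases "U \<in> bad k")
    case True
    have "0 \<le> L * (?p - ?m)" using le L_pos by simp
    moreover have "\<phi> ?p - \<phi> ?m \<le> 2" using \<phi>_range[OF mean_bounds[of "active_offsets k" t "top_spins \<omega> U"]]
        \<phi>_range[OF mean_bounds[of "active_offsets k" t "bot_spins \<omega> U"]] by auto
    ultimately show ?thesis using True by simp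
  next
    case False
    then have "?p \<in> {-\<delta>..\<delta>} \<inter> {-1..1}" "?m \<in> {-\<delta>..\<delta>} \<inter> {-1..1}"
      using le mean_bounds[of "active_offsets k" t "top_spins \<omega> U"] mean_bounds[of "active_offsets k" t "bot_spins \<omega> U"]
      by (auto simp: bad_def)
    from lipschitz[OF this(2,1)] show ?thesis using False le by simp
  qed
qed

text \<open>The spread is the average of the discrepancies of the active sites. Each of these equals
  an expected difference of drifts, and all drifts are the same function of the mean one level
  up.\<close>

lemma spread_step:
  assumes k: "K0 \<le> k" and ne: "active_offsets k \<noteq> {}" "active_offsets (Suc k) \<noteq> {}"
  shows "spread k \<le> h (Suc k) * (L * spread (Suc k) + 2 * noise.prob (bad (Suc k)))"
proof -
  let ?c = "h (Suc k) * (L * spread (Suc k) + 2 * noise.prob (bad (Suc k)))"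
  have hp: "0 < h (Suc k)" using k K0 by (intro h_pos) simp
  have "discrepancy (t - int n) \<le> ?c" if n: "n \<in> active_offsets k" for n
  proof -
    have "discrepancy (t - int n) =
        noise.expectation (\<lambda>U. D \<omega> (t - int n) (top_spins \<omega> U) - D \<omega> (t - int n) (bot_spins \<omega> U))"
      unfolding expectation_top expectation_bot
      by (rule Bochner_Integration.integral_diff[OF integrable_drifts, symmetric])
    also have "\<dots> \<le> noise.expectation (\<lambda>U. h (Suc k) * (L * (top_mean (Suc k) U -
        bot_mean (Suc k) U) + 2 * indicator (bad (Suc k)) U))"
    proof (rule integral_mono)
      fix U
      show "D \<omega> (t - int n) (top_spins \<omega> U) - D \<omega> (t - int n) (bot_spins \<omega> U) \<le>
        h (Suc k) * (L * (top_mean (Suc k) U -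
        bot_mean (Suc k) U) + 2 * indicator (bad (Suc k)) U)"
        unfolding D_active_offsets[OF k n ne(2)] right_diff_distrib[symmetric]
        using \<phi>_diff_le hp by (intro mult_left_mono) auto
    qed (auto intro!: Bochner_Integration.integrable_diff Bochner_Integration.integrable_add
        integrable_drifts integrable_mean integrable_mult_right simp: noise.emeasure_eq_measure)
    also have "\<dots> = ?c"
      unfolding spread_def
      by (simp add: integrable_mean noise.emeasure_eq_measure)
    finally show ?thesis .
  qed
  then have "spread k \<le> (\<Sum>n\<in>active_offsets k. ?c) / real (card (active_offsets k))"
    unfolding spread_eq_sum by (intro divide_right_mono sum_mono) auto
  also have "\<dots> = ?c" using ne by simp
  finally show ?thesis .
qed

lemma prob_bad:
  assumes k: "K0 \<le> k" and ne: "active_offsets k \<noteq> {}" and small: "h (Suc k) \<le> \<delta> / 2"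
  shows "noise.prob (bad k) \<le> 2 * exp (- real (card (active_offsets k)) * \<delta>\<^sup>2 / 8)"
proof -
  let ?N = "active_offsets k" and ?h = "h (Suc k)"
  have hp: "0 < ?h" "?h < 1"
    using h_pos[of "Suc k"] h_le[of "Suc k"] h_less k K0 by auto
  have Dle: "\<bar>D \<omega> (t - int n) x\<bar> \<le> ?h" if "n \<in> ?N" for n x
    using D_bound_level[of \<omega> "t - int n" x] level_active_offsets[OF k that] hp by (auto split: if_splits)
  have sp: "spin a \<le> spin b" if "a \<longrightarrow> b" for a b using that by (simp add: spin_def)
  have top: "mean ?N t (top_spins \<omega> U) \<le> mean ?N t (\<lambda>s. U s \<le> (1 + ?h) / 2)" for U
    unfolding mean_def
  proof (intro divide_right_mono sum_mono sp impI)
    fix n assume "n \<in> ?N" "top_spins \<omega> U (t - int n)"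
    then show "U (t - int n) \<le> (1 + ?h) / 2"
      using Dle[of n "top_spins \<omega> U"] top_spins_fixed[of \<omega> U "t - int n"] by (auto simp: abs_le_iff)
  qed simp
  have bot: "mean ?N t (\<lambda>s. U s \<le> (1 - ?h) / 2) \<le> mean ?N t (bot_spins \<omega> U)" for U
    unfolding mean_def
  proof (intro divide_right_mono sum_mono sp impI)
    fix n assume "n \<in> ?N" "U (t - int n) \<le> (1 - ?h) / 2"
    then show "bot_spins \<omega> U (t - int n)"
      using Dle[of n "bot_spins \<omega> U"] bot_spins_fixed[of \<omega> U "t - int n"] by (auto simp: abs_le_iff)
  qed simp
  let ?A = "{U. 2 * ((1 + ?h) / 2) - 1 + \<delta> / 2 \<le> mean ?N t (\<lambda>s. U s \<le> (1 + ?h) / 2)}"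
  let ?B = "{U. mean ?N t (\<lambda>s. U s \<le> (1 - ?h) / 2) \<le> 2 * ((1 - ?h) / 2) - 1 - \<delta> / 2}"
  have m: "(\<lambda>U. mean ?N t (\<lambda>s. U s \<le> p)) \<in> borel_measurable noise" for p
    unfolding mean_def spin_def by measurable
  note m[of "(1 + ?h) / 2", measurable] m[of "(1 - ?h) / 2", measurable]
  have "{U \<in> space noise. 2 * ((1 + ?h) / 2) - 1 + \<delta> / 2 \<le> mean ?N t (\<lambda>s. U s \<le> (1 + ?h) / 2)} \<in> sets noise"
    "{U \<in> space noise. mean ?N t (\<lambda>s. U s \<le> (1 - ?h) / 2) \<le> 2 * ((1 - ?h) / 2) - 1 - \<delta> / 2} \<in> sets noise"
    by measurable
  then have AB: "?A \<in> sets noise" "?B \<in> sets noise" by simp_all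
  have "bad k \<subseteq> ?A \<union> ?B"
  proof
    fix U assume "U \<in> bad k"
    then show "U \<in> ?A \<union> ?B" using top[of U] bot[of U] small by (auto simp: bad_def field_simps)
  qed
  then have "noise.prob (bad k) \<le> noise.prob (?A \<union> ?B)" using AB by (intro noise.finite_measure_mono) auto
  also have "\<dots> \<le> noise.prob ?A + noise.prob ?B" using AB by (intro measure_Un_le)
  also have "\<dots> \<le> exp (- real (card ?N) * (\<delta> / 2)\<^sup>2 / 2) + exp (- real (card ?N) * (\<delta> / 2)\<^sup>2 / 2)"
    using hp \<delta>_pos ne by (intro add_mono hoeffding_mean) auto
  finally show ?thesis by (simp add: power_divide)
qed

text \<open>One step gives a \<le> a'/2 + 2b, whose fixed point is 4b. The induction climbs n
  levels, where the spread is bounded trivially by 2; the bound b must therefore hold at all levels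
  above k.\<close>

lemma spread_le:
  assumes "K0 \<le> k"
    and ne: "\<And>j. k \<le> j \<Longrightarrow> active_offsets j \<noteq> {}"
    and small: "\<And>j. k \<le> j \<Longrightarrow> h j * L \<le> 1 / 2"
    and bad: "\<And>j. k < j \<Longrightarrow> noise.prob (bad j) \<le> b"
  shows "spread k \<le> 2 * (1 / 2) ^ n + 4 * b"
  using assms
proof (induction n arbitrary: k)
  case 0
  have "0 \<le> b" using order_trans[OF measure_nonneg 0(4)[of "Suc k"]] by simp
  then show ?case using spread_le_2[of k] by simp
next
  case (Suc n)
  have IH: "spread (Suc k) \<le> 2 * (1 / 2) ^ n + 4 * b"
    by (rule Suc.IH) (use Suc.prems in auto)
  have b0: "0 \<le> b" using order_trans[OF measure_nonneg Suc.prems(4)[of "Suc k"]] by simp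
  have hp: "0 < h (Suc k)" "h (Suc k) \<le> 1"
    using h_pos[of "Suc k"] h_le[of "Suc k"] h_less Suc.prems(1) K0 by auto
  have "spread k \<le> h (Suc k) * (L * spread (Suc k) + 2 * noise.prob (bad (Suc k)))"
    by (rule spread_step) (use Suc.prems in auto)
  also have "\<dots> \<le> h (Suc k) * (L * (2 * (1 / 2) ^ n + 4 * b) + 2 * b)"
    using hp L_pos IH Suc.prems(4)[of "Suc k"] by (intro mult_left_mono add_mono) auto
  also have "\<dots> = (h (Suc k) * L) * (2 * (1 / 2) ^ n + 4 * b) + h (Suc k) * (2 * b)"
    by (simp add: algebra_simps)
  also have "\<dots> \<le> (1 / 2) * (2 * (1 / 2) ^ n + 4 * b) + 1 * (2 * b)"
    using Suc.prems(3)[of "Suc k"] hp b0 by (intro add_mono mult_right_mono) auto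
  finally show ?case by (simp add: add_divide_distrib)
qed

text \<open>A disagreement at t is inherited from some active point of level k. By the ordering of
  the two solutions, the probability of disagreement at a site is half the difference of the
  expected spins, so the union bound becomes an average times the number of points.\<close>

lemma prob_disagree_le:
  assumes k: "K0 < k" and ne: "active_offsets k \<noteq> {}"
  shows "noise.prob {U. top_spins \<omega> U t \<noteq> bot_spins \<omega> U t} \<le> real (card (active_offsets k)) * spread k / 2"
proof -
  let ?E = "\<lambda>s. {U. top_spins \<omega> U s \<noteq> bot_spins \<omega> U s}"
  have E: "?E s \<in> sets noise" for s
    by (rule sets_CollectI) (simp, measurable)
  have "?E t \<subseteq> (\<Union>n\<in>active_offsets k. ?E (t - int n))"
  proof (rule ccontr)
    assume "\<not> ?thesis"
    then obtain U where U: "U \<in> ?E t" "\<And>n. n \<in> active_offsets k \<Longrightarrow> U \<notin> ?E (t - int n)" by auto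
    have "top_spins \<omega> U (t - int 0) = bot_spins \<omega> U (t - int 0)"
    \<comment> \<open>Agreement on the active set of level k forces agreement on the part of the
      (k-1)-block up to t, where t is the point at distance 0.\<close>
    proof (rule fixed_points_coincide[of "k - 1", OF _ top_spins_fixed bot_spins_fixed])
      fix n assume "n \<in> active_offsets (Suc (k - 1))"
      then show "top_spins \<omega> U (t - int n) = bot_spins \<omega> U (t - int n)" using U(2)[of n] k by simp
    qed (use k in auto)
    then show False using U(1) by simp
  qed
  then have "noise.prob (?E t) \<le> noise.prob (\<Union>n\<in>active_offsets k. ?E (t - int n))"
    using E by (intro noise.finite_measure_mono sets.finite_UN) auto
  also have "\<dots> \<le> (\<Sum>n\<in>active_offsets k. noise.prob (?E (t - int n)))"
    using E by (intro noise.finite_measure_subadditive_finite) auto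
  also have "\<dots> = (\<Sum>n\<in>active_offsets k. discrepancy (t - int n) / 2)"
  proof (rule sum.cong[OF refl])
    fix n
    let ?s = "t - int n"
    have "discrepancy ?s =
      noise.expectation (\<lambda>U. spin (top_spins \<omega> U ?s) - spin (bot_spins \<omega> U ?s))"
      by (rule Bochner_Integration.integral_diff[OF integrable_spins, symmetric])
    also have "\<dots> = noise.expectation (\<lambda>U. 2 * indicator (?E ?s) U)"
      by (rule Bochner_Integration.integral_cong) (use bot_le_top in \<open>auto simp: spin_def\<close>)
    also have "\<dots> = 2 * noise.prob (?E ?s)" using E[of ?s] by simp
    finally show "noise.prob (?E ?s) = discrepancy ?s / 2" by simp
  qed
  also have "\<dots> = real (card (active_offsets k)) * spread k / 2"
    using ne unfolding spread_eq_sum by (simp add: sum_divide_distrib[symmetric])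
  finally show ?thesis .
qed

lemma prob_disagree_zero: "noise.prob {U. top_spins \<omega> U t \<noteq> bot_spins \<omega> U t} = 0"
proof -
  define c where "c = \<delta>\<^sup>2 / 8"
  have c: "0 < c" using \<delta>_pos by (simp add: c_def)
  have "((\<lambda>x :: real. 4 * (2 * (x * exp (- (c * x))))) \<longlongrightarrow> 0) at_top"
    using c by real_asymp
  moreover have top: "filterlim (\<lambda>k. real (card (active_offsets k))) at_top sequentially"
  proof -
    have "filterlim (\<lambda>k. nu e k powr (1 - e) - 1) at_top sequentially"
      using filterlim_tendsto_add_at_top[OF tendsto_const filterlim_nu_powr[OF e_pos], of "1 - e" "- 1"] e_less
      by simp
    then show ?thesis
    proof (rule filterlim_at_top_mono)
      show "\<forall>\<^sub>F k in sequentially. nu e k powr (1 - e) - 1 \<le> real (card (active_offsets k))"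
        using eventually_gt_at_top[of K0]
      proof eventually_elim
        case (elim k)
        then show ?case using card_active_offsets[of k] by linarith
      qed
    qed
  qed
  ultimately have lim: "(\<lambda>k. 4 * (2 * (real (card (active_offsets k)) * exp (- (c * real (card (active_offsets k))))))) \<longlonglongrightarrow> 0"
    by (rule filterlim_compose)
  have large: "\<forall>\<^sub>F k in sequentially. 1 \<le> real (card (active_offsets k))"
    using top unfolding filterlim_at_top by blast
  have hL: "\<forall>\<^sub>F k in sequentially. h k * L < 1 / 2" 
    using tendsto_mult_left_zero[OF h_tendsto, of L] by (rule order_tendstoD) simp
  have h\<delta>: "\<forall>\<^sub>F k in sequentially. h k < \<delta> / 2" 
    using h_tendsto by (rule order_tendstoD) (use \<delta>_pos in simp)
  show ?thesis
  proof (rule antisym[OF field_le_epsilon measure_nonneg])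
    fix \<epsilon> :: real assume \<epsilon>: "0 < \<epsilon>"
    have "\<forall>\<^sub>F k in sequentially. 4 * (2 * (real (card (active_offsets k)) * exp (- (c * real (card (active_offsets k)))))) < \<epsilon>"
      by (rule order_tendstoD(2)[OF lim \<epsilon>])
    with large hL h\<delta> eventually_gt_at_top[of K0]
    have "\<forall>\<^sub>F k in sequentially. 1 \<le> real (card (active_offsets k)) \<and> h k * L < 1 / 2 \<and> h k < \<delta> / 2 \<and> K0 < k \<and>
        4 * (2 * (real (card (active_offsets k)) * exp (- (c * real (card (active_offsets k)))))) < \<epsilon>"
      by eventually_elim auto
    then obtain J where J: "\<And>k. J \<le> k \<Longrightarrow> 1 \<le> real (card (active_offsets k)) \<and> h k * L < 1 / 2 \<and> h k < \<delta> / 2 \<and> K0 < k \<and>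
        4 * (2 * (real (card (active_offsets k)) * exp (- (c * real (card (active_offsets k)))))) < \<epsilon>"
      unfolding eventually_sequentially by blast
    \<comment> \<open>Minimality is what makes the single bound \<open>?b\<close>, formed with the
      number of active points at k, valid for the bad events at every higher level.\<close>
    obtain k where k: "J \<le> k" and kmin: "\<And>j. J \<le> j \<Longrightarrow> card (active_offsets k) \<le> card (active_offsets j)"
      using ex_has_least_nat[of "\<lambda>k. J \<le> k" J "\<lambda>k. card (active_offsets k)"] by auto
    let ?n = "real (card (active_offsets k))"
    let ?b = "2 * exp (- (c * ?n))"
    have ne: "active_offsets j \<noteq> {}" if "J \<le> j" for j using J[OF that] by auto
    have bad: "noise.prob (bad j) \<le> ?b" if "k < j" for j
    proof -
      have "noise.prob (bad j) \<le> 2 * exp (- real (card (active_offsets j)) * \<delta>\<^sup>2 / 8)"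
        using J[of j] J[of "Suc j"] k that by (intro prob_bad ne) auto
      also have "\<dots> \<le> ?b" using kmin[of j] k that c by (simp add: c_def)
      finally show ?thesis .
    qed
    have "spread k \<le> 4 * ?b + 2 * (1 / 2) ^ n" for n
      using spread_le[of k ?b n] J k ne bad by (force intro: less_imp_le)
    moreover have "(\<lambda>n. 4 * ?b + 2 * (1 / 2 :: real) ^ n) \<longlonglongrightarrow> 4 * ?b + 2 * 0"
      by (intro tendsto_intros LIMSEQ_power_zero) simp
    ultimately have "spread k \<le> 4 * ?b" by (intro LIMSEQ_le_const) auto
    then have "?n * spread k / 2 \<le> ?n * (4 * ?b) / 2" by (intro divide_right_mono mult_left_mono) auto
    also have "\<dots> = 4 * (?n * exp (- (c * ?n)))" by simp
    also have "\<dots> \<le> 4 * (2 * (?n * exp (- (c * ?n))))" by simp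
    also have "\<dots> \<le> \<epsilon>" using J[OF k] by (intro less_imp_le) blast
    finally show "noise.prob {U. top_spins \<omega> U t \<noteq> bot_spins \<omega> U t} \<le> 0 + \<epsilon>"
      using prob_disagree_le[of k] J[OF k] ne[OF k] by simp
  qed
qed

end

lemma AE_noise_coalesce:
  assumes "\<forall>k. marked e k \<omega>"
    and "\<forall>\<^sub>F k in sequentially. \<lfloor>nu e k powr (1 - e)\<rfloor> < int (mark_count e k \<omega> t)"
    and "\<forall>\<^sub>F k in sequentially. real (gap e k \<omega> t) < beta e (k + 1)"
  shows "AE U in noise. top_spins \<omega> U t = bot_spins \<omega> U t"
proof -
  have "\<forall>\<^sub>F k in sequentially. ks \<le> k \<and> \<lfloor>nu e k powr (1 - e)\<rfloor> < int (mark_count e k \<omega> t) \<and> real (gap e k \<omega> t) < beta e (k + 1)"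
    using eventually_ge_at_top[of ks] assms(2,3) by eventually_elim auto
  then obtain K0 where K0: "\<And>k. K0 \<le> k \<Longrightarrow> ks \<le> k \<and> \<lfloor>nu e k powr (1 - e)\<rfloor> < int (mark_count e k \<omega> t) \<and>
      real (gap e k \<omega> t) < beta e (k + 1)"
    unfolding eventually_sequentially by blast
  have z: "noise.prob {U. top_spins \<omega> U t \<noteq> bot_spins \<omega> U t} = 0"
    by (rule prob_disagree_zero[of \<omega> K0]) (use assms(1) K0 in \<open>auto intro: less_imp_le\<close>)
  have [measurable]: "Measurable.pred noise (\<lambda>U. top_spins \<omega> U t)" "Measurable.pred noise (\<lambda>U. bot_spins \<omega> U t)"
    by (auto intro!: measurable_top_spins measurable_bot_spins)
  have "{U \<in> space noise. top_spins \<omega> U t \<noteq> bot_spins \<omega> U t} \<in> sets noise" by measurable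
  then have "{U. top_spins \<omega> U t \<noteq> bot_spins \<omega> U t} \<in> null_sets noise"
    using z by (simp add: null_sets_def noise.emeasure_eq_measure)
  then show ?thesis by (rule AE_I') auto
qed

end

section \<open>Existence\<close>

abbreviation path_past :: "int \<Rightarrow> (int \<Rightarrow> bool \<times> bool) \<Rightarrow> nat \<Rightarrow> bool \<times> bool" where
  "path_past \<equiv> past (\<lambda>t z. z t)"

abbreviation past_space :: "(nat \<Rightarrow> bool \<times> bool) measure" where
  "past_space \<equiv> PiM UNIV (\<lambda>_. count_space UNIV)"

lemma marked_past:
  assumes agree: "\<And>n. \<omega>' (t' - int n) = \<omega> (t - int n)" and m: "marked e k \<omega>"
  shows "marked e k \<omega>'"
  unfolding marked_def
proof
  fix s
  define n0 where "n0 = nat (t' - s)"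
  obtain m where "mark e k \<omega> (t - int n0 - int m)" using m unfolding marked_def by blast
  then have "mark e k \<omega> (t - int (n0 + m))" by (simp add: algebra_simps)
  then have "mark e k \<omega>' (t' - int (n0 + m))" unfolding mark_cong[of \<omega>' t' \<omega> t, OF agree] .
  moreover have "t' - int (n0 + m) = s - int (nat (s - t' + int (n0 + m)))" by (simp add: n0_def)
  ultimately show "\<exists>n. mark e k \<omega>' (s - int n)" by metis
qed

lemma environment_right: "\<exists>b>t. mark e k (environment w0 w) b"
proof -
  define m where "m = int (ell e k) + \<bar>t\<bar> + 1"
  have m: "1 \<le> m" "t < m" "int (ell e k) < m" by (auto simp: m_def)
  have mm: "m \<le> m\<^sup>2" using m(1) by (simp add: power2_eq_square)
  have "environment w0 w (m\<^sup>2 - i)" if i: "1 \<le> i" "i < int (ell e k)" for i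
  proof -
    have "(m - 1)\<^sup>2 = m\<^sup>2 - 2 * m + 1" by (simp add: power2_diff)
    then have low: "(m - 1)\<^sup>2 < m\<^sup>2 - i" using i m by linarith
    have "m\<^sup>2 - i \<noteq> n\<^sup>2" for n
    proof
      assume n: "m\<^sup>2 - i = n\<^sup>2"
      have "(m - 1)\<^sup>2 < \<bar>n\<bar>\<^sup>2" "\<bar>n\<bar>\<^sup>2 < m\<^sup>2" using low n i by simp_all
      then have "m - 1 < \<bar>n\<bar>" "\<bar>n\<bar> < m" using m(1) by (auto intro: power2_less_imp_less[of _ "\<bar>n\<bar>"] power2_less_imp_less[of "\<bar>n\<bar>"] simp del: power2_abs)
      then show False by linarith
    qed
    moreover have "0 < m\<^sup>2 - i" using low by (rule le_less_trans[OF zero_le_power2])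
    ultimately show ?thesis by (simp add: environment_def)
  qed
  moreover have "\<not> environment w0 w (m\<^sup>2)"
    using m(1) mm by (auto simp: environment_def)
  ultimately have "mark e k (environment w0 w) (m\<^sup>2)" by (simp add: mark_def)
  moreover have "t < m\<^sup>2" using m(2) mm by linarith
  ultimately show ?thesis by blast
qed

context bramson_kalikow
begin

text \<open>The drift at time 0 as a function of the current bit and the past. Spins at times from 0
  on receive the value at -1 through \<open>nat\<close>, and the drift never reads them.\<close>

definition past_drift :: "bool \<Rightarrow> (nat \<Rightarrow> bool \<times> bool) \<Rightarrow> real" where
  "past_drift w p = D (environment w (snd \<circ> p)) 0 (\<lambda>s. fst (p (nat (- 1 - s))))"

text \<open>Marks to the right are supplied by the artificial continuation, marks to the left must
  be assumed. For paths this identity is therefore used only almost surely.\<close>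

lemma gfun_eq:
  assumes "\<And>k. marked e k (environment (snd z) (snd \<circ> p))"
  shows "gfun e ks \<phi> h z p = (1 + spin (fst z) * past_drift (snd z) p) / 4"
proof -
  have "psi e ks \<phi> h (environment (snd z) (snd \<circ> p)) 0 (fst \<circ> p) = past_drift (snd z) p"
    using psi_eq_drift[OF e_pos assms environment_right, of ks \<phi> h "\<lambda>s. fst (p (nat (- 1 - s)))"]
    by (simp add: past_drift_def comp_def)
  then show ?thesis by (simp add: gfun_def)
qed

text \<open>This holds for every past, whether or not its blocks exist, and so it is available
  before anything is known about the environment of a specified process.\<close>

lemma sum_gfun: "gfun e ks \<phi> h (True, w) p + gfun e ks \<phi> h (False, w) p = 1 / 2"
  by (simp add: gfun_def spin_def add_divide_distrib diff_divide_distrib)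

lemma past_drift_bound: "\<bar>past_drift w p\<bar> < 1"
  unfolding past_drift_def by (rule D_less)

lemma environment_past:
  "environment w (snd \<circ> path_past t \<zeta>) (0 - int n) = fun_upd (\<lambda>s. snd (\<zeta> s)) t w (t - int n)"
  by (auto simp: environment_def past_def algebra_simps)

lemma past_drift_past:
  "past_drift w (path_past t \<zeta>) = D (fun_upd (\<lambda>s. snd (\<zeta> s)) t w) t (\<lambda>s. fst (\<zeta> s))"
  unfolding past_drift_def
proof (rule drift_cong)
  fix n :: nat assume "1 \<le> n"
  then show "fst (path_past t \<zeta> (nat (- 1 - (0 - int n)))) = fst (\<zeta> (t - int n))"
    by (simp add: past_def of_nat_diff)
qed (rule environment_past)

text \<open>The comparison is made at times -1 and t - 1, so that the prescribed bit w at the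
  current time does not matter.\<close>

lemma marked_environment_past:
  assumes "marked e k (\<lambda>s. snd (\<zeta> s))"
  shows "marked e k (environment w (snd \<circ> path_past t \<zeta>))"
  by (rule marked_past[OF _ assms, of _ "- 1" "t - 1"]) (simp add: environment_def past_def algebra_simps)

lemma measurable_past_drift [measurable]:
  "past_drift w \<in> borel_measurable past_space"
  unfolding past_drift_def
proof (rule measurable_drift)
  fix s :: int
  have c: "(\<lambda>p. f (p n)) \<in> measurable past_space (count_space UNIV)"
    for n :: nat and f :: "bool \<times> bool \<Rightarrow> bool"
    by (rule measurable_compose[OF measurable_component_singleton]) auto
  show "(\<lambda>p :: nat \<Rightarrow> bool \<times> bool. environment w (snd \<circ> p) s) \<in> measurable past_space (count_space UNIV)"
  proof (cases "s < 0")
    case True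
    then have "(\<lambda>p :: nat \<Rightarrow> bool \<times> bool. environment w (snd \<circ> p) s) = (\<lambda>p. snd (p (nat (- 1 - s))))"
      by (simp add: environment_def fun_eq_iff)
    then show ?thesis by (simp only: c)
  qed (simp add: environment_def)
  show "(\<lambda>p :: nat \<Rightarrow> bool \<times> bool. fst (p (nat (- 1 - s)))) \<in> measurable past_space (count_space UNIV)"
    by (rule c)
qed

end

lemma space_path_space [simp]: "space path_space = UNIV"
  by (simp add: path_space_def space_PiM)

lemma measurable_path [measurable]: "(\<lambda>\<zeta>. \<zeta> t) \<in> measurable path_space (count_space UNIV)"
  unfolding path_space_def by (rule measurable_component_singleton) simp

lemma measurable_path_space:
  "(\<And>t. (\<lambda>w. f w t) \<in> measurable M (count_space UNIV)) \<Longrightarrow> f \<in> measurable M path_space"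
  unfolding path_space_def by (rule measurable_abs_UNIV)

lemma measurable_past [measurable]:
  "path_past t \<in> measurable path_space past_space"
  unfolding past_def by (rule measurable_abs_UNIV) measurable

lemma measurable_pair_count_space:
  fixes a :: "'w \<Rightarrow> 'a :: countable"
  assumes "a \<in> measurable M (count_space UNIV)" "b \<in> measurable M (count_space UNIV)"
  shows "(\<lambda>w. (a w, b w)) \<in> measurable M (count_space UNIV)"
  by (rule measurable_compose_countable[OF _ assms(1), where f = "\<lambda>i w. (i, b w)"])
     (rule measurable_compose[OF assms(2)], simp)

abbreviation seeds :: "((int \<Rightarrow> bool) \<times> (int \<Rightarrow> real)) measure" where
  "seeds \<equiv> bits \<Otimes>\<^sub>M noise"

interpretation joint: pair_prob_space bits noise ..

lemma measurable_resample [measurable]: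
  "(\<lambda>q. (fun_upd (fst (fst q)) t b, fun_upd (snd (fst q)) t (snd q))) \<in>
     measurable (seeds \<Otimes>\<^sub>M unif) seeds"
proof (rule measurable_Pair)
  show "(\<lambda>q. fun_upd (fst (fst q)) t b) \<in> measurable (seeds \<Otimes>\<^sub>M unif) bits"
    unfolding bits_def by (rule measurable_fun_upd[where J = UNIV]) (auto simp: bits_def[symmetric])
  show "(\<lambda>q. fun_upd (snd (fst q)) t (snd q)) \<in> measurable (seeds \<Otimes>\<^sub>M unif) noise"
    unfolding noise_def by (rule measurable_fun_upd[where J = UNIV]) (auto simp: noise_def[symmetric])
qed

text \<open>The bit and the uniform variable at time t are refreshed together: they are the
  randomness that enters at one step of the process.\<close>

lemma nn_integral_joint_resample:
  assumes f: "f \<in> borel_measurable seeds"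
  shows "(\<integral>\<^sup>+ p. f p \<partial>seeds) =
    (\<integral>\<^sup>+ p. ((\<integral>\<^sup>+ u. f (fun_upd (fst p) t True, fun_upd (snd p) t u) \<partial>unif) +
            (\<integral>\<^sup>+ u. f (fun_upd (fst p) t False, fun_upd (snd p) t u) \<partial>unif)) / 2 \<partial>seeds)"
proof -
  interpret unif: prob_space unif by (rule prob_space_unif)
  define g where "g \<omega> = (\<integral>\<^sup>+ U. f (\<omega>, U) \<partial>noise)" for \<omega>
  define F where "F b p = (\<integral>\<^sup>+ u. f (fun_upd (fst p) t b, fun_upd (snd p) t u) \<partial>unif)" for b p
  have g: "g \<in> borel_measurable bits"
    unfolding g_def by (rule noise.borel_measurable_nn_integral_fst[OF f])
  have F: "F b \<in> borel_measurable seeds" for b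
    using unif.borel_measurable_nn_integral_fst[OF measurable_compose[OF measurable_resample f]]
    unfolding F_def[abs_def] by simp
  have Fs: "(\<lambda>U. F b (\<omega>, U)) \<in> borel_measurable noise" for b \<omega>
    by (rule measurable_compose[OF _ F]) simp
  have gF: "g (fun_upd \<omega> t b) = (\<integral>\<^sup>+ U. F b (\<omega>, U) \<partial>noise)" for \<omega> b
  proof -
    have "(\<lambda>U. f (fun_upd \<omega> t b, U)) \<in> borel_measurable noise"
      by (rule measurable_compose[OF _ f]) simp
    then show ?thesis
      unfolding g_def F_def noise_def fst_conv snd_conv
      by (rule nn_integral_PiM_resample[OF prob_space_unif])
  qed
  have "(\<integral>\<^sup>+ p. f p \<partial>seeds) = (\<integral>\<^sup>+ \<omega>. g \<omega> \<partial>bits)"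
    unfolding g_def by (rule noise.nn_integral_fst[OF f, symmetric])
  also have "\<dots> = (\<integral>\<^sup>+ \<omega>. (\<integral>\<^sup>+ b. g (fun_upd \<omega> t b) \<partial>coin) \<partial>bits)"
    using g unfolding bits_def by (rule nn_integral_PiM_resample[OF prob_space_coin])
  also have "\<dots> = (\<integral>\<^sup>+ \<omega>. (\<integral>\<^sup>+ U. (F True (\<omega>, U) + F False (\<omega>, U)) / 2 \<partial>noise) \<partial>bits)"
    unfolding nn_integral_coin gF using Fs
    by (simp add: nn_integral_add divide_ennreal_def nn_integral_multc)
  also have "\<dots> = (\<integral>\<^sup>+ p. (F True p + F False p) / 2 \<partial>seeds)"
    by (rule noise.nn_integral_fst) (use F in measurable)
  finally show ?thesis by (simp add: F_def)
qed

context bramson_kalikow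
begin

definition config :: "(int \<Rightarrow> bool) \<times> (int \<Rightarrow> real) \<Rightarrow> int \<Rightarrow> bool \<times> bool" where
  "config p t = (top_spins (fst p) (snd p) t, fst p t)"

definition law :: "(int \<Rightarrow> bool \<times> bool) measure" where
  "law = distr seeds path_space config"

lemma measurable_config [measurable]: "config \<in> measurable seeds path_space"
  unfolding config_def
  by (intro measurable_path_space measurable_pair_count_space measurable_top_spins) measurable

lemma sets_law [measurable_cong, simp]: "sets law = sets path_space"
  by (simp add: law_def)

lemma space_law [simp]: "space law = UNIV"
  by (simp add: law_def)

lemma prob_space_law: "prob_space law"
  unfolding law_def by (rule joint.P.prob_space_distr) (rule measurable_config)

lemma AE_law_marked: "AE \<zeta> in law. \<forall>k. marked e k (\<lambda>s. snd (\<zeta> s))"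
proof -
  have "AE p in seeds. \<forall>k. marked e k (fst p)"
    by (rule AE_distrD[of fst _ bits]) (simp, unfold noise.distr_pair_fst, rule AE_marked[OF e_pos])
  moreover have [measurable]: "Measurable.pred path_space (\<lambda>\<zeta>. mark e k (\<lambda>s. snd (\<zeta> s :: bool \<times> bool)) b)" for k b
    by (rule measurable_mark) (rule measurable_compose[OF measurable_path], simp)
  have "{\<zeta> \<in> space path_space. \<forall>k. marked e k (\<lambda>s. snd (\<zeta> s :: bool \<times> bool))} \<in> sets path_space"
    unfolding marked_def by measurable
  ultimately show ?thesis
    unfolding law_def by (subst AE_distr_iff[OF measurable_config]) (simp_all add: config_def)
qed

text \<open>The seeds are i.i.d., hence shift invariant, and forming the largest solution commutes
  with shifts.\<close>

lemma stationary_law: "stationary law (\<lambda>t z. z t)"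
  unfolding stationary_def
proof
  fix s :: int
  define S where "S p = ((\<lambda>t. fst p (t + s)), (\<lambda>t. snd p (t + s)))" for p :: "(int \<Rightarrow> bool) \<times> (int \<Rightarrow> real)"
  have sb: "(\<lambda>\<omega> t. \<omega> (t + s)) \<in> measurable bits bits"
    unfolding bits_def by (rule measurable_abs_UNIV) (rule measurable_component_singleton, simp)
  have sn: "(\<lambda>U t. U (t + s)) \<in> measurable noise noise"
    unfolding noise_def by (rule measurable_abs_UNIV) (rule measurable_component_singleton, simp)
  have db: "distr bits bits (\<lambda>\<omega> t. \<omega> (t + s)) = bits"
    unfolding bits_def using distr_PiM_reindex[of UNIV "\<lambda>_. coin" "\<lambda>t. t + s" UNIV]
    by (simp add: prob_space_coin inj_on_def restrict_def)
  have dn: "distr noise noise (\<lambda>U t. U (t + s)) = noise"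
    unfolding noise_def using distr_PiM_reindex[of UNIV "\<lambda>_. unif" "\<lambda>t. t + s" UNIV]
    by (simp add: prob_space_unif inj_on_def restrict_def)
  have S: "S \<in> measurable seeds seeds"
    unfolding S_def using measurable_compose[OF measurable_fst sb] measurable_compose[OF measurable_snd sn]
    by (rule measurable_Pair)
  have dS: "distr seeds seeds S = seeds"
    using pair_measure_distr[OF sb sn] noise.sigma_finite_measure_axioms
    by (simp add: db dn S_def[abs_def] case_prod_beta')
  have "top_spins (fst p) (snd p) (t + s) = top_spins (\<lambda>t. fst p (t + s)) (\<lambda>t. snd p (t + s)) t" for p t
    by (rule top_spins_cong) (simp_all add: algebra_simps)
  then have shift: "(\<lambda>t. config p (t + s)) = config (S p)" for p
    by (simp add: config_def S_def fun_eq_iff)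
  have sh: "(\<lambda>w t. w (t + s)) \<in> measurable path_space (path_space :: (int \<Rightarrow> bool \<times> bool) measure)"
    by (rule measurable_path_space) (rule measurable_path)
  have "distr law path_space (\<lambda>w t. w (t + s)) = distr seeds path_space (\<lambda>p t. config p (t + s))"
    unfolding law_def by (subst distr_distr[OF sh measurable_config]) (simp add: comp_def)
  also have "\<dots> = distr (distr seeds seeds S) path_space config"
    unfolding shift by (subst distr_distr[OF measurable_config S]) (simp add: comp_def)
  also have "\<dots> = law" unfolding dS law_def ..
  also have "law = distr law path_space (\<lambda>w t. w t)"
    by (rule distr_id2[symmetric]) simp
  finally show "distr law path_space (\<lambda>w t. w (t + s)) = distr law path_space (\<lambda>w t. w t)" .
qed

lemma process_law: "process law (\<lambda>t z. z t)"
  unfolding process_def using prob_space_law measurable_path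
  by (simp add: measurable_cong_sets[OF sets_law refl])

text \<open>Refreshing the seeds at t leaves the past untouched. The fresh bit equals the prescribed
  one with probability 1/2, and the fresh uniform variable then decides the spin, with threshold (1
  + drift) / 2; together this gives the factor 1/4.\<close>

lemma emeasure_law_next:
  assumes A: "A \<in> sets past_space"
  shows "emeasure law {\<zeta>. path_past t \<zeta> \<in> A \<and> \<zeta> t = z} =
    (\<integral>\<^sup>+ \<zeta>. indicator A (path_past t \<zeta>) *
        ennreal ((1 + spin (fst z) * past_drift (snd z) (path_past t \<zeta>)) / 4) \<partial>law)"
proof -
  let ?past = "path_past t"
  let ?w = "snd z"
  let ?d = "\<lambda>p. 1 + spin (fst z) * past_drift ?w (?past (config p))"
  define f where "f p = indicator A (?past (config p)) * (indicator {z} (config p t) :: ennreal)" for p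
  note [measurable] = A
  have f: "f \<in> borel_measurable seeds"
  proof -
    have [measurable]: "(\<lambda>p. ?past (config p)) \<in> measurable seeds past_space"
      by (rule measurable_compose[OF measurable_config measurable_past])
    have [measurable]: "(\<lambda>p. config p t) \<in> measurable seeds (count_space UNIV)"
      by (rule measurable_compose[OF measurable_config measurable_path])
    show ?thesis unfolding f_def by measurable
  qed
  have past_upd: "?past (config (fun_upd (fst p) t b, fun_upd (snd p) t u)) = ?past (config p)" for p b u
  proof -
    have "config (fun_upd (fst p) t b, fun_upd (snd p) t u) (t - 1 - int n) = config p (t - 1 - int n)" for n
      unfolding config_def by (auto intro!: top_spins_cong)
    then show ?thesis by (simp add: past_def fun_eq_iff)
  qed
  have inner: "(\<integral>\<^sup>+ u. f (fun_upd (fst p) t b, fun_upd (snd p) t u) \<partial>unif) =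
      indicator A (?past (config p)) * (if b = ?w then ennreal (?d p / 2) else 0)"
    for p b
  proof -
    define q where "q = (1 + past_drift ?w (?past (config p))) / 2"
    have q: "0 \<le> q" "q \<le> 1" using past_drift_bound[of ?w "?past (config p)"] by (auto simp: q_def abs_less_iff)
    have top: "top_spins (fun_upd (fst p) t ?w) (fun_upd (snd p) t u) t \<longleftrightarrow> u \<le> q" for u
    proof -
      have "D (fun_upd (fst p) t ?w) t (top_spins (fun_upd (fst p) t ?w) (fun_upd (snd p) t u)) =
        past_drift ?w (?past (config p))"
        unfolding past_drift_past config_def snd_conv fst_conv
        by (rule drift_cong) (auto intro!: top_spins_cong)
      then show ?thesis
        using top_spins_fixed[of "fun_upd (fst p) t ?w" "fun_upd (snd p) t u" t] by (simp add: q_def)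
    qed
    have f_upd: "f (fun_upd (fst p) t b, fun_upd (snd p) t u) =
      indicator A (?past (config p)) * (if b = ?w then indicator {u. (u \<le> q) = fst z} u else 0)" for u
      unfolding f_def past_upd using top[of u] by (cases z) (auto simp: config_def indicator_def)
    have "{u. (u \<le> q) = fst z} = (if fst z then {u. u \<le> q} else space unif - {u. u \<le> q})" by auto
    moreover have "emeasure unif (space unif - {u. u \<le> q}) = ennreal (1 - q)"
    proof -
      interpret unif: prob_space unif by (rule prob_space_unif)
      have "unif.prob {u. u \<le> q} = q" using emeasure_unif_atMost[OF q] q by (simp add: unif.emeasure_eq_measure)
      then show ?thesis using unif.prob_compl[of "{u. u \<le> q}"] by (simp add: unif.emeasure_eq_measure)
    qed
    ultimately have em: "emeasure unif {u. (u \<le> q) = fst z} =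
        ennreal (?d p / 2)"
      using emeasure_unif_atMost[OF q] by (simp add: spin_def q_def field_simps)
    have [measurable]: "{u. (u \<le> q) = fst z} \<in> sets unif" by (cases "fst z") (auto simp: not_le)
    show ?thesis
      unfolding f_upd using em by (cases "b = ?w") (simp_all add: nn_integral_cmult)
  qed
  have ev: "{\<zeta> \<in> space path_space. ?past \<zeta> \<in> A \<and> \<zeta> t = z} \<in> sets path_space" by measurable
  then have "emeasure law {\<zeta>. ?past \<zeta> \<in> A \<and> \<zeta> t = z} =
      (\<integral>\<^sup>+ \<zeta>. indicator {\<zeta>. ?past \<zeta> \<in> A \<and> \<zeta> t = z} \<zeta> \<partial>law)" by simp
  also have "\<dots> = (\<integral>\<^sup>+ p. indicator {\<zeta>. ?past \<zeta> \<in> A \<and> \<zeta> t = z} (config p) \<partial>seeds)"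
    unfolding law_def using ev by (subst nn_integral_distr) auto
  also have "\<dots> = (\<integral>\<^sup>+ p. f p \<partial>seeds)"
    by (rule nn_integral_cong) (auto simp: f_def indicator_def)
  also have "\<dots> = (\<integral>\<^sup>+ p. indicator A (?past (config p)) *
      ennreal (?d p / 4) \<partial>seeds)"
    unfolding nn_integral_joint_resample[OF f, of t] inner
  proof (rule nn_integral_cong)
    fix p
    have half: "ennreal (x / 2) / 2 = ennreal (x / 4)" for x
      using divide_ennreal[of "x / 2" 2] by (cases "0 \<le> x") (simp_all add: ennreal_neg)
    show "(indicator A (?past (config p)) * (if True = ?w then ennreal (?d p / 2) else 0) +
       indicator A (?past (config p)) * (if False = ?w then ennreal (?d p / 2) else 0)) / 2 =
      indicator A (?past (config p)) * ennreal (?d p / 4)"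
      by (cases ?w; cases "?past (config p) \<in> A") (simp_all add: half)
  qed
  also have "\<dots> = (\<integral>\<^sup>+ \<zeta>. indicator A (?past \<zeta>) * ennreal ((1 + spin (fst z) * past_drift ?w (?past \<zeta>)) / 4) \<partial>law)"
    unfolding law_def by (subst nn_integral_distr) measurable
  finally show ?thesis .
qed

lemma finite_measure_subalgebra_past:
  fixes M :: "(int \<Rightarrow> bool \<times> bool) measure"
  assumes "prob_space M" "sets M = sets path_space"
  shows "finite_measure_subalgebra M (past_algebra M (\<lambda>t z. z t) t)"
proof -
  interpret prob_space M by fact
  have sp: "space M = UNIV" using sets_eq_imp_space_eq[OF assms(2)] by simp
  have m: "path_past t \<in> measurable M past_space"
    unfolding measurable_cong_sets[OF assms(2) refl] by (rule measurable_past)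
  have "path_past t -` A \<in> sets M" if "A \<in> sets past_space" for A
    using measurable_sets[OF m that] by (simp add: sp)
  then have "subalgebra M (past_algebra M (\<lambda>t z. z t) t)"
    unfolding subalgebra_def past_algebra_def
    by (auto simp: sets_vimage_algebra2 space_PiM sp)
  then show ?thesis by unfold_locales
qed

text \<open>The conditional probability is identified with the version g built from
  \<open>past_drift\<close>, which is measurable in the past. It is exchanged for
  \<open>gfun\<close> only at the end, on the almost sure event that all marks exist.\<close>

lemma specified_by_law: "specified_by law (\<lambda>t z. z t) (gfun e ks \<phi> h)"
  unfolding specified_by_def
proof (intro allI)
  fix t :: int and z :: "bool \<times> bool"
  let ?past = "path_past t"
  let ?F = "past_algebra law (\<lambda>t z. z t) t"
  define g where "g \<zeta> = (1 + spin (fst z) * past_drift (snd z) (?past \<zeta>)) / 4" for \<zeta>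
  interpret law: prob_space law by (rule prob_space_law)
  interpret finite_measure_subalgebra law ?F
    by (rule finite_measure_subalgebra_past[OF prob_space_law sets_law])
  have g01: "0 \<le> g \<zeta>" "g \<zeta> \<le> 1" for \<zeta>
    using past_drift_bound[of "snd z" "?past \<zeta>"] by (auto simp: g_def spin_def abs_less_iff)
  have pF: "?past \<in> measurable ?F past_space"
    unfolding past_algebra_def by (rule measurable_vimage_algebra1) (simp add: space_PiM)
  have gF: "g \<in> borel_measurable ?F"
    unfolding g_def using measurable_compose[OF pF measurable_past_drift] by measurable
  have g [measurable]: "g \<in> borel_measurable law" by (rule measurable_from_subalg[OF subalg gF])
  have zs [measurable]: "{\<zeta>. \<zeta> t = z} \<in> sets law"
    by (rule sets_CollectI) (simp, measurable)
  have "AE \<zeta> in law. real_cond_exp law ?F (indicator {\<zeta> \<in> space law. \<zeta> t = z}) \<zeta> = g \<zeta>"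
  proof (rule real_cond_exp_charact[OF _ _ _ gF])
    show "integrable law g"
      by (rule law.integrable_const_bound[where B = 1]) (use g01 in auto)
    show "integrable law (indicator {\<zeta> \<in> space law. \<zeta> t = z} :: _ \<Rightarrow> real)"
      using zs by (simp add: law.emeasure_eq_measure)
    fix B assume "B \<in> sets ?F"
    then obtain A where A: "A \<in> sets past_space" and B: "B = ?past -` A"
      unfolding past_algebra_def by (auto simp: sets_vimage_algebra2 space_PiM)
    note [measurable] = A
    have Bs [measurable]: "B \<in> sets law"
      unfolding B vimage_def by (rule sets_CollectI) (simp, measurable)
    have "ennreal (\<integral>\<zeta>\<in>B. g \<zeta> \<partial>law) = (\<integral>\<^sup>+ \<zeta>. ennreal (indicator B \<zeta> * g \<zeta>) \<partial>law)"
      unfolding set_lebesgue_integral_def real_scaleR_def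
      by (rule nn_integral_eq_integral[symmetric])
         (use g01 in \<open>auto intro!: law.integrable_const_bound[where B = 1] simp: indicator_def\<close>)
    also have "\<dots> = (\<integral>\<^sup>+ \<zeta>. indicator A (?past \<zeta>) * ennreal (g \<zeta>) \<partial>law)"
      by (rule nn_integral_cong) (auto simp: B indicator_def)
    also have "\<dots> = emeasure law {\<zeta>. ?past \<zeta> \<in> A \<and> \<zeta> t = z}"
      unfolding g_def by (rule emeasure_law_next[OF A, symmetric])
    also have "{\<zeta>. ?past \<zeta> \<in> A \<and> \<zeta> t = z} = B \<inter> {\<zeta>. \<zeta> t = z}" by (auto simp: B)
    also have "emeasure law \<dots> = ennreal (\<integral>\<zeta>\<in>B. indicator {\<zeta> \<in> space law. \<zeta> t = z} \<zeta> \<partial>law)"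
      by (simp add: set_lebesgue_integral_def law.emeasure_eq_measure indicator_inter_arith[symmetric])
    finally show "(\<integral>\<zeta>\<in>B. indicator {\<zeta> \<in> space law. \<zeta> t = z} \<zeta> \<partial>law) = (\<integral>\<zeta>\<in>B. g \<zeta> \<partial>law)"
      using g01 by (subst (asm) ennreal_inj) (auto simp: set_lebesgue_integral_def intro!: Bochner_Integration.integral_nonneg)
  qed
  then show "AE \<zeta> in law. real_cond_exp law ?F (indicator {\<zeta> \<in> space law. \<zeta> t = z}) \<zeta> = gfun e ks \<phi> h z (?past \<zeta>)"
    using AE_law_marked
  proof eventually_elim
    case (elim \<zeta>)
    then show ?case
      using gfun_eq[of z "?past \<zeta>"] marked_environment_past[of _ \<zeta>] by (simp add: g_def)
  qed
qed

end

section \<open>Uniqueness\<close>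

lemma measure_coin: "measure coin B = real (card B) / 2"
proof -
  have "pmf (bernoulli_pmf (1 / 2)) b = 1 / 2" for b by (cases b) simp_all
  then show ?thesis by (simp add: coin_def measure_measure_pmf_finite)
qed

lemma sets_rescale:
  fixes q :: real
  assumes [measurable]: "A \<in> sets borel"
  shows "{v. v * q \<in> A} \<in> sets borel" "{v. q + (1 - q) * v \<in> A} \<in> sets borel"
proof -
  have "(\<lambda>v. v * q) -` A \<inter> space borel \<in> sets borel" "(\<lambda>v. q + (1 - q) * v) -` A \<inter> space borel \<in> sets borel"
    by (intro measurable_sets[where A = borel]; measurable)+
  then show "{v. v * q \<in> A} \<in> sets borel" "{v. q + (1 - q) * v \<in> A} \<in> sets borel"
    by (simp_all add: vimage_def)
qed

text \<open>The uniform law on [0, 1] is the mixture, with weights q and 1 - q, of the uniform laws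
  on [0, q] and [q, 1]. Each of these is an affine image of the uniform law on [0, 1].\<close>

lemma emeasure_unif_split:
  assumes q: "0 < q" "q < 1" and [measurable]: "A \<in> sets borel"
  shows "ennreal q * emeasure unif {v. v * q \<in> A} + ennreal (1 - q) * emeasure unif {v. q + (1 - q) * v \<in> A} =
    emeasure unif A"
proof -
  note m = sets_rescale[OF assms(3), of q]
  note [measurable] = m
  have em: "emeasure unif B = (\<integral>\<^sup>+ u. indicator B u * indicator {0..1} u \<partial>lborel)" if "B \<in> sets borel" for B
    using nn_integral_unif[of "indicator B"] that by simp
  have "emeasure unif A = (\<integral>\<^sup>+ u. indicator A u * indicator {0..q} u + indicator A u * indicator {q..1} u \<partial>lborel)"
    unfolding em[OF assms(3)]
    by (rule nn_integral_cong_AE, use AE_lborel_singleton[of q] in eventually_elim)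
       (use q in \<open>auto simp: indicator_def\<close>)
  also have "\<dots> = (\<integral>\<^sup>+ u. indicator A u * indicator {0..q} u \<partial>lborel) +
      (\<integral>\<^sup>+ u. indicator A u * indicator {q..1} u \<partial>lborel)"
    by (rule nn_integral_add) auto
  also have "(\<integral>\<^sup>+ u. indicator A u * indicator {0..q} u \<partial>lborel) =
      ennreal q * (\<integral>\<^sup>+ v. indicator A (0 + q * v) * indicator {0..q} (0 + q * v) \<partial>lborel)"
    using q by (subst nn_integral_real_affine[where c = q and t = 0]) auto
  also have "(\<integral>\<^sup>+ v. indicator A (0 + q * v) * indicator {0..q} (0 + q * v) \<partial>lborel) = emeasure unif {v. v * q \<in> A}"
    unfolding em[OF m(1)]
    by (rule nn_integral_cong) (use q in \<open>auto simp: indicator_def mult.commute zero_le_mult_iff mult_le_cancel_left1\<close>)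
  also have "(\<integral>\<^sup>+ u. indicator A u * indicator {q..1} u \<partial>lborel) =
      ennreal (1 - q) * (\<integral>\<^sup>+ v. indicator A (q + (1 - q) * v) * indicator {q..1} (q + (1 - q) * v) \<partial>lborel)"
    using q by (subst nn_integral_real_affine[where c = "1 - q" and t = q]) auto
  also have "(\<integral>\<^sup>+ v. indicator A (q + (1 - q) * v) * indicator {q..1} (q + (1 - q) * v) \<partial>lborel) =
      emeasure unif {v. q + (1 - q) * v \<in> A}"
    unfolding em[OF m(2)]
  proof (rule nn_integral_cong)
    fix v
    have "q + (1 - q) * v \<le> 1 \<longleftrightarrow> (1 - q) * v \<le> (1 - q) * 1" by (simp add: algebra_simps)
    also have "\<dots> \<longleftrightarrow> v \<le> 1" using q by (subst mult_le_cancel_left_pos) auto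
    finally show "indicator A (q + (1 - q) * v) * indicator {q..1} (q + (1 - q) * v) =
        (indicator {v. q + (1 - q) * v \<in> A} v * indicator {0..1} v :: ennreal)"
      using q by (auto simp: indicator_def zero_le_mult_iff)
  qed
  finally show ?thesis by simp
qed

lemma prod_emb_UNIV:
  "(\<And>i. space (M i) = UNIV) \<Longrightarrow> prod_emb UNIV M J (PiE J B) = {f. \<forall>j\<in>J. f j \<in> B j}"
  by (auto simp: prod_emb_def PiE_iff)

text \<open>Products of cylinders form an intersection-stable generator. Padding the two finite
  index sets with trivial conditions brings both factors to a common J, so that each time
  contributes one pair of conditions.\<close>

lemma joint_eqI:
  assumes sets: "sets N = sets seeds"
    and eq: "\<And>J A B. finite J \<Longrightarrow> (\<And>j. j \<in> J \<Longrightarrow> B j \<in> sets borel) \<Longrightarrow>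
      emeasure N {p. \<forall>j\<in>J. fst p j \<in> A j \<and> snd p j \<in> B j} = (\<Prod>j\<in>J. emeasure coin (A j) * emeasure unif (B j))"
  shows "N = seeds"
proof -
  let ?Eb = "prod_algebra UNIV (\<lambda>_ :: int. coin)" and ?En = "prod_algebra UNIV (\<lambda>_ :: int. unif)"
  let ?E = "{a \<times> b | a b. a \<in> ?Eb \<and> b \<in> ?En}"
  interpret Pc: product_prob_space "\<lambda>_ :: int. coin" UNIV
    by (intro product_prob_spaceI prob_space_coin)
  interpret Pu: product_prob_space "\<lambda>_ :: int. unif" UNIV
    by (intro product_prob_spaceI prob_space_unif)
  have Ub: "UNIV \<in> ?Eb"
    using prod_algebraI[of "{0}" UNIV "\<lambda>_. UNIV" "\<lambda>_ :: int. coin"] by (simp add: prod_emb_UNIV)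
  have Un: "UNIV \<in> ?En"
    using prod_algebraI[of "{0}" UNIV "\<lambda>_. UNIV" "\<lambda>_ :: int. unif"] by (simp add: prod_emb_UNIV)
  have sE: "sets seeds = sigma_sets UNIV ?E"
  proof -
    have "sets seeds = sets (sigma (space bits \<times> space noise) ?E)"
      by (rule sets_pair_eq[where Ca = "{UNIV}" and Cb = "{UNIV}"])
         (use Ub Un in \<open>auto simp: bits_def noise_def sets_PiM space_PiM\<close>)
    then show ?thesis by simp
  qed
  have rect: "emeasure N (a \<times> b) = emeasure bits a * emeasure noise b" if ab: "a \<in> ?Eb" "b \<in> ?En" for a b
  proof -
    obtain J A where J: "a = prod_emb UNIV (\<lambda>_. coin) J (\<Pi>\<^sub>E j\<in>J. A j)" "finite J"
      using ab(1) by (rule prod_algebraE) blast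
    obtain K B where K: "b = prod_emb UNIV (\<lambda>_. unif) K (\<Pi>\<^sub>E j\<in>K. B j)" "finite K" "\<And>j. j \<in> K \<Longrightarrow> B j \<in> sets unif"
      using ab(2) by (rule prod_algebraE) blast
    define A' where "A' j = (if j \<in> J then A j else UNIV)" for j
    define B' where "B' j = (if j \<in> K then B j else UNIV)" for j
    have ea: "emeasure bits a = (\<Prod>j\<in>J \<union> K. emeasure coin (A' j))"
    proof -
      have "emeasure bits a = (\<Prod>j\<in>J. emeasure coin (A j))"
        unfolding J(1) bits_def by (rule Pc.emeasure_PiM_emb) (use J in auto)
      also have "\<dots> = (\<Prod>j\<in>J \<union> K. emeasure coin (A' j))"
        using J(2) K(2) Pc.M.emeasure_space_1 by (intro prod.mono_neutral_cong_left) (auto simp: A'_def)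
      finally show ?thesis .
    qed
    have eb: "emeasure noise b = (\<Prod>j\<in>J \<union> K. emeasure unif (B' j))"
    proof -
      have "emeasure noise b = (\<Prod>j\<in>K. emeasure unif (B j))"
        unfolding K(1) noise_def by (rule Pu.emeasure_PiM_emb) (use K in auto)
      also have "\<dots> = (\<Prod>j\<in>J \<union> K. emeasure unif (B' j))"
        using J(2) K(2) Pu.M.emeasure_space_1 by (intro prod.mono_neutral_cong_left) (auto simp: B'_def)
      finally show ?thesis .
    qed
    have "a \<times> b = {p. \<forall>j\<in>J \<union> K. fst p j \<in> A' j \<and> snd p j \<in> B' j}"
      unfolding J(1) K(1) by (auto simp: prod_emb_UNIV A'_def B'_def split: if_splits)
    then have "emeasure N (a \<times> b) = (\<Prod>j\<in>J \<union> K. emeasure coin (A' j) * emeasure unif (B' j))"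
      using J(2) K(2,3) by (simp only:) (rule eq, auto simp: B'_def)
    then show ?thesis by (simp add: ea eb prod.distrib)
  qed
  show ?thesis
  proof (rule measure_eqI_generator_eq_countable[of ?E UNIV, where A = "{UNIV}"])
    show "Int_stable ?E"
    proof (rule Int_stableI)
      fix x y assume "x \<in> ?E" "y \<in> ?E"
      then obtain a b a' b' where *: "x = a \<times> b" "y = a' \<times> b'" "a \<in> ?Eb" "a' \<in> ?Eb" "b \<in> ?En" "b' \<in> ?En" by auto
      have "a \<inter> a' \<in> ?Eb" "b \<inter> b' \<in> ?En"
        using Int_stable_prod_algebra *(3-6) unfolding Int_stable_def by blast+
      moreover have "x \<inter> y = (a \<inter> a') \<times> (b \<inter> b')" using * by auto
      ultimately show "x \<inter> y \<in> ?E" by blast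
    qed
    show "sets N = sigma_sets UNIV ?E" "sets seeds = sigma_sets UNIV ?E" using sets sE by auto
    show "emeasure N X = emeasure seeds X" if XE: "X \<in> ?E" for X
    proof -
      obtain a b where X: "X = a \<times> b" "a \<in> ?Eb" "b \<in> ?En" using XE by blast
      have "a \<in> sets bits" "b \<in> sets noise" using X by (auto simp: bits_def noise_def sets_PiM)
      then show ?thesis using rect[OF X(2,3)] X(1) by (simp add: noise.emeasure_pair_measure_Times)
    qed
    have U: "UNIV \<times> UNIV \<in> ?E" using Ub Un by blast
    then show "{UNIV} \<subseteq> ?E" by simp
    have "emeasure N (UNIV \<times> UNIV) = 1"
      using rect[OF Ub Un] bits.emeasure_space_1 noise.emeasure_space_1 by simp
    then show "emeasure N x \<noteq> \<infinity>" if "x \<in> {UNIV}" for x using that by simp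
  qed auto
qed

section \<open>One-step conditional laws of an arbitrary specified measure\<close>

locale specified_measure = bramson_kalikow +
  fixes \<mu> :: "(int \<Rightarrow> bool \<times> bool) measure"
  assumes sets_\<mu> [measurable_cong, simp]: "sets \<mu> = sets path_space"
    and prob_space_\<mu>: "prob_space \<mu>"
    and specified: "specified_by \<mu> (\<lambda>t z. z t) (gfun e ks \<phi> h)"
begin

sublocale \<mu>: prob_space \<mu>
  by (rule prob_space_\<mu>)

lemma space_\<mu> [simp]: "space \<mu> = UNIV"
  using sets_eq_imp_space_eq[OF sets_\<mu>] by simp

abbreviation cond :: "int \<Rightarrow> bool \<times> bool \<Rightarrow> (int \<Rightarrow> bool \<times> bool) \<Rightarrow> real" where
  "cond t z \<equiv> real_cond_exp \<mu> (past_algebra \<mu> (\<lambda>t z. z t) t) (indicator {w \<in> space \<mu>. w t = z})"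

lemma AE_cond: "AE \<zeta> in \<mu>. cond t z \<zeta> = gfun e ks \<phi> h z (path_past t \<zeta>)"
  using specified unfolding specified_by_def by blast

definition depends_past :: "int \<Rightarrow> ((int \<Rightarrow> bool \<times> bool) \<Rightarrow> 'b) \<Rightarrow> bool" where
  "depends_past t f \<longleftrightarrow> (\<forall>\<zeta> \<zeta>'. (\<forall>s<t. \<zeta> s = \<zeta>' s) \<longrightarrow> f \<zeta> = f \<zeta>')"

lemma sets_next [measurable]: "{\<zeta>. \<zeta> t = z} \<in> sets \<mu>"
proof -
  have "{\<zeta> \<in> space path_space. \<zeta> t = z} \<in> sets path_space" by measurable
  then show ?thesis by simp
qed

lemma integral_cond:
  fixes f :: "(int \<Rightarrow> bool \<times> bool) \<Rightarrow> real"
  assumes f [measurable]: "f \<in> borel_measurable path_space" and f01: "\<And>\<zeta>. 0 \<le> f \<zeta>" "\<And>\<zeta>. f \<zeta> \<le> 1"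
    and dep: "depends_past t f"
  shows "integrable \<mu> (\<lambda>\<zeta>. f \<zeta> * cond t z \<zeta>)"
    and "(\<integral>\<zeta>. f \<zeta> * cond t z \<zeta> \<partial>\<mu>) = (\<integral>\<zeta>. f \<zeta> * indicator {\<zeta>. \<zeta> t = z} \<zeta> \<partial>\<mu>)"
proof -
  let ?F = "past_algebra \<mu> (\<lambda>t z. z t) t"
  interpret finite_measure_subalgebra \<mu> ?F
    by (rule finite_measure_subalgebra_past[OF prob_space_\<mu> sets_\<mu>])
  have pF: "path_past t \<in> measurable ?F past_space"
    unfolding past_algebra_def by (rule measurable_vimage_algebra1) (simp add: space_PiM)
  \<comment> \<open>A path with the given past and arbitrary values from t on. Since f ignores those
    values, f is a function of the past, hence measurable for the past algebra.\<close>
  define ext where "ext p s = (if s < t then p (nat (t - 1 - s)) else (True, True))"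
    for p :: "nat \<Rightarrow> bool \<times> bool" and s :: int
  have "(\<lambda>p. ext p s) \<in> measurable past_space (count_space UNIV)" for s
    unfolding ext_def by (cases "s < t") auto
  then have "ext \<in> measurable past_space path_space"
    by (rule measurable_path_space)
  then have "(\<lambda>\<zeta>. f (ext (path_past t \<zeta>))) \<in> borel_measurable ?F"
    by (intro measurable_compose[OF measurable_compose[OF pF] f])
  moreover have "f (ext (path_past t \<zeta>)) = f \<zeta>" for \<zeta>
    using dep unfolding depends_past_def by (auto simp: ext_def past_def)
  ultimately have fF: "f \<in> borel_measurable ?F" by simp
  have ind: "indicator {w \<in> space \<mu>. w t = z} = (indicator {\<zeta>. \<zeta> t = z} :: _ \<Rightarrow> real)" by simp
  have int: "integrable \<mu> (\<lambda>\<zeta>. f \<zeta> * indicator {w \<in> space \<mu>. w t = z} \<zeta>)"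
    unfolding ind
    by (rule \<mu>.integrable_const_bound[where B = 1]) (use f01 in \<open>auto simp: indicator_def\<close>)
  show "integrable \<mu> (\<lambda>\<zeta>. f \<zeta> * cond t z \<zeta>)"
    by (rule real_cond_exp_intg(1)[OF int fF]) (simp add: ind)
  show "(\<integral>\<zeta>. f \<zeta> * cond t z \<zeta> \<partial>\<mu>) = (\<integral>\<zeta>. f \<zeta> * indicator {\<zeta>. \<zeta> t = z} \<zeta> \<partial>\<mu>)"
    using real_cond_exp_intg(2)[OF int fF] by (simp add: ind)
qed

text \<open>Summing the specification over the two spins removes the drift, so each bit is a fair
  coin independent of the past.\<close>

lemma integral_next_bit:
  fixes f :: "(int \<Rightarrow> bool \<times> bool) \<Rightarrow> real"
  assumes f: "f \<in> borel_measurable path_space" and f01: "\<And>\<zeta>. 0 \<le> f \<zeta>" "\<And>\<zeta>. f \<zeta> \<le> 1"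
    and dep: "depends_past t f"
  shows "(\<integral>\<zeta>. f \<zeta> * indicator {\<zeta>. snd (\<zeta> t) \<in> B} \<zeta> \<partial>\<mu>) = measure coin B * (\<integral>\<zeta>. f \<zeta> \<partial>\<mu>)"
proof -
  note [measurable] = f
  have int: "integrable \<mu> (\<lambda>\<zeta>. f \<zeta> * indicator {\<zeta>. \<zeta> t = z} \<zeta>)" for z
    by (rule \<mu>.integrable_const_bound[where B = 1]) (use f01 in \<open>auto simp: indicator_def\<close>)
  have bit: "(\<integral>\<zeta>. f \<zeta> * indicator {\<zeta>. \<zeta> t = (True, w)} \<zeta> \<partial>\<mu>) +
      (\<integral>\<zeta>. f \<zeta> * indicator {\<zeta>. \<zeta> t = (False, w)} \<zeta> \<partial>\<mu>) = (\<integral>\<zeta>. f \<zeta> \<partial>\<mu>) / 2" for w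
  proof -
    note i = integral_cond[OF assms]
    have "(\<integral>\<zeta>. f \<zeta> * indicator {\<zeta>. \<zeta> t = (True, w)} \<zeta> \<partial>\<mu>) +
      (\<integral>\<zeta>. f \<zeta> * indicator {\<zeta>. \<zeta> t = (False, w)} \<zeta> \<partial>\<mu>) =
      (\<integral>\<zeta>. f \<zeta> * cond t (True, w) \<zeta> + f \<zeta> * cond t (False, w) \<zeta> \<partial>\<mu>)"
      using i(2) by (subst Bochner_Integration.integral_add[OF i(1) i(1)]) simp
    also have "\<dots> = (\<integral>\<zeta>. f \<zeta> / 2 \<partial>\<mu>)"
    proof (rule integral_cong_AE)
      show "AE \<zeta> in \<mu>. f \<zeta> * cond t (True, w) \<zeta> + f \<zeta> * cond t (False, w) \<zeta> = f \<zeta> / 2"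
        using AE_cond[of t "(True, w)"] AE_cond[of t "(False, w)"]
      proof eventually_elim
        case (elim \<zeta>)
        then show ?case using sum_gfun[of w "path_past t \<zeta>"]
          by (metis (no_types, lifting) distrib_left mult.right_neutral times_divide_eq_right)
      qed
    qed (use i(1) in \<open>auto dest: borel_measurable_integrable\<close>)
    finally show ?thesis by simp
  qed
  have "(\<integral>\<zeta>. f \<zeta> * indicator {\<zeta>. snd (\<zeta> t) \<in> B} \<zeta> \<partial>\<mu>) =
    (\<integral>\<zeta>. (\<Sum>w\<in>B. f \<zeta> * indicator {\<zeta>. \<zeta> t = (True, w)} \<zeta> + f \<zeta> * indicator {\<zeta>. \<zeta> t = (False, w)} \<zeta>) \<partial>\<mu>)"
  proof (rule Bochner_Integration.integral_cong)
    fix \<zeta> :: "int \<Rightarrow> bool \<times> bool"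
    obtain c w0 where z: "\<zeta> t = (c, w0)" by (cases "\<zeta> t")
    have "(\<Sum>w\<in>B. f \<zeta> * indicator {\<zeta>. \<zeta> t = (True, w)} \<zeta> + f \<zeta> * indicator {\<zeta>. \<zeta> t = (False, w)} \<zeta>) =
      (\<Sum>w\<in>B. if w = w0 then f \<zeta> else 0)"
      by (rule sum.cong) (use z in \<open>cases c; auto simp: indicator_def\<close>)+
    also have "\<dots> = f \<zeta> * indicator {\<zeta>. snd (\<zeta> t) \<in> B} \<zeta>" using z by (simp add: indicator_def)
    finally show "f \<zeta> * indicator {\<zeta>. snd (\<zeta> t) \<in> B} \<zeta> =
      (\<Sum>w\<in>B. f \<zeta> * indicator {\<zeta>. \<zeta> t = (True, w)} \<zeta> + f \<zeta> * indicator {\<zeta>. \<zeta> t = (False, w)} \<zeta>)" ..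
  qed simp
  also have "\<dots> = (\<Sum>w\<in>B. (\<integral>\<zeta>. f \<zeta> \<partial>\<mu>) / 2)"
    using int by (subst Bochner_Integration.integral_sum) (auto simp: Bochner_Integration.integral_add bit)
  also have "\<dots> = measure coin B * (\<integral>\<zeta>. f \<zeta> \<partial>\<mu>)" by (simp add: measure_coin)
  finally show ?thesis .
qed

lemma measurable_env: "(\<lambda>\<zeta> s. snd (\<zeta> s :: bool \<times> bool)) \<in> measurable path_space bits"
proof -
  have "(\<lambda>\<zeta> s. snd (\<zeta> s :: bool \<times> bool)) \<in> measurable path_space (PiM UNIV (\<lambda>_ :: int. count_space UNIV :: bool measure))"
    by (rule measurable_abs_UNIV) (rule measurable_compose[OF measurable_path], simp)
  then show ?thesis by (simp add: measurable_cong_sets[OF refl sets_bits])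
qed

lemma measurable_snd_path [measurable]: "(\<lambda>\<zeta>. snd (\<zeta> s :: bool \<times> bool)) \<in> measurable path_space (count_space (UNIV :: bool set))"
  by (rule measurable_compose[OF measurable_path]) simp

lemma measurable_fst_path [measurable]: "(\<lambda>\<zeta>. fst (\<zeta> s :: bool \<times> bool)) \<in> measurable path_space (count_space (UNIV :: bool set))"
  by (rule measurable_compose[OF measurable_path]) simp

text \<open>Splitting off the latest time of a finite set reduces its cylinder probability to that
  of earlier times. No knowledge of marks enters, so their almost sure existence can be deduced from
  this lemma without circularity.\<close>

lemma distr_env: "distr \<mu> bits (\<lambda>\<zeta> s. snd (\<zeta> s)) = bits"
proof -
  interpret Pc: product_prob_space "\<lambda>_ :: int. coin" UNIV
    by (intro product_prob_spaceI prob_space_coin)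
  show ?thesis
    unfolding bits_def
  proof (rule Pc.PiM_eq)
    fix J :: "int set" and A :: "int \<Rightarrow> bool set" assume "finite J"
    have S: "{\<zeta>. \<forall>j\<in>J. snd (\<zeta> j) \<in> A j} \<in> sets \<mu>" if "finite J" for J
    proof -
      have "{\<zeta> \<in> space path_space. \<forall>j\<in>J. snd (\<zeta> j :: bool \<times> bool) \<in> A j} \<in> sets path_space"
        using that by measurable
      then show ?thesis by simp
    qed
    have "\<mu>.prob {\<zeta>. \<forall>j\<in>J. snd (\<zeta> j) \<in> A j} = (\<Prod>j\<in>J. measure coin (A j))"
      using \<open>finite J\<close>
    proof (induction J rule: finite_linorder_max_induct)
      case empty
      then show ?case using \<mu>.prob_space by simp
    next
      case (insert b J)
      define f where "f = (indicator {\<zeta>. \<forall>j\<in>J. snd (\<zeta> j) \<in> A j} :: (int \<Rightarrow> bool \<times> bool) \<Rightarrow> real)"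
      note [measurable] = S[OF insert(1)]
      have "\<mu>.prob {\<zeta>. \<forall>j\<in>insert b J. snd (\<zeta> j) \<in> A j} = (\<integral>\<zeta>. indicator {\<zeta>. \<forall>j\<in>insert b J. snd (\<zeta> j) \<in> A j} \<zeta> \<partial>\<mu>)"
        using S[of "insert b J"] insert(1) by simp
      also have "\<dots> = (\<integral>\<zeta>. f \<zeta> * indicator {\<zeta>. snd (\<zeta> b) \<in> A b} \<zeta> \<partial>\<mu>)"
        by (rule Bochner_Integration.integral_cong) (auto simp: f_def indicator_def)
      also have "\<dots> = measure coin (A b) * (\<integral>\<zeta>. f \<zeta> \<partial>\<mu>)"
      proof (rule integral_next_bit)
        show "depends_past b f"
          unfolding depends_past_def f_def indicator_def using insert(2) by (auto intro!: arg_cong[where f = of_bool])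
        show "f \<in> borel_measurable path_space"
          unfolding f_def using S[OF insert(1)] by simp
      qed (auto simp: f_def indicator_def)
      also have "(\<integral>\<zeta>. f \<zeta> \<partial>\<mu>) = \<mu>.prob {\<zeta>. \<forall>j\<in>J. snd (\<zeta> j) \<in> A j}"
        unfolding f_def using S[OF insert(1)] by simp
      finally show ?case using insert by auto
    qed
    then have "emeasure \<mu> {\<zeta>. \<forall>j\<in>J. snd (\<zeta> j) \<in> A j} = (\<Prod>j\<in>J. emeasure coin (A j))"
      by (simp add: \<mu>.emeasure_eq_measure Pc.M.emeasure_eq_measure prod_ennreal)
    moreover have "prod_emb UNIV (\<lambda>_. coin) J (PiE J A) \<in> sets bits"
      unfolding bits_def using \<open>finite J\<close> by (intro sets_PiM_I) auto
    ultimately show "emeasure (distr \<mu> (PiM UNIV (\<lambda>_. coin)) (\<lambda>\<zeta> s. snd (\<zeta> s))) (prod_emb UNIV (\<lambda>_. coin) J (PiE J A)) =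
      (\<Prod>j\<in>J. emeasure coin (A j))"
      unfolding bits_def[symmetric]
      by (subst emeasure_distr) (auto simp: prod_emb_UNIV vimage_def measurable_env measurable_cong_sets[OF sets_\<mu> refl])
  qed simp
qed

lemma AE_marked_path: "AE \<zeta> in \<mu>. \<forall>k. marked e k (\<lambda>s. snd (\<zeta> s))"
  by (rule AE_distrD[of "\<lambda>\<zeta> s. snd (\<zeta> s)" _ bits])
     (simp add: measurable_env measurable_cong_sets[OF sets_\<mu> refl], unfold distr_env, rule AE_marked[OF e_pos])

definition prob_up :: "int \<Rightarrow> bool \<Rightarrow> (int \<Rightarrow> bool \<times> bool) \<Rightarrow> real" where
  "prob_up t w \<zeta> = (1 + past_drift w (path_past t \<zeta>)) / 2"

lemma prob_up_bounds: "0 < prob_up t w \<zeta>" "prob_up t w \<zeta> < 1"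
  using past_drift_bound[of w "path_past t \<zeta>"] by (auto simp: prob_up_def abs_less_iff)

lemma measurable_prob_up [measurable]: "prob_up t w \<in> borel_measurable path_space"
  unfolding prob_up_def[abs_def] by measurable

lemma depends_prob_up: "\<forall>s<t. \<zeta> s = \<zeta>' s \<Longrightarrow> prob_up t w \<zeta> = prob_up t w \<zeta>'"
proof -
  assume "\<forall>s<t. \<zeta> s = \<zeta>' s"
  then have "path_past t \<zeta> = path_past t \<zeta>'" by (simp add: past_def)
  then show ?thesis by (simp add: prob_up_def)
qed

lemma prob_up_eq: "prob_up t (snd (\<zeta> t)) \<zeta> = (1 + D (\<lambda>s. snd (\<zeta> s)) t (\<lambda>s. fst (\<zeta> s))) / 2"
proof -
  have "fun_upd (\<lambda>s. snd (\<zeta> s)) t (snd (\<zeta> t)) = (\<lambda>s. snd (\<zeta> s))" by auto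
  then show ?thesis unfolding prob_up_def past_drift_past by simp
qed

text \<open>Now that marks exist almost surely, the value of \<open>gfun\<close> is explicit: 1/2
  for the bit times the probability of the spin given the bit.\<close>

lemma nn_integral_next:
  fixes G :: "(int \<Rightarrow> bool \<times> bool) \<Rightarrow> ennreal"
  assumes G [measurable]: "G \<in> borel_measurable path_space" and G1: "\<And>\<zeta>. G \<zeta> \<le> 1" and dep: "depends_past t G"
  shows "(\<integral>\<^sup>+\<zeta>. G \<zeta> * indicator {\<zeta>. \<zeta> t = (c, w)} \<zeta> \<partial>\<mu>) =
    (\<integral>\<^sup>+\<zeta>. G \<zeta> * ennreal ((if c then prob_up t w \<zeta> else 1 - prob_up t w \<zeta>) / 2) \<partial>\<mu>)"
proof -
  define f where "f \<zeta> = enn2real (G \<zeta>)" for \<zeta>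
  define p where "p \<zeta> = (if c then prob_up t w \<zeta> else 1 - prob_up t w \<zeta>) / 2" for \<zeta>
  have Gfin: "G \<zeta> < top" for \<zeta> using le_less_trans[OF G1[of \<zeta>], of top] by simp
  have Gf: "G \<zeta> = ennreal (f \<zeta>)" for \<zeta> using Gfin[of \<zeta>] by (simp add: f_def)
  have f [measurable]: "f \<in> borel_measurable path_space" unfolding f_def[abs_def] by measurable
  have p [measurable]: "p \<in> borel_measurable path_space" unfolding p_def[abs_def] by (cases c) measurable
  have f01: "0 \<le> f \<zeta>" "f \<zeta> \<le> 1" for \<zeta>
    using G1[of \<zeta>] unfolding Gf by (simp_all add: f_def)
  have p01: "0 \<le> p \<zeta>" "p \<zeta> \<le> 1" for \<zeta>
    using prob_up_bounds[of t w \<zeta>] by (auto simp: p_def)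
  have depf: "depends_past t f" using dep unfolding depends_past_def f_def by metis
  note i = integral_cond[OF f f01 depf, of "(c, w)"]
  have "(\<integral>\<^sup>+\<zeta>. G \<zeta> * indicator {\<zeta>. \<zeta> t = (c, w)} \<zeta> \<partial>\<mu>) =
    (\<integral>\<^sup>+\<zeta>. ennreal (f \<zeta> * indicator {\<zeta>. \<zeta> t = (c, w)} \<zeta>) \<partial>\<mu>)"
    by (rule nn_integral_cong) (simp add: Gf indicator_def)
  also have "\<dots> = ennreal (\<integral>\<zeta>. f \<zeta> * indicator {\<zeta>. \<zeta> t = (c, w)} \<zeta> \<partial>\<mu>)"
    by (rule nn_integral_eq_integral)
       (use f01 in \<open>auto intro!: \<mu>.integrable_const_bound[where B = 1] simp: indicator_def\<close>)
  also have "\<dots> = ennreal (\<integral>\<zeta>. f \<zeta> * p \<zeta> \<partial>\<mu>)"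
    unfolding i(2)[symmetric]
  proof (rule arg_cong[where f = ennreal], rule integral_cong_AE)
    show "AE \<zeta> in \<mu>. f \<zeta> * cond t (c, w) \<zeta> = f \<zeta> * p \<zeta>"
      using AE_cond[of t "(c, w)"] AE_marked_path
    proof eventually_elim
      case (elim \<zeta>)
      have "gfun e ks \<phi> h (c, w) (path_past t \<zeta>) = p \<zeta>"
        using gfun_eq[of "(c, w)" "path_past t \<zeta>"] marked_environment_past[of _ \<zeta>] elim(2)
        by (cases c) (simp_all add: p_def prob_up_def spin_def field_simps)
      then show ?case using elim(1) by simp
    qed
  qed (use i(1) in \<open>auto dest: borel_measurable_integrable\<close>)
  also have "\<dots> = (\<integral>\<^sup>+\<zeta>. ennreal (f \<zeta> * p \<zeta>) \<partial>\<mu>)"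
    by (rule nn_integral_eq_integral[symmetric])
       (use f01 p01 in \<open>auto intro!: \<mu>.integrable_const_bound[where B = 1] AE_I2 mult_le_one simp: abs_mult\<close>)
  also have "\<dots> = (\<integral>\<^sup>+\<zeta>. G \<zeta> * ennreal (p \<zeta>) \<partial>\<mu>)"
    by (rule nn_integral_cong) (simp add: Gf ennreal_mult f01 p01)
  finally show ?thesis by (simp add: p_def)
qed

end

section \<open>Reconstruction of the uniform variables from the process and auxiliary noise\<close>

context specified_measure
begin

sublocale pm: pair_prob_space \<mu> noise ..

text \<open>
  Conditionally on the spin at t, the uniform variable is distributed on one of the two
  subintervals cut off by the probability of a positive spin, and it is obtained by rescaling
  an auxiliary uniform v.
\<close>

definition lifted :: "int \<Rightarrow> (int \<Rightarrow> bool \<times> bool) \<Rightarrow> real \<Rightarrow> real" where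
  "lifted t \<zeta> v = (if fst (\<zeta> t) then v * prob_up t (snd (\<zeta> t)) \<zeta>
     else prob_up t (snd (\<zeta> t)) \<zeta> + (1 - prob_up t (snd (\<zeta> t)) \<zeta>) * v)"

definition lift :: "(int \<Rightarrow> bool \<times> bool) \<times> (int \<Rightarrow> real) \<Rightarrow> (int \<Rightarrow> bool) \<times> (int \<Rightarrow> real)" where
  "lift p = ((\<lambda>s. snd (fst p s)), (\<lambda>s. lifted s (fst p) (snd p s)))"

lemma measurable_prob_up_env [measurable]: "(\<lambda>\<zeta>. prob_up t (snd (\<zeta> t)) \<zeta>) \<in> borel_measurable path_space"
  by (rule measurable_compose_countable[OF _ measurable_snd_path, where f = "\<lambda>w. prob_up t w"])
     (rule measurable_prob_up)

lemma measurable_lifted: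
  assumes f [measurable]: "f \<in> measurable M path_space" and g [measurable]: "g \<in> borel_measurable M"
  shows "(\<lambda>p. lifted t (f p) (g p)) \<in> borel_measurable M"
proof -
  have [measurable]: "Measurable.pred M (\<lambda>p. fst (f p t))"
    by (rule measurable_compose[OF f measurable_fst_path])
  have [measurable]: "(\<lambda>p. prob_up t (snd (f p t)) (f p)) \<in> borel_measurable M"
    by (rule measurable_compose[OF f measurable_prob_up_env])
  show ?thesis unfolding lifted_def by measurable
qed

text \<open>Given everything before T, the bit and the lifted variable at T are an independent pair
  of a fair coin and a uniform variable. The auxiliary variable is integrated out for a fixed spin,
  and averaging over the spin with its conditional probabilities reassembles the uniform
  law.\<close>

lemma nn_integral_next_lifted:
  fixes E :: "(int \<Rightarrow> bool \<times> bool) \<Rightarrow> (int \<Rightarrow> real) \<Rightarrow> ennreal"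
  assumes E: "(\<lambda>p. E (fst p) (snd p)) \<in> borel_measurable (path_space \<Otimes>\<^sub>M noise)"
    and E1: "\<And>\<zeta> V. E \<zeta> V \<le> 1"
    and dep: "\<And>\<zeta> \<zeta>' V V'. (\<And>s. s < T \<Longrightarrow> \<zeta> s = \<zeta>' s) \<Longrightarrow> (\<And>s. s < T \<Longrightarrow> V s = V' s) \<Longrightarrow> E \<zeta> V = E \<zeta>' V'"
    and A: "A \<in> sets borel"
  shows "(\<integral>\<^sup>+p. E (fst p) (snd p) * (indicator B (snd (fst p T)) * indicator A (lifted T (fst p) (snd p T))) \<partial>(\<mu> \<Otimes>\<^sub>M noise)) =
    emeasure coin B * emeasure unif A * (\<integral>\<^sup>+p. E (fst p) (snd p) \<partial>(\<mu> \<Otimes>\<^sub>M noise))"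
proof -
  note [measurable] = A
  interpret unif: prob_space unif by (rule prob_space_unif)
  interpret coin: prob_space coin by (rule prob_space_coin)
  \<comment> \<open>The conditional probability that the lifted variable falls into A, given the
    spin c and the threshold q.\<close>
  define \<kappa> where "\<kappa> c q = (\<integral>\<^sup>+v. indicator A (if c then v * q else q + (1 - q) * v) \<partial>unif)" for c and q :: real
  have \<kappa> [measurable]: "\<kappa> c \<in> borel_measurable borel" for c
    unfolding \<kappa>_def[abs_def] by (rule unif.borel_measurable_nn_integral) measurable
  have \<kappa>1: "\<kappa> c q \<le> 1" for c q
  proof -
    have "\<kappa> c q \<le> (\<integral>\<^sup>+v. 1 \<partial>unif)" unfolding \<kappa>_def by (rule nn_integral_mono) (simp add: indicator_def)
    then show ?thesis using unif.emeasure_space_1 by simp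
  qed
  have \<kappa>_sum: "ennreal q * \<kappa> True q + ennreal (1 - q) * \<kappa> False q = emeasure unif A" if "0 < q" "q < 1" for q
  proof -
    note sets_rescale[OF A, of q]
    then have "\<kappa> True q = emeasure unif {v. v * q \<in> A}" "\<kappa> False q = emeasure unif {v. q + (1 - q) * v \<in> A}"
      unfolding \<kappa>_def by (simp_all add: nn_integral_indicator[symmetric] indicator_def del: nn_integral_indicator)
    then show ?thesis using emeasure_unif_split[OF that A] by simp
  qed
  have E\<mu> [measurable]: "(\<lambda>p. E (fst p) (snd p)) \<in> borel_measurable (\<mu> \<Otimes>\<^sub>M noise)"
    using E by (simp cong: measurable_cong_sets sets_pair_measure_cong)
  have EV [measurable]: "(\<lambda>V. E \<zeta> V) \<in> borel_measurable noise" for \<zeta>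
    using measurable_compose[OF measurable_Pair1' E\<mu>, of \<zeta>] by simp
  have E\<zeta> [measurable]: "(\<lambda>\<zeta>. E \<zeta> V) \<in> borel_measurable path_space" for V
    using measurable_compose[OF measurable_Pair2' E, of V] by simp
  define R where "R \<zeta> = indicator B (snd (\<zeta> T)) * \<kappa> (fst (\<zeta> T)) (prob_up T (snd (\<zeta> T)) \<zeta>)"
    for \<zeta> :: "int \<Rightarrow> bool \<times> bool"
  have R [measurable]: "R \<in> borel_measurable path_space"
  proof -
    have "(\<lambda>\<zeta>. \<kappa> (fst (\<zeta> T)) (prob_up T (snd (\<zeta> T)) \<zeta>)) \<in> borel_measurable path_space"
      by (rule measurable_compose_countable[OF _ measurable_fst_path, where f = "\<lambda>c \<zeta>. \<kappa> c (prob_up T (snd (\<zeta> T)) \<zeta>)"])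
         measurable
    then show ?thesis unfolding R_def[abs_def] by measurable
  qed
  have lift_m [measurable]: "(\<lambda>p. lifted T (fst p) (snd p T)) \<in> borel_measurable (\<mu> \<Otimes>\<^sub>M noise)"
    by (rule measurable_lifted) (auto simp: measurable_cong_sets[OF refl sets_\<mu>[symmetric]])
  have B_m [measurable]: "(\<lambda>p. indicator B (snd (fst p T)) :: ennreal) \<in> borel_measurable (\<mu> \<Otimes>\<^sub>M noise)"
    by (rule measurable_compose[OF measurable_fst])
       (simp add: measurable_cong_sets[OF sets_\<mu> refl] measurable_compose[OF measurable_snd_path])
  have "(\<integral>\<^sup>+p. E (fst p) (snd p) * (indicator B (snd (fst p T)) * indicator A (lifted T (fst p) (snd p T))) \<partial>(\<mu> \<Otimes>\<^sub>M noise)) =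
    (\<integral>\<^sup>+\<zeta>. (\<integral>\<^sup>+V. E \<zeta> V * (indicator B (snd (\<zeta> T)) * indicator A (lifted T \<zeta> (V T))) \<partial>noise) \<partial>\<mu>)"
    by (subst noise.nn_integral_fst[symmetric]) simp_all
  also have "\<dots> = (\<integral>\<^sup>+\<zeta>. (\<integral>\<^sup>+V. E \<zeta> V * R \<zeta> \<partial>noise) \<partial>\<mu>)"
  proof (rule nn_integral_cong)
    fix \<zeta>
    have [measurable]: "lifted T \<zeta> \<in> borel_measurable borel" unfolding lifted_def[abs_def] by measurable
    have "lifted T \<zeta> \<in> borel_measurable unif" by (simp add: measurable_cong_sets[OF sets_unif refl])
    then have f_m: "(\<lambda>v. indicator A (lifted T \<zeta> v) :: ennreal) \<in> borel_measurable unif"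
      by (rule measurable_compose[OF _ borel_measurable_indicator[OF A]])
    have "(\<lambda>V. E \<zeta> V * (indicator B (snd (\<zeta> T)) * indicator A (lifted T \<zeta> (V T)))) \<in> borel_measurable noise"
      by measurable
    then have "(\<integral>\<^sup>+V. E \<zeta> V * (indicator B (snd (\<zeta> T)) * indicator A (lifted T \<zeta> (V T))) \<partial>noise) =
      (\<integral>\<^sup>+V. (\<integral>\<^sup>+v. E \<zeta> (fun_upd V T v) * (indicator B (snd (\<zeta> T)) * indicator A (lifted T \<zeta> (fun_upd V T v T))) \<partial>unif) \<partial>noise)"
      unfolding noise_def by (rule nn_integral_PiM_resample[OF prob_space_unif])
    also have "\<dots> = (\<integral>\<^sup>+V. E \<zeta> V * R \<zeta> \<partial>noise)"
    proof (rule nn_integral_cong)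
      fix V
      have "E \<zeta> (fun_upd V T v) = E \<zeta> V" for v by (rule dep) auto
      then have "(\<integral>\<^sup>+v. E \<zeta> (fun_upd V T v) * (indicator B (snd (\<zeta> T)) * indicator A (lifted T \<zeta> (fun_upd V T v T))) \<partial>unif) =
        E \<zeta> V * (indicator B (snd (\<zeta> T)) * (\<integral>\<^sup>+v. indicator A (lifted T \<zeta> v) \<partial>unif))"
        using f_m by (simp add: nn_integral_cmult)
      also have "(\<integral>\<^sup>+v. indicator A (lifted T \<zeta> v) \<partial>unif) = \<kappa> (fst (\<zeta> T)) (prob_up T (snd (\<zeta> T)) \<zeta>)"
        unfolding \<kappa>_def lifted_def ..
      finally show "(\<integral>\<^sup>+v. E \<zeta> (fun_upd V T v) * (indicator B (snd (\<zeta> T)) * indicator A (lifted T \<zeta> (fun_upd V T v T))) \<partial>unif) =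
        E \<zeta> V * R \<zeta>" unfolding R_def .
    qed
    finally show "(\<integral>\<^sup>+V. E \<zeta> V * (indicator B (snd (\<zeta> T)) * indicator A (lifted T \<zeta> (V T))) \<partial>noise) =
      (\<integral>\<^sup>+V. E \<zeta> V * R \<zeta> \<partial>noise)" .
  qed
  \<comment> \<open>For a fixed noise configuration the weight is a function of the path before T,
    to which the one-step law of \<mu> applies.\<close>
  also have "\<dots> = (\<integral>\<^sup>+V. (\<integral>\<^sup>+\<zeta>. E \<zeta> V * R \<zeta> \<partial>\<mu>) \<partial>noise)"
    by (rule pm.Fubini'[symmetric]) (simp add: case_prod_beta')
  also have "\<dots> = (\<integral>\<^sup>+V. emeasure coin B * emeasure unif A * (\<integral>\<^sup>+\<zeta>. E \<zeta> V \<partial>\<mu>) \<partial>noise)"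
  proof (rule nn_integral_cong)
    fix V
    let ?G = "\<lambda>c w \<zeta>. E \<zeta> V * \<kappa> c (prob_up T w \<zeta>)"
    have G: "?G c w \<in> borel_measurable path_space" for c w by measurable
    have G1: "?G c w \<zeta> \<le> 1" for c w \<zeta>
      using mult_mono[OF E1[of \<zeta> V] \<kappa>1[of c "prob_up T w \<zeta>"]] by simp
    have depG: "depends_past T (?G c w)" for c w
      unfolding depends_past_def using depends_prob_up dep by (metis (no_types, lifting))
    let ?I = "\<lambda>c w \<zeta>. ?G c w \<zeta> * indicator {\<zeta>. \<zeta> T = (c, w)} \<zeta>"
    have split: "E \<zeta> V * R \<zeta> = (\<Sum>w\<in>B. ?I True w \<zeta> +
        ?I False w \<zeta>)" for \<zeta>
    proof -
      obtain c w0 where z: "\<zeta> T = (c, w0)" by (cases "\<zeta> T")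
      have "(\<Sum>w\<in>B. ?I True w \<zeta> + ?I False w \<zeta>) =
        (\<Sum>w\<in>B. if w = w0 then ?G c w0 \<zeta> else 0)"
        by (rule sum.cong) (use z in \<open>cases c; auto simp: indicator_def\<close>)+
      also have "\<dots> = E \<zeta> V * R \<zeta>" using z by (simp add: R_def indicator_def)
      finally show ?thesis ..
    qed
    have "(\<integral>\<^sup>+\<zeta>. E \<zeta> V * R \<zeta> \<partial>\<mu>) =
      (\<Sum>w\<in>B. (\<integral>\<^sup>+\<zeta>. ?I True w \<zeta> \<partial>\<mu>) +
        (\<integral>\<^sup>+\<zeta>. ?I False w \<zeta> \<partial>\<mu>))"
      unfolding split by (subst nn_integral_sum) (auto simp: nn_integral_add)
    also have "\<dots> = (\<Sum>w\<in>B. (\<integral>\<^sup>+\<zeta>. E \<zeta> V \<partial>\<mu>) * emeasure unif A / 2)"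
    proof (rule sum.cong[OF refl])
      fix w
      let ?q = "\<lambda>\<zeta>. prob_up T w \<zeta>"
      have half: "ennreal (x / 2) = ennreal x / 2" if "0 \<le> x" for x
        using divide_ennreal[of x 2] that by simp
      have "(\<integral>\<^sup>+\<zeta>. ?I True w \<zeta> \<partial>\<mu>) +
        (\<integral>\<^sup>+\<zeta>. ?I False w \<zeta> \<partial>\<mu>) =
        (\<integral>\<^sup>+\<zeta>. ?G True w \<zeta> * ennreal (?q \<zeta> / 2) \<partial>\<mu>) + (\<integral>\<^sup>+\<zeta>. ?G False w \<zeta> * ennreal ((1 - ?q \<zeta>) / 2) \<partial>\<mu>)"
        using nn_integral_next[OF G G1 depG, of True w True w] nn_integral_next[OF G G1 depG, of False w False w] by simp
      also have "\<dots> = (\<integral>\<^sup>+\<zeta>. ?G True w \<zeta> * ennreal (?q \<zeta> / 2) + ?G False w \<zeta> * ennreal ((1 - ?q \<zeta>) / 2) \<partial>\<mu>)"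
        by (rule nn_integral_add[symmetric]) auto
      also have "\<dots> = (\<integral>\<^sup>+\<zeta>. E \<zeta> V * (emeasure unif A / 2) \<partial>\<mu>)"
      proof (rule nn_integral_cong)
        fix \<zeta>
        have "?G True w \<zeta> * ennreal (?q \<zeta> / 2) + ?G False w \<zeta> * ennreal ((1 - ?q \<zeta>) / 2) =
          E \<zeta> V * ((ennreal (?q \<zeta>) * \<kappa> True (?q \<zeta>) + ennreal (1 - ?q \<zeta>) * \<kappa> False (?q \<zeta>)) / 2)"
          using prob_up_bounds[of T w \<zeta>] by (simp add: half divide_ennreal_def distrib_left distrib_right mult_ac)
        then show "?G True w \<zeta> * ennreal (?q \<zeta> / 2) + ?G False w \<zeta> * ennreal ((1 - ?q \<zeta>) / 2) =
          E \<zeta> V * (emeasure unif A / 2)"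
          by (simp add: \<kappa>_sum prob_up_bounds)
      qed
      also have "\<dots> = (\<integral>\<^sup>+\<zeta>. E \<zeta> V \<partial>\<mu>) * emeasure unif A / 2"
        by (simp add: nn_integral_multc divide_ennreal_def mult_ac)
      finally show "(\<integral>\<^sup>+\<zeta>. ?I True w \<zeta> \<partial>\<mu>) +
        (\<integral>\<^sup>+\<zeta>. ?I False w \<zeta> \<partial>\<mu>) = (\<integral>\<^sup>+\<zeta>. E \<zeta> V \<partial>\<mu>) * emeasure unif A / 2" .
    qed
    also have "\<dots> = emeasure coin B * emeasure unif A * (\<integral>\<^sup>+\<zeta>. E \<zeta> V \<partial>\<mu>)"
    proof -
      have "emeasure coin B = of_nat (card B) / 2"
        using divide_ennreal[of "real (card B)" 2]
        by (simp add: coin.emeasure_eq_measure measure_coin ennreal_of_nat_eq_real_of_nat)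
      then show ?thesis by (simp add: divide_ennreal_def mult_ac)
    qed
    finally show "(\<integral>\<^sup>+\<zeta>. E \<zeta> V * R \<zeta> \<partial>\<mu>) = emeasure coin B * emeasure unif A * (\<integral>\<^sup>+\<zeta>. E \<zeta> V \<partial>\<mu>)" .
  qed
  also have "\<dots> = emeasure coin B * emeasure unif A * (\<integral>\<^sup>+V. (\<integral>\<^sup>+\<zeta>. E \<zeta> V \<partial>\<mu>) \<partial>noise)"
  proof (rule nn_integral_cmult)
    have "(\<lambda>q. E (snd q) (fst q)) \<in> borel_measurable (noise \<Otimes>\<^sub>M \<mu>)"
      using measurable_compose[OF measurable_pair_swap' E\<mu>] by (simp add: case_prod_beta')
    from \<mu>.borel_measurable_nn_integral_fst[OF this]
    show "(\<lambda>V. \<integral>\<^sup>+\<zeta>. E \<zeta> V \<partial>\<mu>) \<in> borel_measurable noise" by simp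
  qed
  also have "(\<integral>\<^sup>+V. (\<integral>\<^sup>+\<zeta>. E \<zeta> V \<partial>\<mu>) \<partial>noise) = (\<integral>\<^sup>+p. E (fst p) (snd p) \<partial>(\<mu> \<Otimes>\<^sub>M noise))"
    using pm.nn_integral_snd[OF E\<mu>] by simp
  finally show ?thesis .
qed

lemma measurable_lift: "lift \<in> measurable (\<mu> \<Otimes>\<^sub>M noise) seeds"
  unfolding lift_def[abs_def]
proof (rule measurable_Pair)
  show "(\<lambda>p s. snd (fst p s)) \<in> measurable (\<mu> \<Otimes>\<^sub>M noise) bits"
    by (rule measurable_compose[OF measurable_fst]) (simp add: measurable_env measurable_cong_sets[OF sets_\<mu> refl])
  have "(\<lambda>p. lifted s (fst p) (snd p s)) \<in> borel_measurable (\<mu> \<Otimes>\<^sub>M noise)" for s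
    by (rule measurable_lifted) (auto simp: measurable_cong_sets[OF refl sets_\<mu>[symmetric]])
  then have "(\<lambda>p s. lifted s (fst p) (snd p s)) \<in> measurable (\<mu> \<Otimes>\<^sub>M noise) (PiM UNIV (\<lambda>_. borel))"
    by (rule measurable_abs_UNIV)
  then show "(\<lambda>p s. lifted s (fst p) (snd p s)) \<in> measurable (\<mu> \<Otimes>\<^sub>M noise) noise"
    by (simp add: measurable_cong_sets[OF refl sets_noise])
qed

lemma depends_lifted: "(\<And>s. s \<le> t \<Longrightarrow> \<zeta> s = \<zeta>' s) \<Longrightarrow> lifted t \<zeta> v = lifted t \<zeta>' v"
  using depends_prob_up[of t \<zeta> \<zeta>'] by (simp add: lifted_def)

text \<open>Removing the latest time of a finite set at each step, the bits and lifted variables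
  factorize into independent pairs. So the lifted seeds have exactly the law of the original
  seeds.\<close>

lemma distr_lift: "distr (\<mu> \<Otimes>\<^sub>M noise) seeds lift = seeds"
proof (rule joint_eqI)
  fix J :: "int set" and A :: "int \<Rightarrow> bool set" and B :: "int \<Rightarrow> real set"
  assume J: "finite J" and B: "\<And>j. j \<in> J \<Longrightarrow> B j \<in> sets borel"
  define S where "S J = {p. \<forall>j\<in>J. snd (fst p j) \<in> A j \<and> lifted j (fst p) (snd p j) \<in> B j}" for J
  have S: "S J \<in> sets (path_space \<Otimes>\<^sub>M noise)" if "finite J" "\<And>j. j \<in> J \<Longrightarrow> B j \<in> sets borel" for J
  proof -
    have "{p \<in> space (path_space \<Otimes>\<^sub>M noise). snd (fst p j) \<in> A j \<and> lifted j (fst p) (snd p j) \<in> B j}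
        \<in> sets (path_space \<Otimes>\<^sub>M noise)" if "j \<in> J" for j
    proof -
      have [measurable]: "B j \<in> sets borel" using \<open>\<And>j. j \<in> J \<Longrightarrow> B j \<in> sets borel\<close> that .
      have [measurable]: "(\<lambda>p. lifted j (fst p) (snd p j)) \<in> borel_measurable (path_space \<Otimes>\<^sub>M noise)"
        by (rule measurable_lifted) auto
      have [measurable]: "(\<lambda>p :: (int \<Rightarrow> bool \<times> bool) \<times> (int \<Rightarrow> real). snd (fst p j)) \<in> measurable (path_space \<Otimes>\<^sub>M noise) (count_space UNIV)"
        by (rule measurable_compose[OF measurable_fst measurable_snd_path])
      show ?thesis by measurable
    qed
    then have "{p \<in> space (path_space \<Otimes>\<^sub>M noise). \<forall>j\<in>J. snd (fst p j) \<in> A j \<and> lifted j (fst p) (snd p j) \<in> B j}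
        \<in> sets (path_space \<Otimes>\<^sub>M noise)"
      using \<open>finite J\<close> by (intro sets.sets_Collect_finite_All) auto
    then show ?thesis by (simp add: S_def space_pair_measure)
  qed
  have sM: "sets (\<mu> \<Otimes>\<^sub>M noise) = sets (path_space \<Otimes>\<^sub>M noise)"
    by (intro sets_pair_measure_cong sets_\<mu> refl)
  have "emeasure (\<mu> \<Otimes>\<^sub>M noise) (S J) = (\<Prod>j\<in>J. emeasure coin (A j) * emeasure unif (B j))"
    using J B
  proof (induction J rule: finite_linorder_max_induct)
    case empty
    then show ?case using pm.P.emeasure_space_1 by (simp add: S_def space_pair_measure)
  next
    case (insert b J)
    have SJ: "S J \<in> sets (path_space \<Otimes>\<^sub>M noise)" "S (insert b J) \<in> sets (path_space \<Otimes>\<^sub>M noise)"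
      using insert by (auto intro!: S)
    define E where "E \<zeta> V = (indicator (S J) (\<zeta>, V) :: ennreal)" for \<zeta> V
    have "emeasure (\<mu> \<Otimes>\<^sub>M noise) (S (insert b J)) = (\<integral>\<^sup>+p. indicator (S (insert b J)) p \<partial>(\<mu> \<Otimes>\<^sub>M noise))"
      using SJ sM by simp
    also have "\<dots> = (\<integral>\<^sup>+p. E (fst p) (snd p) * (indicator (A b) (snd (fst p b)) *
        indicator (B b) (lifted b (fst p) (snd p b))) \<partial>(\<mu> \<Otimes>\<^sub>M noise))"
      by (rule nn_integral_cong) (auto simp: E_def S_def indicator_def)
    also have "\<dots> = emeasure coin (A b) * emeasure unif (B b) * (\<integral>\<^sup>+p. E (fst p) (snd p) \<partial>(\<mu> \<Otimes>\<^sub>M noise))"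
    proof (rule nn_integral_next_lifted)
      show "(\<lambda>p. E (fst p) (snd p)) \<in> borel_measurable (path_space \<Otimes>\<^sub>M noise)"
        unfolding E_def using SJ(1) by simp
      show "E \<zeta> V \<le> 1" for \<zeta> V by (simp add: E_def indicator_def)
      show "B b \<in> sets borel" using insert.prems by simp
      fix \<zeta> \<zeta>' :: "int \<Rightarrow> bool \<times> bool" and V V' :: "int \<Rightarrow> real"
      assume *: "\<And>s. s < b \<Longrightarrow> \<zeta> s = \<zeta>' s" "\<And>s. s < b \<Longrightarrow> V s = V' s"
      have "\<zeta> j = \<zeta>' j \<and> lifted j \<zeta> (V j) = lifted j \<zeta>' (V' j)" if "j \<in> J" for j
      proof -
        have "j < b" using insert.hyps that by blast
        then have "lifted j \<zeta> (V j) = lifted j \<zeta>' (V j)" by (intro depends_lifted *(1)) simp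
        then show ?thesis using *[of j] \<open>j < b\<close> by simp
      qed
      then have "(\<zeta>, V) \<in> S J \<longleftrightarrow> (\<zeta>', V') \<in> S J" by (simp add: S_def)
      then show "E \<zeta> V = E \<zeta>' V'" by (simp add: E_def indicator_def)
    qed
    also have "(\<integral>\<^sup>+p. E (fst p) (snd p) \<partial>(\<mu> \<Otimes>\<^sub>M noise)) = emeasure (\<mu> \<Otimes>\<^sub>M noise) (S J)"
      unfolding E_def using SJ sM by simp
    also have "\<dots> = (\<Prod>j\<in>J. emeasure coin (A j) * emeasure unif (B j))"
      using insert by simp
    finally show ?case using insert.hyps by (subst prod.insert) auto
  qed
  moreover have "emeasure (distr (\<mu> \<Otimes>\<^sub>M noise) seeds lift) {p. \<forall>j\<in>J. fst p j \<in> A j \<and> snd p j \<in> B j} =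
    emeasure (\<mu> \<Otimes>\<^sub>M noise) (S J)"
  proof -
    have "{p \<in> space seeds. fst p j \<in> A j \<and> snd p j \<in> B j} \<in> sets seeds" if "j \<in> J" for j
    proof -
      have [measurable]: "B j \<in> sets borel" using B[OF that] .
      have [measurable]: "(\<lambda>p. fst p j) \<in> measurable seeds (count_space UNIV)"
        by (rule measurable_compose[OF measurable_fst measurable_bit])
      have [measurable]: "(\<lambda>p. snd p j) \<in> borel_measurable seeds"
        by (rule measurable_compose[OF measurable_snd measurable_noise])
      show ?thesis by measurable
    qed
    then have "{p \<in> space seeds. \<forall>j\<in>J. fst p j \<in> A j \<and> snd p j \<in> B j} \<in> sets seeds"
      using J by (intro sets.sets_Collect_finite_All) auto
    then show ?thesis
      by (subst emeasure_distr[OF measurable_lift])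
         (simp_all add: space_pair_measure lift_def S_def vimage_def)
  qed
  ultimately show "emeasure (distr (\<mu> \<Otimes>\<^sub>M noise) seeds lift) {p. \<forall>j\<in>J. fst p j \<in> A j \<and> snd p j \<in> B j} =
    (\<Prod>j\<in>J. emeasure coin (A j) * emeasure unif (B j))" by simp
qed simp

text \<open>The value 0 is excluded because a negative spin needs a lifted variable strictly above
  the threshold.\<close>

lemma AE_noise_unit: "AE V in noise. \<forall>t. 0 < V t \<and> V t \<le> 1"
  unfolding AE_all_countable
proof
  fix t
  have "AE v in unif. 0 < v \<and> v \<le> (1::real)"
    unfolding unif_def
    by (subst AE_uniform_measure, simp, simp, use AE_lborel_singleton[of "0::real"] in eventually_elim) auto
  then show "AE V in noise. 0 < V t \<and> V t \<le> 1"
    by (intro AE_distrD[of "\<lambda>U. U t" noise unif])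
       (simp add: measurable_cong_sets[OF refl sets_unif], simp only: distr_noise_component)
qed

lemma lift_fixed_point:
  assumes "0 < V t" "V t \<le> 1"
  shows "fst (\<zeta> t) \<longleftrightarrow> snd (lift (\<zeta>, V)) t \<le> (1 + D (fst (lift (\<zeta>, V))) t (\<lambda>s. fst (\<zeta> s))) / 2"
proof -
  define q where "q = prob_up t (snd (\<zeta> t)) \<zeta>"
  have q: "0 < q" "q < 1" by (simp_all add: q_def prob_up_bounds)
  have "V t * q \<le> q" using assms q by (simp add: mult_le_cancel_right1)
  moreover have "0 < (1 - q) * V t" using assms q by simp
  ultimately have "fst (\<zeta> t) \<longleftrightarrow> lifted t \<zeta> (V t) \<le> q"
    by (auto simp: lifted_def q_def[symmetric])
  then show ?thesis using prob_up_eq[of t \<zeta>] by (simp add: lift_def q_def)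
qed

text \<open>The lifted seeds have the law of the seeds, so the extremal solutions driven by them
  coincide almost surely. The spins of the process solve the same rule and are squeezed between the
  two. Hence the process is \<open>config\<close> applied to the lifted seeds, and its law is that
  of \<open>config\<close>.\<close>

lemma eq_law:
  assumes coalesce: "AE p in seeds. \<forall>t. top_spins (fst p) (snd p) t = bot_spins (fst p) (snd p) t"
  shows "\<mu> = law"
proof -
  have c: "AE p in \<mu> \<Otimes>\<^sub>M noise. \<forall>t. top_spins (fst (lift p)) (snd (lift p)) t = bot_spins (fst (lift p)) (snd (lift p)) t"
    by (rule AE_distrD[OF measurable_lift]) (unfold distr_lift, rule coalesce)
  have v: "AE p in \<mu> \<Otimes>\<^sub>M noise. \<forall>t. 0 < snd p t \<and> snd p t \<le> 1"
  proof (rule pm.AE_pair_measure)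
    have [measurable]: "(\<lambda>p. snd p t) \<in> borel_measurable (\<mu> \<Otimes>\<^sub>M noise)" for t
      by (rule measurable_compose[OF measurable_snd measurable_noise])
    show "{p \<in> space (\<mu> \<Otimes>\<^sub>M noise). \<forall>t. 0 < snd p t \<and> snd p t \<le> 1} \<in> sets (\<mu> \<Otimes>\<^sub>M noise)" by measurable
    show "AE \<zeta> in \<mu>. AE V in noise. \<forall>t. 0 < snd (\<zeta>, V) t \<and> snd (\<zeta>, V) t \<le> 1"
      using AE_noise_unit by simp
  qed
  have "AE p in \<mu> \<Otimes>\<^sub>M noise. fst p = config (lift p)"
    using c v
  proof eventually_elim
    case (elim p)
    obtain \<zeta> V where p: "p = (\<zeta>, V)" by (cases p)
    have fp: "fst (\<zeta> t) \<longleftrightarrow> snd (lift p) t \<le> (1 + D (fst (lift p)) t (\<lambda>s. fst (\<zeta> s))) / 2" for t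
      unfolding p by (rule lift_fixed_point) (use elim(2) in \<open>auto simp: p\<close>)
    have "fst (\<zeta> t) = top_spins (fst (lift p)) (snd (lift p)) t" for t
      using fixed_point_bounds[of "\<lambda>s. fst (\<zeta> s)" "snd (lift p)" "fst (lift p)" t, OF fp] elim(1) by blast
    moreover have "snd (\<zeta> t) = fst (lift p) t" for t by (simp add: lift_def p)
    ultimately have "\<zeta> t = config (lift p) t" for t by (simp add: config_def prod_eq_iff)
    then show ?case by (simp add: p fun_eq_iff)
  qed
  then have "distr (\<mu> \<Otimes>\<^sub>M noise) path_space fst = distr (\<mu> \<Otimes>\<^sub>M noise) path_space (\<lambda>p. config (lift p))"
    by (intro distr_cong_AE measurable_compose[OF measurable_lift measurable_config])
       (auto simp: measurable_cong_sets[OF refl sets_\<mu>[symmetric]])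
  also have "\<dots> = distr (distr (\<mu> \<Otimes>\<^sub>M noise) seeds lift) path_space config"
    by (subst distr_distr[OF measurable_config measurable_lift]) (simp add: comp_def)
  also have "\<dots> = law" unfolding distr_lift law_def ..
  also have "distr (\<mu> \<Otimes>\<^sub>M noise) path_space fst = distr (\<mu> \<Otimes>\<^sub>M noise) \<mu> fst"
    by (rule distr_cong) simp_all
  finally show ?thesis using noise.distr_pair_fst[of \<mu>] by simp
qed

end

context lipschitz_bramson_kalikow
begin

lemma AE_joint_coalesce:
  "AE p in seeds. \<forall>t. top_spins (fst p) (snd p) t = bot_spins (fst p) (snd p) t"
proof (rule joint.AE_pair_measure)
  have [measurable]: "(\<lambda>p. top_spins (fst p) (snd p) t) \<in> measurable seeds (count_space UNIV)" for t
    by (rule measurable_top_spins) measurable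
  have [measurable]: "(\<lambda>p. bot_spins (fst p) (snd p) t) \<in> measurable seeds (count_space UNIV)" for t
    by (rule measurable_bot_spins) measurable
  show "{p \<in> space seeds. \<forall>t. top_spins (fst p) (snd p) t = bot_spins (fst p) (snd p) t} \<in> sets seeds"
    by measurable
  show "AE \<omega> in bits. AE U in noise. \<forall>t. top_spins (fst (\<omega>, U)) (snd (\<omega>, U)) t = bot_spins (fst (\<omega>, U)) (snd (\<omega>, U)) t"
    using AE_marked[OF e_pos] AE_eventually_mark_count[OF e_pos] AE_eventually_gap[OF e_pos]
  proof eventually_elim
    case (elim \<omega>)
    then show ?case unfolding AE_all_countable by (auto intro!: AE_noise_coalesce)
  qed
qed

end

theorem theorem3:
  fixes e :: real
  assumes "0 < e" and "e < 1"
  shows "\<exists>K. \<forall>ks\<ge>K. \<forall>(\<phi> :: real \<Rightarrow> real) (h :: nat \<Rightarrow> real).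
           \<phi> ` {-1..1} \<subseteq> {-1..1} \<and> mono_on {-1..1} \<phi> \<and> (\<forall>z\<in>{-1..1}. \<phi> (- z) = - \<phi> z) \<and>
           (\<exists>\<delta>>0. \<exists>L>0. \<forall>z1\<in>{-\<delta>..\<delta>} \<inter> {-1..1}. \<forall>z2\<in>{-\<delta>..\<delta>} \<inter> {-1..1}.
              \<bar>\<phi> z2 - \<phi> z1\<bar> \<le> L * \<bar>z2 - z1\<bar>) \<and>
           (\<forall>k\<ge>ks. 0 < h k) \<and> (\<forall>k\<ge>ks. h (Suc k) \<le> h k) \<and> h \<longlonglongrightarrow> 0 \<and> h ks < 1 \<longrightarrow>
           (\<exists>!\<mu>. sets \<mu> = sets (path_space :: (int \<Rightarrow> bool \<times> bool) measure) \<and>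
                 process \<mu> (\<lambda>t z. z t) \<and>
                 stationary \<mu> (\<lambda>t z. z t) \<and>
                 specified_by \<mu> (\<lambda>t z. z t) (gfun e ks \<phi> h))"
proof (intro exI[of _ 0] allI impI, elim conjE exE)
  fix ks and \<phi> :: "real \<Rightarrow> real" and h :: "nat \<Rightarrow> real" and \<delta> L :: real
  assume *: "\<phi> ` {-1..1} \<subseteq> {-1..1::real}" "mono_on {-1..1} \<phi>" "\<forall>z\<in>{-1..1}. \<phi> (- z) = - \<phi> z"
    "0 < \<delta>" "0 < L" "\<forall>z1\<in>{-\<delta>..\<delta>} \<inter> {-1..1}. \<forall>z2\<in>{-\<delta>..\<delta>} \<inter> {-1..1}. \<bar>\<phi> z2 - \<phi> z1\<bar> \<le> L * \<bar>z2 - z1\<bar>"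
    "\<forall>k\<ge>ks. 0 < h k" "\<forall>k\<ge>ks. h (Suc k) \<le> h k" "h \<longlonglongrightarrow> 0" "h ks < 1"
  interpret lipschitz_bramson_kalikow e ks \<phi> h \<delta> L
  proof unfold_locales
    show "\<phi> z \<in> {-1..1}" if "z \<in> {-1..1}" for z using *(1) that by (simp add: image_subset_iff)
    show "0 < h k" if "ks \<le> k" for k using *(7) that by simp
    show "h (Suc k) \<le> h k" if "ks \<le> k" for k using *(8) that by simp
    show "\<bar>\<phi> z2 - \<phi> z1\<bar> \<le> L * \<bar>z2 - z1\<bar>"
      if "z1 \<in> {-\<delta>..\<delta>} \<inter> {-1..1}" "z2 \<in> {-\<delta>..\<delta>} \<inter> {-1..1}" for z1 z2
      by (rule *(6)[THEN bspec, OF that(1), THEN bspec, OF that(2)])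
  qed (rule assms *)+
  show "\<exists>!\<mu>. sets \<mu> = sets (path_space :: (int \<Rightarrow> bool \<times> bool) measure) \<and>
                 process \<mu> (\<lambda>t z. z t) \<and> stationary \<mu> (\<lambda>t z. z t) \<and>
                 specified_by \<mu> (\<lambda>t z. z t) (gfun e ks \<phi> h)"
  proof (rule ex1I[of _ law])
    show "sets law = sets path_space \<and> process law (\<lambda>t z. z t) \<and> stationary law (\<lambda>t z. z t) \<and>
        specified_by law (\<lambda>t z. z t) (gfun e ks \<phi> h)"
      using process_law stationary_law specified_by_law by simp
    fix \<mu> :: "(int \<Rightarrow> bool \<times> bool) measure"
    assume \<mu>: "sets \<mu> = sets path_space \<and> process \<mu> (\<lambda>t z. z t) \<and> stationary \<mu> (\<lambda>t z. z t) \<and>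
        specified_by \<mu> (\<lambda>t z. z t) (gfun e ks \<phi> h)"
    interpret \<mu>: specified_measure e ks \<phi> h \<mu>
    proof (rule specified_measure.intro[OF bramson_kalikow_axioms specified_measure_axioms.intro])
      show "sets \<mu> = sets path_space" using \<mu> by (elim conjE)
      show "prob_space \<mu>" using \<mu> unfolding process_def by (elim conjE)
      show "specified_by \<mu> (\<lambda>t z. z t) (gfun e ks \<phi> h)" using \<mu> by (elim conjE)
    qed
    show "\<mu> = law" by (rule \<mu>.eq_law[OF AE_joint_coalesce])
  qed
qed

end
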